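(* Let a connected Lie group $G$ act freely and properly on the left on $Q$, fix a principal connection on $\pi_Q:Q\to Q/G$, and let $L\in C^\infty(T^1_kQ)$ be a regular, $G$-regular, $G$-invariant Lagrangian with reduced Lagrangian $l$ on $(T^1_kQ)/G$. Suppose that, on an open set of $t\in\mathbb R^k$: (1) $\breve\phi(t)=(q^i=\phi^i(t),v^i_\alpha=\phi^i_\alpha(t),w^a_\alpha=\phi^a_\alpha(t))$ is a solution of the Lagrange-Poincaré field equations $$\frac{\partial\phi^i}{\partial t^\alpha}=\phi^i_\alpha,\quad \frac{\partial}{\partial t^\alpha}\left(\frac{\partial l}{\partial v^i_\alpha}\right)-\frac{\partial l}{\partial q^i}=\left(K^b_{ik}\phi^k_\beta-\Upsilon^b_{ic}\phi^c_\beta\right)\frac{\partial l}{\partial w^b_\beta},\quad \frac{\partial}{\partial t^\alpha}\left(\frac{\partial l}{\partial w^a_\alpha}\right)=\left(\Upsilon^b_{ka}\phi^k_\beta-C^b_{ac}\phi^c_\beta\right)\frac{\partial l}{\partial w^b_\beta}$$ (all terms evaluated along $\breve\phi$); (2) $\phi^a_H(t)$ is a solution of $$\frac{\partial\phi^a_H}{\partial t^\alpha}=-\phi^i_\gamma\Big(K^a_b\big(\gamma^c_iA^b_c\,\delta^\gamma_\alpha+\tilde B^{\gamma b}_{\alpha i}\big)\circ\breve\phi_H\Big),$$ where $\breve\phi_H(t)\in T^1_kQ$ is the point with coordinates $(q^i=\phi^i(t),q^a=\phi^a_H(t),v^i_\alpha=\phi^i_\alpha(t),w^a_\alpha=\phi^a_\alpha(t))$;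 (3) $g(t)\in G$ is a solution of the reconstruction equation $$(g^{-1}g^{(1)})_\alpha=\Big(\big(v^a_\alpha+v^i_\gamma\tilde B^{\gamma a}_{\alpha i}\big)\circ\breve\phi_H\Big)E_a,\qquad \alpha=1,\dots,k.$$ Then $\phi(t)=g(t)\breve\phi_H(t)$ is a solution of the Euler-Lagrange field equations of $L$, in the sense that $\phi$ is the first prolongation of the map $\varphi=\tau^1_Q\circ\phi$ into $Q$, and $\varphi$ satisfies $$\frac{\partial^2L}{\partial q^B\partial u^A_\alpha}\frac{\partial\varphi^B}{\partial t^\alpha}+\frac{\partial^2L}{\partial u^B_\beta\partial u^A_\alpha}\frac{\partial^2\varphi^B}{\partial t^\alpha\partial t^\beta}=\frac{\partial L}{\partial q^A}$$ with $(q^A,u^A_\alpha)=(\varphi^A(t),\partial\varphi^A/\partial t^\alpha(t))$.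
   Context: Everything is smooth; repeated indices are summed. $T^1_kQ=TQ\oplus\cdots\oplus TQ$ ($k$ copies), $\tau^1_Q:T^1_kQ\to Q$, natural coordinates $(q^A,u^A_\alpha)$, $\alpha=1,\dots,k$. The first prolongation of $\varphi:\mathbb R^k\supset U_0\to Q$ is $t\mapsto(T_t\varphi(\partial/\partial t^1),\dots,T_t\varphi(\partial/\partial t^k))$. $G$ acts on $T^1_kQ$ by $g\cdot(v_1,\dots,v_k)=(T\Phi_g v_1,\dots,T\Phi_g v_k)$, and $l$ is defined by $l\circ\pi_{T^1_kQ}=L$ with $\pi_{T^1_kQ}$ the quotient projection. $(g^{-1}g^{(1)})_\alpha=T_{g(t)}L_{g(t)^{-1}}(T_tg(\partial/\partial t^\alpha|_t))\in\mathfrak g$. Local frames. Over an open set $U\subset Q/G$ use a trivialization $\pi_Q^{-1}(U)\simeq U\times G$ with $\Phi_g(x,h)=(x,gh)$, coordinates $(q^i)$ on $U$ and $(q^a)$ on $G$. Let $\{E_a\}$ be a basis of the Lie algebra $\mathfrak g$, $[E_a,E_b]=C^c_{ab}E_c$. $\widetilde E_a=K^b_a\,\partial/\partial q^b$ is the fundamental vector field of $E_a$ on $Q$; $\widehat E_a=A^b_a\widetilde E_b$ is the $G$-invariant vertical vector field equal, in the trivialization, to the left-invariant vector field of $G$ determined by $E_a$. $X_i=\frac{\partial}{\partial q^i}-\gamma^b_i\widehat E_b$ ($\gamma^b_i$ functions of the $q^j$) is the horizontal lift of $\partial/\partial q^i$ for the principal connection. $\Upsilon^b_{ia}$ and $K^a_{ij}$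 are defined by $[X_i,\widehat E_a]=\Upsilon^b_{ia}\widehat E_b$ and $[X_i,X_j]=-K^a_{ij}\widehat E_a$ (the two-lower-index $K^a_{ij}$ are curvature components, distinct from the matrix $K^b_a$). For $\mathbf v=(v_\alpha)\in T^1_kQ$ over $q$ write $v_\alpha=v^i_\alpha X_i(q)+w^a_\alpha\widehat E_a(q)=v^i_\alpha X_i(q)+v^a_\alpha\widetilde E_a(q)$, so $v^a_\alpha=A^a_bw^b_\alpha$. $(q^i,q^a,v^i_\alpha,w^a_\alpha)$ are coordinates on $T^1_kQ$ and $(q^i,v^i_\alpha,w^a_\alpha)$ on $(T^1_kQ)/G$. Regularity. $L$ is regular if $\left(\frac{\partial^2L}{\partial u^A_\alpha\partial u^B_\beta}\right)$ is everywhere non-singular. For a vector field $Z=Z^A\partial/\partial q^A$ on $Q$ put $Z^{V_\alpha}=Z^A\partial/\partial u^A_\alpha$. Put $g^{\alpha\beta}_{ia}=X_i^{V_\alpha}(\widetilde E_a^{V_\beta}(L))$ and $g^{\alpha\beta}_{ab}=\widetilde E_a^{V_\alpha}(\widetilde E_b^{V_\beta}(L))$. $L$ is $G$-regular if the matrix $(g^{\alpha\beta}_{ab})$ (rows $(\alpha,a)$, columns $(\beta,b)$) is everywhere non-singular; its inverse is $(g^{ab}_{\alpha\beta})$, with $g^{\alpha\beta}_{ab}g^{ac}_{\alpha\gamma}=\delta^\beta_\gamma\delta^c_b$. Finally $\tilde B^{\gamma a}_{\alpha i}=g^{ba}_{\beta\alpha}g^{\gamma\beta}_{ib}$, a function on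 $T^1_kQ$. *)

theory Defs
  imports "HOL-Analysis.Analysis"
begin

section \<open>Coordinate spaces and smooth functions\<close>

text \<open>Coordinate spaces are types of class \<open>real_inner\<close> with a finite orthonormal basis \<open>B\<close>, whose
  elements label the coordinates \<open>z \<bullet> b\<close>. This is Euclidean space, but, in contrast to the class
  \<open>euclidean_space\<close>, dimension 0 is allowed, so that \<open>Q/G\<close> may be a point and \<open>G\<close> may be trivial.\<close>

definition coord_basis :: "'a::real_inner set \<Rightarrow> bool" where
  "coord_basis B \<longleftrightarrow> finite B \<and> span B = UNIV \<and> (\<forall>a\<in>B. \<forall>b\<in>B. a \<bullet> b = (if a = b then 1 else 0))"

definition pd :: "'a::real_normed_vector \<Rightarrow> ('a \<Rightarrow> 'b::real_normed_vector) \<Rightarrow> 'a \<Rightarrow> 'b" where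
  "pd d F z = frechet_derivative F (at z) d"

primrec Ck_on :: "nat \<Rightarrow> 'a set \<Rightarrow> ('a::real_normed_vector \<Rightarrow> 'b::real_normed_vector) \<Rightarrow> bool" where
  "Ck_on 0 S f \<longleftrightarrow> continuous_on S f"
| "Ck_on (Suc n) S f \<longleftrightarrow> (\<forall>x\<in>S. f differentiable (at x)) \<and> (\<forall>d. Ck_on n S (pd d f))"

text \<open>Only used for open \<open>S\<close>.\<close>

definition smooth_on :: "'a set \<Rightarrow> ('a::real_normed_vector \<Rightarrow> 'b::real_normed_vector) \<Rightarrow> bool" where
  "smooth_on S f \<longleftrightarrow> (\<forall>n. Ck_on n S f)"

definition nonsingular :: "'i set \<Rightarrow> ('i \<Rightarrow> 'i \<Rightarrow> real) \<Rightarrow> bool" where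
  "nonsingular S M \<longleftrightarrow>
     (\<exists>N. \<forall>r\<in>S. \<forall>c\<in>S. (\<Sum>s\<in>S. M r s * N s c) = (if r = c then 1 else 0) \<and>
                       (\<Sum>s\<in>S. N r s * M s c) = (if r = c then 1 else 0))"

section \<open>Manifolds\<close>

type_synonym ('p,'e) chart = "'p set \<times> ('p \<Rightarrow> 'e)"

abbreviation inv_chart :: "('p,'e) chart \<Rightarrow> 'e \<Rightarrow> 'p" where
  "inv_chart c \<equiv> inv_into (fst c) (snd c)"

abbreviation chart_image :: "('p,'e) chart \<Rightarrow> 'e set" where
  "chart_image c \<equiv> snd c ` fst c"

definition is_chart :: "('p::topological_space,'e::real_inner) chart \<Rightarrow> bool" where
  "is_chart c \<longleftrightarrow> open (fst c) \<and> open (chart_image c) \<and>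
     homeomorphism (fst c) (chart_image c) (snd c) (inv_chart c)"

definition compatible :: "('p,'e::real_inner) chart \<Rightarrow> ('p,'e) chart \<Rightarrow> bool" where
  "compatible c d \<longleftrightarrow> smooth_on (snd c ` (fst c \<inter> fst d)) (snd d \<circ> inv_chart c) \<and>
                      smooth_on (snd d ` (fst c \<inter> fst d)) (snd c \<circ> inv_chart d)"

text \<open>The maximal atlas generated by \<open>A\<close>.\<close>

definition admissible :: "('p::topological_space,'e::real_inner) chart set \<Rightarrow> ('p,'e) chart set" where
  "admissible A = {c. is_chart c \<and> (\<forall>d\<in>A. compatible c d)}"

definition charts_at :: "('p::topological_space,'e::real_inner) chart set \<Rightarrow> 'p \<Rightarrow> ('p,'e) chart set" where
  "charts_at A p = {c \<in> admissible A. p \<in> fst c}"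

definition smooth_manifold ::
    "'e::real_inner set \<Rightarrow> ('p::{t2_space,second_countable_topology},'e) chart set \<Rightarrow> bool" where
  "smooth_manifold B A \<longleftrightarrow> coord_basis B \<and> (\<Union>c\<in>A. fst c) = UNIV \<and>
     (\<forall>c\<in>A. is_chart c) \<and> (\<forall>c\<in>A. \<forall>d\<in>A. compatible c d)"

definition std_atlas :: "('e::real_inner,'e) chart set" where
  "std_atlas = {(UNIV, id)}"

definition prod_atlas :: "('p,'e) chart set \<Rightarrow> ('q,'f) chart set \<Rightarrow> ('p \<times> 'q, 'e \<times> 'f) chart set" where
  "prod_atlas A B = {(fst c \<times> fst d, map_prod (snd c) (snd d)) | c d. c \<in> A \<and> d \<in> B}"

definition smooth_map_on ::
    "('p::topological_space,'e::real_inner) chart set \<Rightarrow> ('q::topological_space,'f::real_inner) chart set \<Rightarrow>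
     'p set \<Rightarrow> ('p \<Rightarrow> 'q) \<Rightarrow> bool" where
  "smooth_map_on A B W f \<longleftrightarrow> open W \<and> continuous_on W f \<and>
     (\<forall>c\<in>A. \<forall>d\<in>B. smooth_on (snd c ` (fst c \<inter> W \<inter> f -` fst d)) (snd d \<circ> f \<circ> inv_chart c))"

section \<open>Tangent vectors and vector fields\<close>

text \<open>A tangent vector at \<open>p\<close> is the family of its components in all charts around \<open>p\<close>, which
  transform by the Jacobians of the coordinate changes; the value is set to 0 on all other charts.
  The operations on tangent vectors (at one point) are pointwise.\<close>

type_synonym ('p,'e) tvec = "('p,'e) chart \<Rightarrow> 'e"

definition tangent_space ::
    "('p::topological_space,'e::real_inner) chart set \<Rightarrow> 'p \<Rightarrow> ('p,'e) tvec set" where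
  "tangent_space A p = {v.
     (\<forall>c\<in>charts_at A p. \<forall>d\<in>charts_at A p. v d = pd (v c) (snd d \<circ> inv_chart c) (snd c p)) \<and>
     (\<forall>c. c \<notin> charts_at A p \<longrightarrow> v c = 0)}"

definition lincomb :: "'i set \<Rightarrow> ('i \<Rightarrow> real) \<Rightarrow> ('i \<Rightarrow> ('p,'e::real_vector) tvec) \<Rightarrow> ('p,'e) tvec" where
  "lincomb S f V = (\<lambda>c. \<Sum>i\<in>S. f i *\<^sub>R V i c)"

definition vadd :: "('p,'e::real_vector) tvec \<Rightarrow> ('p,'e) tvec \<Rightarrow> ('p,'e) tvec" where
  "vadd v w = (\<lambda>c. v c + w c)"

definition vsub :: "('p,'e::real_vector) tvec \<Rightarrow> ('p,'e) tvec \<Rightarrow> ('p,'e) tvec" where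
  "vsub v w = (\<lambda>c. v c - w c)"

definition tbasis :: "'i set \<Rightarrow> ('i \<Rightarrow> ('p,'e::real_vector) tvec) \<Rightarrow> ('p,'e) tvec set \<Rightarrow> bool" where
  "tbasis S V T \<longleftrightarrow> finite S \<and> (\<forall>i\<in>S. V i \<in> T) \<and> (\<forall>v\<in>T. \<exists>f. v = lincomb S f V) \<and>
     (\<forall>f. lincomb S f V = (\<lambda>c. 0) \<longrightarrow> (\<forall>i\<in>S. f i = 0))"

text \<open>The tangent map at \<open>x\<close>, applied to \<open>d\<close>, of a map \<open>f\<close> from (an open subset of) a vector space to a
  manifold.\<close>

definition pushvec ::
    "('q::topological_space,'f::real_inner) chart set \<Rightarrow> ('v::real_normed_vector \<Rightarrow> 'q) \<Rightarrow> 'v \<Rightarrow> 'v \<Rightarrow> ('q,'f) tvec" where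
  "pushvec B f x d = (\<lambda>c. if c \<in> charts_at B (f x) then pd d (snd c \<circ> f) x else 0)"

text \<open>The tangent map at \<open>p\<close> of a map \<open>f\<close> between manifolds. For differentiable \<open>f\<close> it does not depend on
  the selected chart.\<close>

definition tmap ::
    "('p::topological_space,'e::real_inner) chart set \<Rightarrow> ('q::topological_space,'f::real_inner) chart set \<Rightarrow>
     ('p \<Rightarrow> 'q) \<Rightarrow> 'p \<Rightarrow> ('p,'e) tvec \<Rightarrow> ('q,'f) tvec" where
  "tmap A B f p v = (let c = (SOME c. c \<in> charts_at A p)
                     in pushvec B (f \<circ> inv_chart c) (snd c p) (v c))"

definition smooth_vector_field_on ::
    "('p::topological_space,'e::real_inner) chart set \<Rightarrow> 'p set \<Rightarrow> ('p \<Rightarrow> ('p,'e) tvec) \<Rightarrow> bool" where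
  "smooth_vector_field_on A W Y \<longleftrightarrow> open W \<and> (\<forall>p\<in>W. Y p \<in> tangent_space A p) \<and>
     (\<forall>c\<in>A. smooth_on (snd c ` (fst c \<inter> W)) (\<lambda>x. Y (inv_chart c x) c))"

definition lie_bracket ::
    "('p::topological_space,'e::real_inner) chart set \<Rightarrow> ('p \<Rightarrow> ('p,'e) tvec) \<Rightarrow> ('p \<Rightarrow> ('p,'e) tvec) \<Rightarrow>
     'p \<Rightarrow> ('p,'e) tvec" where
  "lie_bracket A Y Z p = (\<lambda>c. if c \<in> charts_at A p
     then pd (Y p c) (\<lambda>x. Z (inv_chart c x) c) (snd c p) - pd (Z p c) (\<lambda>x. Y (inv_chart c x) c) (snd c p)
     else 0)"

section \<open>Lie groups, actions, quotients and principal connections\<close>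

definition lie_group ::
    "'h::real_inner set \<Rightarrow> ('g::{t2_space,second_countable_topology},'h) chart set \<Rightarrow>
     ('g \<Rightarrow> 'g \<Rightarrow> 'g) \<Rightarrow> 'g \<Rightarrow> ('g \<Rightarrow> 'g) \<Rightarrow> bool" where
  "lie_group B A mul one invs \<longleftrightarrow> smooth_manifold B A \<and> Groups.group mul one invs \<and>
     smooth_map_on (prod_atlas A A) A UNIV (\<lambda>(g, h). mul g h) \<and> smooth_map_on A A UNIV invs"

definition left_inv_field ::
    "('g::topological_space,'h::real_inner) chart set \<Rightarrow> ('g \<Rightarrow> 'g \<Rightarrow> 'g) \<Rightarrow> 'g \<Rightarrow> ('g,'h) tvec \<Rightarrow>
     'g \<Rightarrow> ('g,'h) tvec" where
  "left_inv_field A mul one \<xi> g = tmap A A (mul g) one \<xi>"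

text \<open>The bracket of the Lie algebra \<open>tangent_space A one\<close>.\<close>

definition lie_algebra_bracket ::
    "('g::topological_space,'h::real_inner) chart set \<Rightarrow> ('g \<Rightarrow> 'g \<Rightarrow> 'g) \<Rightarrow> 'g \<Rightarrow> ('g,'h) tvec \<Rightarrow>
     ('g,'h) tvec \<Rightarrow> ('g,'h) tvec" where
  "lie_algebra_bracket A mul one \<xi> \<eta> =
     lie_bracket A (left_inv_field A mul one \<xi>) (left_inv_field A mul one \<eta>) one"

definition smooth_left_action ::
    "('g::topological_space,'h::real_inner) chart set \<Rightarrow> ('g \<Rightarrow> 'g \<Rightarrow> 'g) \<Rightarrow> 'g \<Rightarrow>
     ('q::topological_space,'e::real_inner) chart set \<Rightarrow> ('g \<Rightarrow> 'q \<Rightarrow> 'q) \<Rightarrow> bool" where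
  "smooth_left_action AG mul one AQ act \<longleftrightarrow>
     smooth_map_on (prod_atlas AG AQ) AQ UNIV (\<lambda>(g, q). act g q) \<and>
     (\<forall>q. act one q = q) \<and> (\<forall>g h q. act (mul g h) q = act g (act h q))"

definition free_action :: "'g \<Rightarrow> ('g \<Rightarrow> 'q \<Rightarrow> 'q) \<Rightarrow> bool" where
  "free_action one act \<longleftrightarrow> (\<forall>g q. act g q = q \<longrightarrow> g = one)"

definition proper_action :: "('g::topological_space \<Rightarrow> 'q::topological_space \<Rightarrow> 'q) \<Rightarrow> bool" where
  "proper_action act \<longleftrightarrow> proper_map euclidean euclidean (\<lambda>(g, q). (act g q, q))"

text \<open>The manifold \<open>(BX, AX)\<close> with projection \<open>\<pi>\<close> is the orbit manifold: \<open>\<pi>\<close> is a surjective submersion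
  whose fibres are the orbits. These properties determine it up to a unique diffeomorphism.\<close>

definition quotient_manifold ::
    "('q::topological_space,'e::real_inner) chart set \<Rightarrow> ('g \<Rightarrow> 'q \<Rightarrow> 'q) \<Rightarrow>
     'b::real_inner set \<Rightarrow> ('x::{t2_space,second_countable_topology},'b) chart set \<Rightarrow> ('q \<Rightarrow> 'x) \<Rightarrow> bool" where
  "quotient_manifold AQ act BX AX \<pi> \<longleftrightarrow> smooth_manifold BX AX \<and> smooth_map_on AQ AX UNIV \<pi> \<and> surj \<pi> \<and>
     (\<forall>q. tmap AQ AX \<pi> q ` tangent_space AQ q = tangent_space AX (\<pi> q)) \<and>
     (\<forall>q q'. \<pi> q = \<pi> q' \<longleftrightarrow> (\<exists>g. q' = act g q))"

definition vertical_space ::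
    "('q::topological_space,'e::real_inner) chart set \<Rightarrow> ('x::topological_space,'b::real_inner) chart set \<Rightarrow>
     ('q \<Rightarrow> 'x) \<Rightarrow> 'q \<Rightarrow> ('q,'e) tvec set" where
  "vertical_space AQ AX \<pi> q = {v \<in> tangent_space AQ q. tmap AQ AX \<pi> q v = (\<lambda>c. 0)}"

text \<open>\<open>H\<close> is an invariant distribution complementary to the vertical one. It is smooth in the sense that
  the horizontal component of a smooth vector field is smooth.\<close>

definition principal_connection ::
    "('q::topological_space,'e::real_inner) chart set \<Rightarrow> ('g \<Rightarrow> 'q \<Rightarrow> 'q) \<Rightarrow>
     ('x::topological_space,'b::real_inner) chart set \<Rightarrow> ('q \<Rightarrow> 'x) \<Rightarrow> ('q \<Rightarrow> ('q,'e) tvec set) \<Rightarrow> bool" where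
  "principal_connection AQ act AX \<pi> H \<longleftrightarrow>
     (\<forall>q. H q \<subseteq> tangent_space AQ q \<and> (\<lambda>c. 0) \<in> H q \<and>
        (\<forall>v\<in>H q. \<forall>w\<in>H q. \<forall>r s. (\<lambda>c. r *\<^sub>R v c + s *\<^sub>R w c) \<in> H q)) \<and>
     (\<forall>q. \<forall>u\<in>tangent_space AQ q. \<exists>!v. v \<in> H q \<and> vsub u v \<in> vertical_space AQ AX \<pi> q) \<and>
     (\<forall>g q. tmap AQ AQ (act g) q ` H q = H (act g q)) \<and>
     (\<forall>W Y. smooth_vector_field_on AQ W Y \<longrightarrow>
        smooth_vector_field_on AQ W
          (\<lambda>q. THE v. v \<in> H q \<and> vsub (Y q) v \<in> vertical_space AQ AX \<pi> q))"

definition horizontal_lift ::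
    "('q::topological_space,'e::real_inner) chart set \<Rightarrow> ('x::topological_space,'b::real_inner) chart set \<Rightarrow>
     ('q \<Rightarrow> 'x) \<Rightarrow> ('q \<Rightarrow> ('q,'e) tvec set) \<Rightarrow> 'q \<Rightarrow> ('x,'b) tvec \<Rightarrow> ('q,'e) tvec" where
  "horizontal_lift AQ AX \<pi> H q y = (THE v. v \<in> H q \<and> tmap AQ AX \<pi> q v = y)"

text \<open>\<open>\<psi>\<close> is an equivariant diffeomorphism of \<open>\<pi> -` U\<close> onto \<open>U \<times> G\<close> over \<open>U\<close>.\<close>

definition local_trivialization ::
    "('q::topological_space,'e::real_inner) chart set \<Rightarrow> ('g::topological_space,'h::real_inner) chart set \<Rightarrow>
     ('g \<Rightarrow> 'g \<Rightarrow> 'g) \<Rightarrow> ('g \<Rightarrow> 'q \<Rightarrow> 'q) \<Rightarrow> ('x::topological_space,'b::real_inner) chart set \<Rightarrow>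
     ('q \<Rightarrow> 'x) \<Rightarrow> 'x set \<Rightarrow> ('q \<Rightarrow> 'x \<times> 'g) \<Rightarrow> bool" where
  "local_trivialization AQ AG mul act AX \<pi> U \<psi> \<longleftrightarrow> open U \<and> bij_betw \<psi> (\<pi> -` U) (U \<times> UNIV) \<and>
     smooth_map_on AQ (prod_atlas AX AG) (\<pi> -` U) \<psi> \<and>
     smooth_map_on (prod_atlas AX AG) AQ (U \<times> UNIV) (inv_into (\<pi> -` U) \<psi>) \<and>
     (\<forall>q\<in>\<pi> -` U. fst (\<psi> q) = \<pi> q \<and> (\<forall>g. \<psi> (act g q) = (\<pi> q, mul g (snd (\<psi> q)))))"

section \<open>The bundle of \<open>k\<close>-velocities\<close>

text \<open>\<open>k\<close> is the cardinality of the index type \<open>'k\<close>, and \<open>\<partial>/\<partial>t\<^sup>\<alpha>\<close> on \<open>real^'k\<close> is \<open>axis \<alpha> 1\<close>.\<close>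

type_synonym ('p,'e,'k) kvel = "'p \<times> ('k \<Rightarrow> ('p,'e) tvec)"

definition T1k :: "('p::topological_space,'e::real_inner) chart set \<Rightarrow> ('p,'e,'k::finite) kvel set" where
  "T1k A = {(p, v). \<forall>\<alpha>. v \<alpha> \<in> tangent_space A p}"

text \<open>The point of \<open>T1k A\<close> with natural coordinates \<open>(q\<^sup>A, u\<^sup>A\<^sub>\<alpha>) = (x, u)\<close> in the chart \<open>c\<close>, where
  \<open>u\<^sup>A\<^sub>\<alpha> = (u $ \<alpha>) \<bullet> A\<close>.\<close>

definition T1k_point ::
    "('p::topological_space,'e::real_inner) chart set \<Rightarrow> ('p,'e) chart \<Rightarrow> 'e \<times> ('e^'k::finite) \<Rightarrow> ('p,'e,'k) kvel" where
  "T1k_point A c = (\<lambda>(x, u). (inv_chart c x, \<lambda>\<alpha>. pushvec A (inv_chart c) x (u $ \<alpha>)))"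

definition local_rep ::
    "('p::topological_space,'e::real_inner) chart set \<Rightarrow> ('p,'e) chart \<Rightarrow> (('p,'e,'k::finite) kvel \<Rightarrow> real) \<Rightarrow>
     'e \<times> ('e^'k) \<Rightarrow> real" where
  "local_rep A c F = F \<circ> T1k_point A c"

definition smooth_on_T1k ::
    "('p::topological_space,'e::real_inner) chart set \<Rightarrow> (('p,'e,'k::finite) kvel \<Rightarrow> real) \<Rightarrow> bool" where
  "smooth_on_T1k A F \<longleftrightarrow> (\<forall>c\<in>A. smooth_on (chart_image c \<times> UNIV) (local_rep A c F))"

definition T1k_act ::
    "('q::topological_space,'e::real_inner) chart set \<Rightarrow> ('g \<Rightarrow> 'q \<Rightarrow> 'q) \<Rightarrow> 'g \<Rightarrow>
     ('q,'e,'k::finite) kvel \<Rightarrow> ('q,'e,'k) kvel" where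
  "T1k_act AQ act g = (\<lambda>(q, v). (act g q, \<lambda>\<alpha>. tmap AQ AQ (act g) q (v \<alpha>)))"

text \<open>The projection of \<open>T1k AQ\<close> onto its set of orbits.\<close>

definition T1k_orbit ::
    "('q::topological_space,'e::real_inner) chart set \<Rightarrow> ('g \<Rightarrow> 'q \<Rightarrow> 'q) \<Rightarrow>
     ('q,'e,'k::finite) kvel \<Rightarrow> ('q,'e,'k) kvel set" where
  "T1k_orbit AQ act p = range (\<lambda>g. T1k_act AQ act g p)"

definition first_prolongation ::
    "('q::topological_space,'e::real_inner) chart set \<Rightarrow> (real^'k::finite \<Rightarrow> 'q) \<Rightarrow> real^'k \<Rightarrow> ('q,'e,'k) kvel" where
  "first_prolongation A f t = (f t, \<lambda>\<alpha>. pushvec A f t (axis \<alpha> 1))"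

text \<open>The derivative \<open>Z\<^sup>A \<partial>F/\<partial>u\<^sup>A\<^sub>\<alpha>\<close> of \<open>F\<close> along the vertical lift of the vector field \<open>Z\<close> to the
  \<open>\<alpha>\<close>-th copy. For smooth \<open>F\<close> it does not depend on the selected chart.\<close>

definition vlift ::
    "'e::real_inner set \<Rightarrow> ('p::topological_space,'e) chart set \<Rightarrow> ('p \<Rightarrow> ('p,'e) tvec) \<Rightarrow> 'k::finite \<Rightarrow>
     (('p,'e,'k) kvel \<Rightarrow> real) \<Rightarrow> ('p,'e,'k) kvel \<Rightarrow> real" where
  "vlift B A Z \<alpha> F = (\<lambda>(p, v). let c = (SOME c. c \<in> charts_at A p) in
     \<Sum>b\<in>B. (Z p c \<bullet> b) * pd (0, axis \<alpha> b) (local_rep A c F) (snd c p, \<chi> \<beta>. v \<beta> c))"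

definition regular_lagrangian ::
    "'e::real_inner set \<Rightarrow> ('p::topological_space,'e) chart set \<Rightarrow> (('p,'e,'k::finite) kvel \<Rightarrow> real) \<Rightarrow> bool" where
  "regular_lagrangian B A L \<longleftrightarrow> (\<forall>c\<in>admissible A. \<forall>x\<in>chart_image c. \<forall>u.
     nonsingular (B \<times> UNIV) (\<lambda>(a, \<alpha>) (b, \<beta>).
       pd (0, axis \<alpha> a) (pd (0, axis \<beta> b) (local_rep A c L)) (x, u)))"

definition fundamental_field ::
    "('g::topological_space,'h::real_inner) chart set \<Rightarrow> 'g \<Rightarrow> ('q::topological_space,'e::real_inner) chart set \<Rightarrow>
     ('g \<Rightarrow> 'q \<Rightarrow> 'q) \<Rightarrow> ('g,'h) tvec \<Rightarrow> 'q \<Rightarrow> ('q,'e) tvec" where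
  "fundamental_field AG one AQ act \<xi> q = tmap AG AQ (\<lambda>g. act g q) one \<xi>"

end

theory Submission
  imports Defs
begin

text \<open>Substituting the equation for \<open>\<phi>h\<close> and the reconstruction equation into the derivative of
  \<open>\<phi>Q\<close>, the terms with \<open>Bt\<close> cancel, and the derivative has the components \<open>\<phi>v\<close>, \<open>\<phi>w\<close> in the invariant
  frame \<open>X\<close>, \<open>Eh\<close>; hence \<open>\<phi>\<close> is a first prolongation. In a chart, the Euler-Lagrange
  expression contracted with a vector field \<open>Z\<close> is \<open>\<partial>\<^sub>\<alpha> (Z\<^sup>V\<^sub>\<alpha> L) - Z\<^sup>C L\<close> along the prolongation, where \<open>Z\<^sup>C\<close>
  is the complete lift. Since \<open>L\<close> in the frame is \<open>lhat\<close>, for \<open>Z = X i\<close> and \<open>Z = Eh a\<close> the second term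
  becomes a base derivative of \<open>lhat\<close> plus the brackets of \<open>Z\<close> with the frame, so that these contractions
  vanish by the Lagrange-Poincare equations, and the frame spans each tangent space.\<close>

section \<open>Calculus of smooth maps between coordinate spaces\<close>

section \<open>Smooth functions\<close>

text \<open>The equations (1) live over the base, whereas the curve is reconstructed upstairs;
  invariance is the bridge. The action only left-multiplies the group factor of the trivialization,
  so \<open>dX i\<close> and \<open>Eh a\<close> are invariant, and so is \<open>X i\<close>, since
  \<open>\<gamma>\<close> depends on the base point alone. Hence translation by \<open>g t\<close>
  preserves base coordinates and frame components, and (1) can be read at \<open>\<phi>Q t\<close>.
  \<open>Bt\<close> comes from the fibre Hessian of \<open>L\<close>: it makes X_i^V - Bt Et^V
  Hessian-orthogonal to the vertical directions. (2) takes the corresponding vertical velocity away,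
  (3) puts it back. Two inputs are not given directly. The bracket of two fields \<open>Eh a\<close>
  is known only at the identity of \<open>G\<close>; the orbit maps of a right action, which relate
  left-invariant fields to \<open>Eh a\<close>, carry it to \<open>Q\<close>. And
  \<open>lhat\<close> is known only through the values of \<open>l\<close> on orbits; its
  differentiability comes from \<open>L\<close> along a local section. Coordinate spaces are merely
  \<open>real_inner\<close> with a finite basis, so derivatives in varying directions are handled by
  expansion in that basis.\<close>

lemma pd_has_derivative:
  "f differentiable (at x) \<Longrightarrow> (f has_derivative (\<lambda>d. pd d f x)) (at x)"
  using frechet_derivative_works unfolding pd_def by blast

lemma pd_eqI: "(f has_derivative f') (at x) \<Longrightarrow> pd d f x = f' d"
  unfolding pd_def by (metis frechet_derivative_at)

lemma pd_linear: "f differentiable (at x) \<Longrightarrow> linear (\<lambda>d. pd d f x)"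
  using pd_has_derivative has_derivative_linear by blast

lemma pd_cong_open:
  assumes "open S" "x \<in> S" "\<And>y. y \<in> S \<Longrightarrow> f y = g y"
  shows "pd d f x = pd d g x"
proof (cases "f differentiable (at x)")
  case True
  have "(g has_derivative (\<lambda>d. pd d f x)) (at x)"
    by (rule has_derivative_transform_within_open[OF pd_has_derivative[OF True] assms(1,2)]) (simp add: assms(3))
  then show ?thesis by (simp add: pd_eqI)
next
  case False
  \<comment> \<open>\<open>frechet_derivative\<close> is a choice among all derivatives. Functions
    that agree near \<open>x\<close> have the same derivatives there, hence the same choice, even
    when there is none to choose from.\<close>
  have eq: "(f has_derivative D) (at x) \<longleftrightarrow> (g has_derivative D) (at x)" for D
    using has_derivative_transform_within_open[OF _ assms(1,2), of f D UNIV g]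
      has_derivative_transform_within_open[OF _ assms(1,2), of g D UNIV f] assms(3)
    by auto
  show ?thesis unfolding pd_def frechet_derivative_def eq ..
qed

lemma differentiable_cong_open:
  assumes "open S" "x \<in> S" "\<And>y. y \<in> S \<Longrightarrow> f y = g y" "f differentiable (at x)"
  shows "g differentiable (at x)"
  using has_derivative_transform_within_open[OF _ assms(1,2), of f _ UNIV g] assms(3,4)
  unfolding differentiable_def by auto

lemma Ck_on_subset: "Ck_on n S f \<Longrightarrow> T \<subseteq> S \<Longrightarrow> Ck_on n T f"
  by (induction n arbitrary: f) (auto intro: continuous_on_subset)

lemma smooth_on_subset: "smooth_on S f \<Longrightarrow> T \<subseteq> S \<Longrightarrow> smooth_on T f"
  unfolding smooth_on_def using Ck_on_subset by blast

lemma Ck_on_cong_open: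
  assumes "open S" "\<And>y. y \<in> S \<Longrightarrow> f y = g y" "Ck_on n S f"
  shows "Ck_on n S g"
  using assms(2,3)
proof (induction n arbitrary: f g)
  case 0
  then show ?case by (simp cong: continuous_on_cong)
next
  case (Suc n)
  show ?case
  proof (simp, intro conjI ballI allI)
    show "g differentiable (at x)" if "x \<in> S" for x
      using differentiable_cong_open[OF assms(1) that Suc.prems(1)] Suc.prems(2) that by simp
    show "Ck_on n S (pd d g)" for d
    proof (rule Suc.IH)
      show "pd d f y = pd d g y" if "y \<in> S" for y
        by (rule pd_cong_open[OF assms(1) that Suc.prems(1)])
      show "Ck_on n S (pd d f)" using Suc.prems(2) by simp
    qed
  qed
qed

lemma smooth_on_cong_open:
  "open S \<Longrightarrow> (\<And>y. y \<in> S \<Longrightarrow> f y = g y) \<Longrightarrow> smooth_on S f \<Longrightarrow> smooth_on S g"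
  unfolding smooth_on_def using Ck_on_cong_open by blast

text \<open>Smoothness of a map read in charts is checked near each point, where an intermediate
  chart is at hand. Since \<open>Ck_on\<close> uses derivatives at a point in the full space,
  nothing has to be glued.\<close>

lemma Ck_on_local:
  assumes "\<And>x. x \<in> S \<Longrightarrow> \<exists>U. open U \<and> x \<in> U \<and> Ck_on n U f"
  shows "Ck_on n S f"
  using assms
proof (induction n arbitrary: f)
  case 0
  have "isCont f x" if x: "x \<in> S" for x
    using 0[OF x] by (auto simp: continuous_on_eq_continuous_at)
  then show ?case by (simp add: continuous_at_imp_continuous_on)
next
  case (Suc n)
  have "Ck_on n S (pd d f)" for d
    using Suc.prems by (intro Suc.IH) (metis Ck_on.simps(2))
  moreover have "f differentiable (at x)" if "x \<in> S" for x
    using Suc.prems[OF that] by auto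
  ultimately show ?case by simp
qed

lemma smooth_on_local:
  assumes "\<And>x. x \<in> S \<Longrightarrow> \<exists>U. open U \<and> x \<in> U \<and> smooth_on U f"
  shows "smooth_on S f"
  using assms Ck_on_local[of S _ f] unfolding smooth_on_def by meson

lemma Ck_on_Suc_imp: "Ck_on (Suc n) S f \<Longrightarrow> Ck_on n S f"
proof (induction n arbitrary: f)
  case 0
  then show ?case
    by (auto intro!: continuous_at_imp_continuous_on differentiable_imp_continuous_within)
next
  case (Suc n)
  then show ?case by auto
qed

lemma smooth_on_pd: "smooth_on S f \<Longrightarrow> smooth_on S (pd d f)"
  unfolding smooth_on_def by (metis Ck_on.simps(2))

lemma smooth_on_differentiable: "smooth_on S f \<Longrightarrow> x \<in> S \<Longrightarrow> f differentiable (at x)"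
  unfolding smooth_on_def by (metis Ck_on.simps(2))

lemma smooth_on_continuous: "smooth_on S f \<Longrightarrow> continuous_on S f"
  unfolding smooth_on_def by (metis Ck_on.simps(1))

lemma pd_const: "pd d (\<lambda>_. c) = (\<lambda>_. 0)"
  by (rule ext) (rule pd_eqI, rule has_derivative_const)

lemma Ck_on_const: "Ck_on n S (\<lambda>_. c)"
  by (induction n arbitrary: c) (auto simp: pd_const)

lemma pd_bounded_linear:
  "bounded_linear h \<Longrightarrow> f differentiable (at x) \<Longrightarrow> pd d (\<lambda>x. h (f x)) x = h (pd d f x)"
  by (rule pd_eqI) (rule bounded_linear.has_derivative[OF _ pd_has_derivative])

lemma Ck_on_bounded_linear:
  assumes "open S" and h: "bounded_linear h" and "Ck_on n S f"
  shows "Ck_on n S (\<lambda>x. h (f x))"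
  using assms(3)
proof (induction n arbitrary: f)
  case 0
  then show ?case by (simp add: bounded_linear.continuous_on[OF h])
next
  case (Suc n)
  have "Ck_on n S (pd d (\<lambda>x. h (f x)))" for d
    by (rule Ck_on_cong_open[OF assms(1) _ Suc.IH[of "pd d f"]])
      (use Suc.prems in \<open>auto simp: pd_bounded_linear[OF h]\<close>)
  moreover have "(\<lambda>x. h (f x)) differentiable (at x)" if "x \<in> S" for x
    using that Suc.prems h
    by (metis Ck_on.simps(2) bounded_linear.has_derivative differentiable_def)
  ultimately show ?case by simp
qed

lemma smooth_on_bounded_linear:
  "open S \<Longrightarrow> bounded_linear h \<Longrightarrow> smooth_on S f \<Longrightarrow> smooth_on S (\<lambda>x. h (f x))"
  unfolding smooth_on_def using Ck_on_bounded_linear by blast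

lemma Ck_on_id: "Ck_on n S (\<lambda>x. x)"
proof (cases n)
  case (Suc m)
  have "pd d (\<lambda>x. x) = (\<lambda>_. d)" for d :: 'a
    by (rule ext) (rule pd_eqI, rule has_derivative_ident)
  then show ?thesis unfolding Suc by (auto simp: Ck_on_const)
qed auto

lemma smooth_on_id: "smooth_on S (\<lambda>x. x)"
  unfolding smooth_on_def using Ck_on_id by blast

lemma smooth_on_const: "smooth_on S (\<lambda>_. c)"
  unfolding smooth_on_def using Ck_on_const by blast

lemma pd_add:
  "f differentiable (at x) \<Longrightarrow> g differentiable (at x) \<Longrightarrow> pd d (\<lambda>x. f x + g x) x = pd d f x + pd d g x"
  by (rule pd_eqI) (rule has_derivative_add; rule pd_has_derivative)

lemma Ck_on_add:
  assumes "open S" "Ck_on n S f" "Ck_on n S g"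
  shows "Ck_on n S (\<lambda>x. f x + g x)"
  using assms(2,3)
proof (induction n arbitrary: f g)
  case 0
  then show ?case by (simp add: continuous_on_add)
next
  case (Suc n)
  have "Ck_on n S (pd d (\<lambda>x. f x + g x))" for d
    by (rule Ck_on_cong_open[OF assms(1) _ Suc.IH[of "pd d f" "pd d g"]])
      (use Suc.prems in \<open>auto simp: pd_add\<close>)
  then show ?case using Suc.prems by (auto intro: differentiable_add)
qed

lemma smooth_on_add:
  "open S \<Longrightarrow> smooth_on S f \<Longrightarrow> smooth_on S g \<Longrightarrow> smooth_on S (\<lambda>x. f x + g x)"
  unfolding smooth_on_def using Ck_on_add by blast

lemma Ck_on_sum:
  "open S \<Longrightarrow> (\<And>i. i \<in> I \<Longrightarrow> Ck_on n S (f i)) \<Longrightarrow> Ck_on n S (\<lambda>x. \<Sum>i\<in>I. f i x)"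
  by (induction I rule: infinite_finite_induct) (auto intro!: Ck_on_const Ck_on_add)

lemma smooth_on_sum:
  "open S \<Longrightarrow> (\<And>i. i \<in> I \<Longrightarrow> smooth_on S (f i)) \<Longrightarrow> smooth_on S (\<lambda>x. \<Sum>i\<in>I. f i x)"
  unfolding smooth_on_def by (auto intro!: Ck_on_sum)

lemma pd_scaleR:
  assumes "f differentiable (at x)" "g differentiable (at x)"
  shows "pd d (\<lambda>x. f x *\<^sub>R g x) x = f x *\<^sub>R pd d g x + pd d f x *\<^sub>R g x"
  by (rule pd_eqI[OF has_derivative_scaleR[OF pd_has_derivative pd_has_derivative]]) (use assms in auto)

text \<open>The product rule pairs each factor itself with the derivative of the other one, so both
  factors are first lowered by one order before the induction hypothesis applies.\<close>

lemma Ck_on_scaleR: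
  assumes "open S" "Ck_on n S f" "Ck_on n S g"
  shows "Ck_on n S (\<lambda>x. f x *\<^sub>R g x)"
  using assms(2,3)
proof (induction n arbitrary: f g)
  case 0
  then show ?case by (simp add: continuous_on_scaleR)
next
  case (Suc n)
  have "Ck_on n S (\<lambda>x. f x *\<^sub>R pd d g x + pd d f x *\<^sub>R g x)" for d
    using Suc.prems Suc.prems[THEN Ck_on_Suc_imp] by (intro Ck_on_add[OF assms(1)] Suc.IH) auto
  then have "Ck_on n S (pd d (\<lambda>x. f x *\<^sub>R g x))" for d
    by (rule Ck_on_cong_open[OF assms(1), rotated]) (use Suc.prems in \<open>auto simp: pd_scaleR\<close>)
  then show ?case using Suc.prems by (auto intro: differentiable_scaleR)
qed

lemma smooth_on_scaleR:
  "open S \<Longrightarrow> smooth_on S f \<Longrightarrow> smooth_on S g \<Longrightarrow> smooth_on S (\<lambda>x. f x *\<^sub>R g x)"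
  unfolding smooth_on_def using Ck_on_scaleR by blast

lemma bounded_linear_Pair_left: "bounded_linear (\<lambda>x. (x, 0))"
  by (intro bounded_linear_Pair bounded_linear_ident bounded_linear_zero)

lemma bounded_linear_Pair_right: "bounded_linear (\<lambda>x. (0, x))"
  by (intro bounded_linear_Pair bounded_linear_ident bounded_linear_zero)

lemma smooth_on_Pair:
  assumes "open S" "smooth_on S f" "smooth_on S g"
  shows "smooth_on S (\<lambda>x. (f x, g x))"
proof -
  have "smooth_on S (\<lambda>x. (f x, 0) + (0, g x))"
    using smooth_on_bounded_linear[OF assms(1) bounded_linear_Pair_left assms(2)]
      smooth_on_bounded_linear[OF assms(1) bounded_linear_Pair_right assms(3)]
    by (rule smooth_on_add[OF assms(1)])
  then show ?thesis by simp
qed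

lemma bounded_linear_axis: "bounded_linear (axis \<alpha> :: 'a::real_normed_vector \<Rightarrow> 'a^'k::finite)"
proof (rule bounded_linear_intro[where K = 1])
  show "axis \<alpha> (x + y) = axis \<alpha> x + axis \<alpha> y" for x y :: 'a
    by (simp add: vec_eq_iff axis_def)
  show "axis \<alpha> (r *\<^sub>R x) = r *\<^sub>R axis \<alpha> x" for r and x :: 'a
    by (simp add: vec_eq_iff axis_def)
  show "norm (axis \<alpha> x :: 'a^'k) \<le> norm x * 1" for x :: 'a
    unfolding norm_vec_def L2_set_def axis_def by (simp add: if_distrib if_distribR cong: if_cong)
qed

text \<open>Reduces smoothness and derivatives of vector-valued maps given by components to finite
  sums of bounded linear images.\<close>

lemma vec_sum_axis: "(\<chi> \<alpha>. f \<alpha>) = (\<Sum>\<alpha>\<in>UNIV. axis \<alpha> (f \<alpha>) :: 'a::real_normed_vector^'k::finite)"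
proof -
  have "(\<Sum>\<alpha>\<in>UNIV. axis \<alpha> (f \<alpha>) $ \<beta>) = f \<beta>" for \<beta>
    by (subst sum.remove[of _ \<beta>]) (auto simp: axis_def)
  then show ?thesis by (simp add: vec_eq_iff)
qed

lemma smooth_on_vec:
  assumes "open S" "\<And>\<alpha>. smooth_on S (f \<alpha>)"
  shows "smooth_on S (\<lambda>x. (\<chi> \<alpha>. f \<alpha> x) :: 'a::real_normed_vector^'k::finite)"
  unfolding vec_sum_axis
  by (intro smooth_on_sum smooth_on_bounded_linear[OF _ bounded_linear_axis] assms)

section \<open>Coordinate bases\<close>

lemma coord_basis_finite: "coord_basis B \<Longrightarrow> finite B"
  by (simp add: coord_basis_def)

lemma coord_basis_expand:
  assumes "coord_basis B"
  shows "x = (\<Sum>b\<in>B. (x \<bullet> b) *\<^sub>R b)"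
proof -
  have fin: "finite B" using assms by (simp add: coord_basis_def)
  have "x \<in> span B" using assms by (simp add: coord_basis_def)
  then obtain u where u: "x = (\<Sum>b\<in>B. u b *\<^sub>R b)"
    using span_finite[OF fin] by auto
  have "x \<bullet> a = u a" if "a \<in> B" for a
  proof -
    have "x \<bullet> a = (\<Sum>b\<in>B. u b * (b \<bullet> a))"
      by (subst u) (simp add: inner_sum_left)
    also have "\<dots> = (\<Sum>b\<in>B. if b = a then u b else 0)"
      using assms that by (intro sum.cong) (auto simp: coord_basis_def)
    finally show ?thesis using fin that by simp
  qed
  then show ?thesis using u by simp
qed

lemma coord_basis_inner:
  "coord_basis B \<Longrightarrow> a \<in> B \<Longrightarrow> b \<in> B \<Longrightarrow> a \<bullet> b = (if a = b then 1 else 0)"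
  by (simp add: coord_basis_def)

lemma zero_notin_coord_basis: "coord_basis B \<Longrightarrow> 0 \<notin> B"
  by (force simp: coord_basis_def)

text \<open>This is where finite dimension enters. \<open>Ck_on\<close> speaks about derivatives in
  fixed directions; a derivative in a direction that varies with the point becomes a finite sum of
  such derivatives with variable coefficients.\<close>

lemma linear_coord_expand:
  fixes f :: "'a::real_inner \<Rightarrow> 'b::real_normed_vector"
  assumes "coord_basis (B :: 'a set)" "linear f"
  shows "f x = (\<Sum>b\<in>B. (x \<bullet> b) *\<^sub>R f b)"
  by (subst coord_basis_expand[OF assms(1), of x])
    (simp add: linear_sum[OF assms(2)] linear_scale[OF assms(2)])

lemma coord_basis_eqI:
  assumes "coord_basis B" "\<And>b. b \<in> B \<Longrightarrow> x \<bullet> b = y \<bullet> b"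
  shows "x = y"
  using coord_basis_expand[OF assms(1), of x] coord_basis_expand[OF assms(1), of y] assms(2)
  by simp

lemma coord_basis_Basis: "coord_basis (Basis :: 'a::euclidean_space set)"
  by (auto simp: coord_basis_def inner_Basis)

text \<open>The two families are orthogonal and cannot share a member, because a common member would
  be zero and basis vectors are not. Together with \<open>coord_basis_vec\<close> it provides the
  coordinates of the velocity bundle.\<close>

lemma coord_basis_prod:
  assumes "coord_basis B" "coord_basis C"
  shows "coord_basis ((\<lambda>b. (b, 0)) ` B \<union> (\<lambda>c. (0, c)) ` C)"
proof -
  let ?S = "(\<lambda>b. (b, 0)) ` B \<union> (\<lambda>c. (0, c)) ` C"
  have "p \<in> span ?S" for p
  proof -
    have "p = (\<Sum>b\<in>B. (fst p \<bullet> b) *\<^sub>R (b, 0)) + (\<Sum>c\<in>C. (snd p \<bullet> c) *\<^sub>R (0, c))"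
      using coord_basis_expand[OF assms(1), of "fst p"] coord_basis_expand[OF assms(2), of "snd p"]
      by (auto simp: prod_eq_iff fst_sum snd_sum)
    also have "\<dots> \<in> span ?S"
      by (intro span_add span_sum span_scale span_base) auto
    finally show ?thesis .
  qed
  moreover have "a \<bullet> b = (if a = b then 1 else 0)" if "a \<in> ?S" "b \<in> ?S" for a b
    using that zero_notin_coord_basis[OF assms(1)] zero_notin_coord_basis[OF assms(2)]
    by (auto simp: coord_basis_inner[OF assms(1)] coord_basis_inner[OF assms(2)] split: if_splits)
  moreover have "finite ?S" using assms by (simp add: coord_basis_finite)
  ultimately show ?thesis unfolding coord_basis_def by blast
qed

lemma coord_basis_vec:
  assumes "coord_basis B"
  shows "coord_basis ((\<lambda>(\<alpha>, b). axis \<alpha> b) ` (UNIV \<times> B) :: ('e::real_inner^'k::finite) set)"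
    (is "coord_basis ?S")
proof -
  have "p \<in> span ?S" for p
  proof -
    have "p = (\<Sum>\<alpha>\<in>UNIV. axis \<alpha> (p $ \<alpha>))"
      by (subst vec_sum_axis[symmetric]) simp
    also have "\<dots> = (\<Sum>\<alpha>\<in>UNIV. \<Sum>b\<in>B. (p $ \<alpha> \<bullet> b) *\<^sub>R axis \<alpha> b)"
      by (intro sum.cong refl linear_coord_expand assms bounded_linear.linear bounded_linear_axis)
    also have "\<dots> \<in> span ?S"
      by (intro span_sum span_scale span_base) auto
    finally show ?thesis .
  qed
  moreover have "x \<bullet> y = (if x = y then 1 else 0)" if "x \<in> ?S" "y \<in> ?S" for x y
    using that zero_notin_coord_basis[OF assms]
    by (auto simp: inner_axis_axis axis_eq_axis coord_basis_inner[OF assms] split: if_splits)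
  moreover have "finite ?S" using assms by (simp add: coord_basis_finite)
  ultimately show ?thesis unfolding coord_basis_def by blast
qed

section \<open>Composition, and derivatives in varying directions\<close>

lemma pd_compose:
  assumes "f differentiable (at x)" "g differentiable (at (f x))"
  shows "pd d (\<lambda>x. g (f x)) x = pd (pd d f x) g (f x)"
  by (rule pd_eqI) (rule has_derivative_compose[OF pd_has_derivative pd_has_derivative], use assms in auto)

lemma differentiable_compose_at:
  "f differentiable (at x) \<Longrightarrow> g differentiable (at (f x)) \<Longrightarrow> (\<lambda>x. g (f x)) differentiable (at x)"
  unfolding differentiable_def using has_derivative_compose[of f _ x UNIV g] by blast

text \<open>By the chain rule the derivative of the composite is that of \<open>g\<close> in the
  varying direction \<open>pd d f x\<close>. Expanded in \<open>B\<close> it involves only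
  composites of some \<open>pd b g\<close> with the same \<open>f\<close>, so the induction varies
  \<open>g\<close> alone.\<close>

lemma Ck_on_compose:
  fixes f :: "'a::real_normed_vector \<Rightarrow> 'b::real_inner" and g :: "'b \<Rightarrow> 'c::real_normed_vector"
  assumes B: "coord_basis (B :: 'b set)" and S: "open S" and "Ck_on n S f" "Ck_on n T g" "f ` S \<subseteq> T"
  shows "Ck_on n S (\<lambda>x. g (f x))"
  using assms(3-)
proof (induction n arbitrary: g)
  case 0
  then show ?case by (auto intro: continuous_on_compose2)
next
  case (Suc n)
  have dg: "g differentiable (at (f x))" if "x \<in> S" for x using that Suc.prems by auto
  have df: "f differentiable (at x)" if "x \<in> S" for x using that Suc.prems by auto
  have "Ck_on n S (\<lambda>x. \<Sum>b\<in>B. (pd d f x \<bullet> b) *\<^sub>R pd b g (f x))" for d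
    using Suc.prems Ck_on_Suc_imp[OF Suc.prems(1)]
    by (intro Ck_on_sum Ck_on_scaleR S Ck_on_bounded_linear[OF _ bounded_linear_inner_left] Suc.IH) auto
  then have "Ck_on n S (pd d (\<lambda>x. g (f x)))" for d
  proof (rule Ck_on_cong_open[OF S, rotated])
    fix y assume y: "y \<in> S"
    show "(\<Sum>b\<in>B. (pd d f y \<bullet> b) *\<^sub>R pd b g (f y)) = pd d (\<lambda>x. g (f x)) y"
      using linear_coord_expand[OF B pd_linear[OF dg[OF y]], of "pd d f y"]
      by (simp add: pd_compose[OF df[OF y] dg[OF y]])
  qed
  moreover have "(\<lambda>x. g (f x)) differentiable (at x)" if "x \<in> S" for x
    using differentiable_compose_at df dg that by blast
  ultimately show ?case by simp
qed

lemma smooth_on_compose: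
  fixes f :: "'a::real_normed_vector \<Rightarrow> 'b::real_inner" and g :: "'b \<Rightarrow> 'c::real_normed_vector"
  assumes "coord_basis (B :: 'b set)" "open S" "smooth_on S f" "smooth_on T g" "f ` S \<subseteq> T"
  shows "smooth_on S (\<lambda>x. g (f x))"
  using assms Ck_on_compose unfolding smooth_on_def by blast

text \<open>Gives the smoothness of vectors that are transformed by the Jacobian of a change of
  charts.\<close>

lemma smooth_on_pd_direction:
  fixes f h :: "'a::real_normed_vector \<Rightarrow> 'b::real_inner" and g :: "'b \<Rightarrow> 'c::real_normed_vector"
  assumes "coord_basis (B :: 'b set)" "open S" "smooth_on S f" "smooth_on T g" "f ` S \<subseteq> T" "smooth_on S h"
  shows "smooth_on S (\<lambda>x. pd (h x) g (f x))"
proof -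
  have "smooth_on S (\<lambda>x. \<Sum>b\<in>B. (h x \<bullet> b) *\<^sub>R pd b g (f x))"
    by (intro smooth_on_sum smooth_on_scaleR assms(2) smooth_on_bounded_linear[OF _ bounded_linear_inner_left]
        assms(6) smooth_on_compose[OF assms(1-3) smooth_on_pd[OF assms(4)] assms(5)])
  then show ?thesis
  proof (rule smooth_on_cong_open[OF assms(2), rotated])
    fix y assume "y \<in> S"
    then show "(\<Sum>b\<in>B. (h y \<bullet> b) *\<^sub>R pd b g (f y)) = pd (h y) g (f y)"
      using linear_coord_expand[OF assms(1) pd_linear, of g "f y" "h y"] assms(4,5) smooth_on_differentiable
      by (metis image_subset_iff)
  qed
qed

section \<open>Symmetry of second derivatives\<close>

lemma pd_directional:
  fixes f :: "'a::real_normed_vector \<Rightarrow> real"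
  assumes "f differentiable (at (x + s *\<^sub>R a))"
  shows "((\<lambda>s. f (x + s *\<^sub>R a)) has_real_derivative pd a f (x + s *\<^sub>R a)) (at s)"
proof -
  have "((\<lambda>s. x + s *\<^sub>R a) has_derivative (\<lambda>s. s *\<^sub>R a)) (at s)"
    by (auto intro!: derivative_eq_intros)
  from has_derivative_compose[OF this pd_has_derivative[OF assms]]
  have "((\<lambda>s. f (x + s *\<^sub>R a)) has_derivative (\<lambda>r. pd (r *\<^sub>R a) f (x + s *\<^sub>R a))) (at s)" .
  then show ?thesis
    by (simp add: has_field_derivative_def linear_scale[OF pd_linear[OF assms]] mult.commute[of _ "pd a f _"])
qed

text \<open>The mean value theorem is applied in direction \<open>a\<close>, then in direction
  \<open>b\<close>. The left-hand side is symmetric in \<open>a\<close> and \<open>b\<close>, so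
  exchanging them compares the two mixed derivatives at nearby points.\<close>

lemma second_difference:
  fixes f :: "'a::real_normed_vector \<Rightarrow> real"
  assumes h: "0 < h" and S: "\<And>s t. 0 \<le> s \<Longrightarrow> s \<le> h \<Longrightarrow> 0 \<le> t \<Longrightarrow> t \<le> h \<Longrightarrow> x + s *\<^sub>R a + t *\<^sub>R b \<in> S"
    and f: "smooth_on S f"
  shows "\<exists>s t. 0 < s \<and> s < h \<and> 0 < t \<and> t < h \<and>
    f (x + h *\<^sub>R a + h *\<^sub>R b) - f (x + h *\<^sub>R a) - f (x + h *\<^sub>R b) + f x = h * h * pd b (pd a f) (x + s *\<^sub>R a + t *\<^sub>R b)"
proof -
  have D: "((\<lambda>s. f (x + s *\<^sub>R a + h *\<^sub>R b) - f (x + s *\<^sub>R a)) has_real_derivative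
      (pd a f (x + s *\<^sub>R a + h *\<^sub>R b) - pd a f (x + s *\<^sub>R a))) (at s)" if "0 \<le> s" "s \<le> h" for s
  proof -
    have "f differentiable (at ((x + h *\<^sub>R b) + s *\<^sub>R a))" "f differentiable (at (x + s *\<^sub>R a))"
      using S[OF that, of h] S[OF that, of 0] h
      by (auto intro!: smooth_on_differentiable[OF f] simp: algebra_simps)
    from DERIV_diff[OF this[THEN pd_directional]] show ?thesis by (simp add: algebra_simps)
  qed
  obtain s where s: "0 < s" "s < h" and
    es: "(f (x + h *\<^sub>R a + h *\<^sub>R b) - f (x + h *\<^sub>R a)) - (f (x + 0 *\<^sub>R a + h *\<^sub>R b) - f (x + 0 *\<^sub>R a))
      = (h - 0) * (pd a f (x + s *\<^sub>R a + h *\<^sub>R b) - pd a f (x + s *\<^sub>R a))"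
    using MVT2[OF h D] by blast
  have D2: "((\<lambda>t. pd a f (x + s *\<^sub>R a + t *\<^sub>R b)) has_real_derivative pd b (pd a f) (x + s *\<^sub>R a + t *\<^sub>R b)) (at t)"
    if "0 \<le> t" "t \<le> h" for t
    using S[of s t] s that by (auto intro!: pd_directional smooth_on_differentiable[OF smooth_on_pd[OF f]])
  obtain t where t: "0 < t" "t < h" and
    et: "pd a f (x + s *\<^sub>R a + h *\<^sub>R b) - pd a f (x + s *\<^sub>R a + 0 *\<^sub>R b) = (h - 0) * pd b (pd a f) (x + s *\<^sub>R a + t *\<^sub>R b)"
    using MVT2[OF h D2] by blast
  show ?thesis using s t es et by (intro exI[of _ s] exI[of _ t]) (simp add: algebra_simps)
qed

lemma pd_symmetric_real:
  fixes f :: "'a::real_normed_vector \<Rightarrow> real"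
  assumes "open S" "x \<in> S" and f: "smooth_on S f"
  shows "pd b (pd a f) x = pd a (pd b f) x"
proof (rule ccontr)
  assume ne: "pd b (pd a f) x \<noteq> pd a (pd b f) x"
  \<comment> \<open>Half the distance, so that no number is within \<open>e\<close> of both mixed
    derivatives at \<open>x\<close>.\<close>
  define e where "e = dist (pd b (pd a f) x) (pd a (pd b f) x) / 2"
  have e: "0 < e" using ne by (simp add: e_def)
  have cont: "isCont (pd b (pd a f)) x" "isCont (pd a (pd b f)) x"
    using assms smooth_on_continuous[OF smooth_on_pd[OF smooth_on_pd[OF f]]]
    by (auto simp: continuous_on_eq_continuous_at)
  obtain d where d: "0 < d" and dS: "ball x d \<subseteq> S"
    and d1: "\<And>y. dist y x < d \<Longrightarrow> dist (pd b (pd a f) y) (pd b (pd a f) x) < e"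
    and d2: "\<And>y. dist y x < d \<Longrightarrow> dist (pd a (pd b f) y) (pd a (pd b f) x) < e"
  proof -
    obtain d0 where "0 < d0" "ball x d0 \<subseteq> S" using assms(1,2) open_contains_ball by blast
    moreover obtain d1 where "0 < d1" "\<And>y. dist y x < d1 \<Longrightarrow> dist (pd b (pd a f) y) (pd b (pd a f) x) < e"
      using cont(1) e unfolding continuous_at_eps_delta dist_norm by metis
    moreover obtain d2 where "0 < d2" "\<And>y. dist y x < d2 \<Longrightarrow> dist (pd a (pd b f) y) (pd a (pd b f) x) < e"
      using cont(2) e unfolding continuous_at_eps_delta dist_norm by metis
    ultimately show thesis by (intro that[of "min d0 (min d1 d2)"]) auto
  qed
  \<comment> \<open>The parallelogram spanned by \<open>h *\<^sub>R a\<close> and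
    \<open>h *\<^sub>R b\<close> stays within \<open>d / 2\<close> of \<open>x\<close>; the summand
    1 keeps the denominator positive when \<open>a\<close> and \<open>b\<close> vanish.\<close>
  define h where "h = d / (2 * (norm a + norm b + 1))"
  have h: "0 < h" using d by (auto simp: h_def intro!: divide_pos_pos add_nonneg_pos)
  have near: "dist (x + s *\<^sub>R a + t *\<^sub>R b) x < d" if "0 \<le> s" "s \<le> h" "0 \<le> t" "t \<le> h" for s t
  proof -
    have "norm (s *\<^sub>R a + t *\<^sub>R b) \<le> h * norm a + h * norm b"
      using that by (intro norm_triangle_mono) (auto intro!: mult_right_mono)
    also have "\<dots> \<le> h * (norm a + norm b + 1)" using h by (simp add: algebra_simps)
    also have "\<dots> = d / 2" by (simp add: h_def field_simps add_nonneg_eq_0_iff)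
    also have "\<dots> < d" using d by simp
    finally show ?thesis by (simp add: dist_norm)
  qed
  have inS: "x + s *\<^sub>R a + t *\<^sub>R b \<in> S" if "0 \<le> s" "s \<le> h" "0 \<le> t" "t \<le> h" for s t
    using near[OF that] dS by (auto simp: dist_commute)
  have inS': "x + s *\<^sub>R b + t *\<^sub>R a \<in> S" if "0 \<le> s" "s \<le> h" "0 \<le> t" "t \<le> h" for s t
    using inS[of t s] that by (simp add: add_ac)
  obtain s t where st: "0 < s" "s < h" "0 < t" "t < h"
    and e1: "f (x + h *\<^sub>R a + h *\<^sub>R b) - f (x + h *\<^sub>R a) - f (x + h *\<^sub>R b) + f x = h * h * pd b (pd a f) (x + s *\<^sub>R a + t *\<^sub>R b)"
    using second_difference[OF h inS f] by blast
  obtain s' t' where st': "0 < s'" "s' < h" "0 < t'" "t' < h"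
    and e2: "f (x + h *\<^sub>R b + h *\<^sub>R a) - f (x + h *\<^sub>R b) - f (x + h *\<^sub>R a) + f x = h * h * pd a (pd b f) (x + s' *\<^sub>R b + t' *\<^sub>R a)"
    using second_difference[OF h inS' f] by blast
  have eq: "pd b (pd a f) (x + s *\<^sub>R a + t *\<^sub>R b) = pd a (pd b f) (x + t' *\<^sub>R a + s' *\<^sub>R b)"
    using e1 e2 h by (simp add: algebra_simps)
  have "dist (pd b (pd a f) (x + s *\<^sub>R a + t *\<^sub>R b)) (pd b (pd a f) x) < e"
    "dist (pd a (pd b f) (x + t' *\<^sub>R a + s' *\<^sub>R b)) (pd a (pd b f) x) < e"
    using d1[OF near] d2[OF near] st st' by auto
  then have "dist (pd b (pd a f) x) (pd a (pd b f) x) < 2 * e"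
    unfolding eq by (metis add_strict_mono dist_commute dist_triangle_less_add mult_2)
  then show False by (simp add: e_def)
qed

lemma pd_symmetric:
  fixes f :: "'a::real_normed_vector \<Rightarrow> 'e::real_inner"
  assumes "coord_basis (B :: 'e set)" "open S" "x \<in> S" and f: "smooth_on S f"
  shows "pd b (pd a f) x = pd a (pd b f) x"
proof (rule coord_basis_eqI[OF assms(1)])
  fix c
  have *: "pd b (pd a f) x \<bullet> c = pd b (pd a (\<lambda>x. f x \<bullet> c)) x" for a b
  proof -
    have "pd b (pd a (\<lambda>x. f x \<bullet> c)) x = pd b (\<lambda>x. pd a f x \<bullet> c) x"
      by (rule pd_cong_open[OF assms(2,3)])
        (simp add: pd_bounded_linear[OF bounded_linear_inner_left] smooth_on_differentiable[OF f])
    then show ?thesis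
      by (simp add: pd_bounded_linear[OF bounded_linear_inner_left] smooth_on_differentiable[OF smooth_on_pd[OF f]] assms(3))
  qed
  show "pd b (pd a f) x \<bullet> c = pd a (pd b f) x \<bullet> c"
    unfolding * by (rule pd_symmetric_real[OF assms(2,3)])
      (rule smooth_on_bounded_linear[OF assms(2) bounded_linear_inner_left f])
qed

text \<open>Since the derivative is bilinear in the direction and in the first-order data of
  \<open>g\<close>, the product rule applies: one term with the direction frozen at
  \<open>h x\<close>, one with the direction differentiated. The expansion in \<open>B\<close> makes
  this a product rule for finite sums.\<close>

lemma pd_direction:
  fixes h :: "'a::real_normed_vector \<Rightarrow> 'b::real_inner" and g :: "'b \<Rightarrow> 'c::real_normed_vector"
    and f :: "'a \<Rightarrow> 'b"
  assumes B: "coord_basis (B :: 'b set)" and U: "open U" "x \<in> U" and T: "open T" "f ` U \<subseteq> T"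
    and f: "f differentiable (at x)" and dg: "\<And>y. y \<in> T \<Longrightarrow> g differentiable (at y)"
    and g: "\<And>b. pd b g differentiable (at (f x))" and h: "h differentiable (at x)"
  shows "pd d (\<lambda>x. pd (h x) g (f x)) x = pd (pd d f x) (pd (h x) g) (f x) + pd (pd d h x) g (f x)"
proof -
  let ?D = "\<lambda>d. \<Sum>b\<in>B. (h x \<bullet> b) *\<^sub>R pd (pd d f x) (pd b g) (f x) + (pd d h x \<bullet> b) *\<^sub>R pd b g (f x)"
  have comp: "((\<lambda>x. pd b g (f x)) has_derivative (\<lambda>d. pd (pd d f x) (pd b g) (f x))) (at x)" for b
    by (rule has_derivative_compose[OF pd_has_derivative[OF f] pd_has_derivative[OF g]])
  have inner: "((\<lambda>x. h x \<bullet> b) has_derivative (\<lambda>d. pd d h x \<bullet> b)) (at x)" for b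
    by (rule has_derivative_inner_left[OF pd_has_derivative[OF h]])
  have "((\<lambda>x. \<Sum>b\<in>B. (h x \<bullet> b) *\<^sub>R pd b g (f x)) has_derivative ?D) (at x)"
    by (intro has_derivative_sum has_derivative_scaleR inner comp)
  moreover have "(\<Sum>b\<in>B. (h y \<bullet> b) *\<^sub>R pd b g (f y)) = pd (h y) g (f y)" if "y \<in> U" for y
    by (rule linear_coord_expand[OF B pd_linear[OF dg], symmetric]) (use that T in auto)
  ultimately have *: "((\<lambda>x. pd (h x) g (f x)) has_derivative ?D) (at x)"
    by (rule has_derivative_transform_within_open[OF _ U])
  have fx: "f x \<in> T" using U T by auto
  have "((\<lambda>y. \<Sum>b\<in>B. (h x \<bullet> b) *\<^sub>R pd b g y) has_derivative (\<lambda>e. \<Sum>b\<in>B. (h x \<bullet> b) *\<^sub>R pd e (pd b g) (f x))) (at (f x))"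
    by (intro has_derivative_sum has_derivative_scaleR_right pd_has_derivative g)
  moreover have "(\<Sum>b\<in>B. (h x \<bullet> b) *\<^sub>R pd b g y) = pd (h x) g y" if "y \<in> T" for y
    by (rule linear_coord_expand[OF B pd_linear[OF dg[OF that]], symmetric])
  ultimately have "(pd (h x) g has_derivative (\<lambda>e. \<Sum>b\<in>B. (h x \<bullet> b) *\<^sub>R pd e (pd b g) (f x))) (at (f x))"
    by (rule has_derivative_transform_within_open[OF _ T(1) fx])
  then have "pd e (pd (h x) g) (f x) = (\<Sum>b\<in>B. (h x \<bullet> b) *\<^sub>R pd e (pd b g) (f x))" for e
    by (rule pd_eqI)
  then show "pd d (\<lambda>x. pd (h x) g (f x)) x = pd (pd d f x) (pd (h x) g) (f x) + pd (pd d h x) g (f x)"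
    using pd_eqI[OF *, of d] linear_coord_expand[OF B pd_linear[OF dg[OF fx]], of "pd d h x"]
    by (simp add: sum.distrib)
qed

section \<open>Charts and smooth maps\<close>

text \<open>A smooth manifold without second countability, so that also the coordinate spaces, of class
  \<open>real_inner\<close>, qualify.\<close>

definition smooth_atlas :: "'e::real_inner set \<Rightarrow> ('p::topological_space,'e) chart set \<Rightarrow> bool" where
  "smooth_atlas B A \<longleftrightarrow> coord_basis B \<and> (\<Union>c\<in>A. fst c) = UNIV \<and>
     (\<forall>c\<in>A. is_chart c) \<and> (\<forall>c\<in>A. \<forall>d\<in>A. compatible c d)"

lemma smooth_manifold_imp_atlas: "smooth_manifold B A \<Longrightarrow> smooth_atlas B A"
  by (simp add: smooth_manifold_def smooth_atlas_def)

lemma smooth_atlas_coord_basis: "smooth_atlas B A \<Longrightarrow> coord_basis B"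
  by (simp add: smooth_atlas_def)

lemma smooth_atlas_is_chart: "smooth_atlas B A \<Longrightarrow> c \<in> A \<Longrightarrow> is_chart c"
  by (simp add: smooth_atlas_def)

lemma smooth_atlas_chart_ex: "smooth_atlas B A \<Longrightarrow> \<exists>c\<in>A. p \<in> fst c"
  unfolding smooth_atlas_def by blast

lemma
  assumes "is_chart c"
  shows is_chart_open: "open (fst c)"
    and is_chart_open_image: "open (chart_image c)"
    and is_chart_inv: "p \<in> fst c \<Longrightarrow> inv_chart c (snd c p) = p"
    and is_chart_inv_in: "x \<in> chart_image c \<Longrightarrow> inv_chart c x \<in> fst c"
    and is_chart_image: "x \<in> chart_image c \<Longrightarrow> snd c (inv_chart c x) = x"
    and is_chart_cont: "continuous_on (fst c) (snd c)"
    and is_chart_cont_inv: "continuous_on (chart_image c) (inv_chart c)"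
proof -
  show "open (fst c)" "open (chart_image c)" using assms by (auto simp: is_chart_def)
  have h: "homeomorphism (fst c) (chart_image c) (snd c) (inv_chart c)"
    using assms by (simp add: is_chart_def)
  show "p \<in> fst c \<Longrightarrow> inv_chart c (snd c p) = p" using homeomorphism_apply1[OF h] .
  show "x \<in> chart_image c \<Longrightarrow> inv_chart c x \<in> fst c" by (rule inv_into_into)
  show "x \<in> chart_image c \<Longrightarrow> snd c (inv_chart c x) = x" by (rule f_inv_into_f)
  show "continuous_on (fst c) (snd c)" "continuous_on (chart_image c) (inv_chart c)"
    using homeomorphism_cont1[OF h] homeomorphism_cont2[OF h] by auto
qed

lemma chart_image_Int:
  assumes "is_chart c"
  shows "snd c ` (fst c \<inter> W) = chart_image c \<inter> inv_chart c -` W"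
  using is_chart_inv[OF assms] is_chart_image[OF assms] is_chart_inv_in[OF assms] by force

lemma open_chart_image_Int:
  assumes "is_chart c" "open W"
  shows "open (snd c ` (fst c \<inter> W))"
  unfolding chart_image_Int[OF assms(1)]
  by (rule continuous_open_preimage[OF is_chart_cont_inv[OF assms(1)] is_chart_open_image[OF assms(1)] assms(2)])

lemma smooth_map_on_open: "smooth_map_on A B W f \<Longrightarrow> open W"
  and smooth_map_on_continuous: "smooth_map_on A B W f \<Longrightarrow> continuous_on W f"
  by (auto simp: smooth_map_on_def)

lemma smooth_map_on_vimage_open: "smooth_map_on A B W f \<Longrightarrow> open V \<Longrightarrow> open (W \<inter> f -` V)"
  by (simp add: smooth_map_on_def continuous_open_preimage)

lemma smooth_map_on_chart:
  assumes "smooth_map_on A B W f" "c \<in> A" "d \<in> B"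
  shows "smooth_on (snd c ` (fst c \<inter> W \<inter> f -` fst d)) (\<lambda>x. snd d (f (inv_chart c x)))"
  using assms by (auto simp: smooth_map_on_def comp_def)

lemma smooth_map_onI:
  assumes "open W" "continuous_on W f"
    "\<And>c d. c \<in> A \<Longrightarrow> d \<in> B \<Longrightarrow>
      smooth_on (snd c ` (fst c \<inter> W \<inter> f -` fst d)) (\<lambda>x. snd d (f (inv_chart c x)))"
  shows "smooth_map_on A B W f"
  using assms by (auto simp: smooth_map_on_def comp_def)

lemma smooth_map_on_subset:
  "smooth_map_on A B W f \<Longrightarrow> open V \<Longrightarrow> V \<subseteq> W \<Longrightarrow> smooth_map_on A B V f"
  by (rule smooth_map_onI)
    (auto intro: continuous_on_subset[OF smooth_map_on_continuous] smooth_on_subset[OF smooth_map_on_chart])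

text \<open>The outer families are only asked to consist of charts, so that \<open>std_atlas\<close>
  and \<open>admissible A\<close> may stand there without further ado; the middle one has to cover,
  because a chart around the intermediate point is used.\<close>

lemma smooth_map_on_compose:
  fixes f :: "'p::topological_space \<Rightarrow> 'q::topological_space" and g :: "'q \<Rightarrow> 'r::topological_space"
    and BB :: "'f::real_inner set"
  assumes A: "\<And>c. c \<in> A \<Longrightarrow> is_chart c" and B: "smooth_atlas BB B" and C: "\<And>c. c \<in> C \<Longrightarrow> is_chart c"
    and f: "smooth_map_on A B W f" and g: "smooth_map_on B C V g" and WV: "f ` W \<subseteq> V"
  shows "smooth_map_on A C W (\<lambda>p. g (f p))"
proof (rule smooth_map_onI)
  show "open W" using f by (rule smooth_map_on_open)
  show "continuous_on W (\<lambda>p. g (f p))"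
    using continuous_on_compose2[OF smooth_map_on_continuous[OF g] smooth_map_on_continuous[OF f] WV] .
  fix c d assume cd: "c \<in> A" "d \<in> C"
  show "smooth_on (snd c ` (fst c \<inter> W \<inter> (\<lambda>p. g (f p)) -` fst d)) (\<lambda>x. snd d (g (f (inv_chart c x))))"
  proof (rule smooth_on_local)
    fix x assume "x \<in> snd c ` (fst c \<inter> W \<inter> (\<lambda>p. g (f p)) -` fst d)"
    then obtain p where p: "p \<in> fst c" "p \<in> W" "g (f p) \<in> fst d" "x = snd c p" by auto
    \<comment> \<open>A chart of the middle manifold around the image point. The set
      \<open>U\<close> below is an open set on which the image stays in its domain, so that the two
      chart expressions can be composed.\<close>
    obtain e where e: "e \<in> B" "f p \<in> fst e" using smooth_atlas_chart_ex[OF B] by blast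
    define N where "N = fst e \<inter> (V \<inter> g -` fst d)"
    have N: "open N"
      unfolding N_def using is_chart_open[OF smooth_atlas_is_chart[OF B e(1)]]
        smooth_map_on_vimage_open[OF g is_chart_open[OF C[OF cd(2)]]] by (rule open_Int)
    define U where "U = snd c ` (fst c \<inter> (W \<inter> f -` N))"
    have U: "open U" unfolding U_def
      by (rule open_chart_image_Int[OF A[OF cd(1)] smooth_map_on_vimage_open[OF f N]])
    have xU: "x \<in> U" unfolding U_def N_def using p e WV by blast
    have Uin: "inv_chart c y \<in> fst c \<and> inv_chart c y \<in> W \<and> f (inv_chart c y) \<in> N" if "y \<in> U" for y
      using that is_chart_inv[OF A[OF cd(1)]] unfolding U_def by force
    have "smooth_on U (\<lambda>x. snd e (f (inv_chart c x)))"
      by (rule smooth_on_subset[OF smooth_map_on_chart[OF f cd(1) e(1)]]) (auto simp: U_def N_def)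
    moreover have "smooth_on (snd e ` N) (\<lambda>x. snd d (g (inv_chart e x)))"
      by (rule smooth_on_subset[OF smooth_map_on_chart[OF g e(1) cd(2)]]) (auto simp: N_def)
    ultimately have "smooth_on U (\<lambda>x. snd d (g (inv_chart e (snd e (f (inv_chart c x))))))"
      by (rule smooth_on_compose[OF smooth_atlas_coord_basis[OF B] U]) (use Uin in auto)
    then have "smooth_on U (\<lambda>x. snd d (g (f (inv_chart c x))))"
    proof (rule smooth_on_cong_open[OF U, rotated])
      fix y assume "y \<in> U"
      from Uin[OF this] have "f (inv_chart c y) \<in> fst e" by (simp add: N_def)
      from is_chart_inv[OF smooth_atlas_is_chart[OF B e(1)] this]
      show "snd d (g (inv_chart e (snd e (f (inv_chart c y))))) = snd d (g (f (inv_chart c y)))" by simp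
    qed
    then show "\<exists>U. open U \<and> x \<in> U \<and> smooth_on U (\<lambda>x. snd d (g (f (inv_chart c x))))"
      using U xU by blast
  qed
qed

lemma admissible_is_chart: "c \<in> admissible A \<Longrightarrow> is_chart c"
  by (simp add: admissible_def)

lemma smooth_atlas_subset_admissible: "smooth_atlas B A \<Longrightarrow> A \<subseteq> admissible A"
  by (auto simp: smooth_atlas_def admissible_def)

text \<open>Compatibility of charts is smoothness of the identity map between them. A change of
  atlas thus becomes composition with the identity.\<close>

lemma smooth_map_on_id_admissible:
  shows "smooth_map_on (admissible A) A UNIV (\<lambda>p. p)"
    and "smooth_map_on A (admissible A) UNIV (\<lambda>p. p)"
  by (rule smooth_map_onI; force simp: admissible_def compatible_def comp_def vimage_def Int_def conj_commute)+

lemma smooth_map_on_admissible: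
  assumes A: "smooth_atlas BA A" and B: "smooth_atlas BB B" and f: "smooth_map_on A B W f"
  shows "smooth_map_on (admissible A) (admissible B) W f"
proof -
  have "smooth_map_on (admissible A) A W (\<lambda>p. p)"
    by (rule smooth_map_on_subset[OF smooth_map_on_id_admissible(1) smooth_map_on_open[OF f]]) simp
  from smooth_map_on_compose[OF admissible_is_chart A smooth_atlas_is_chart[OF B] this f]
  have "smooth_map_on (admissible A) B W f" by simp
  from smooth_map_on_compose[OF admissible_is_chart B admissible_is_chart this smooth_map_on_id_admissible(2)]
  show ?thesis by simp
qed

lemma smooth_map_on_id: "smooth_atlas B A \<Longrightarrow> open W \<Longrightarrow> smooth_map_on A A W (\<lambda>p. p)"
  by (rule smooth_map_on_subset[where W = UNIV], rule smooth_map_onI)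
    (auto simp: smooth_atlas_def compatible_def comp_def vimage_def Int_def conj_commute)

text \<open>\<open>admissible\<close> demands compatibility with the charts of \<open>A\<close>
  only. That two admissible charts are compatible with each other follows by factoring the identity
  through \<open>A\<close>.\<close>

lemma smooth_atlas_admissible:
  assumes "smooth_atlas B A"
  shows "smooth_atlas B (admissible A)"
proof -
  have "smooth_map_on (admissible A) (admissible A) UNIV (\<lambda>p. p)"
    by (rule smooth_map_on_admissible[OF assms assms smooth_map_on_id[OF assms open_UNIV]])
  from smooth_map_on_chart[OF this]
  have "compatible c d" if "c \<in> admissible A" "d \<in> admissible A" for c d
    unfolding compatible_def comp_def using that by (metis Int_UNIV_right Int_commute vimage_ident)
  moreover have "(\<Union>c\<in>admissible A. fst c) = UNIV"
    using smooth_atlas_subset_admissible[OF assms] assms unfolding smooth_atlas_def by blast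
  ultimately show ?thesis using assms admissible_is_chart by (auto simp: smooth_atlas_def)
qed

lemma charts_at_ex: "smooth_atlas B A \<Longrightarrow> \<exists>c. c \<in> charts_at A p"
  using smooth_atlas_chart_ex[of B A p] smooth_atlas_subset_admissible[of B A] unfolding charts_at_def by blast

lemma charts_atD: "c \<in> charts_at A p \<Longrightarrow> c \<in> admissible A" "c \<in> charts_at A p \<Longrightarrow> p \<in> fst c"
  by (auto simp: charts_at_def)

lemma charts_at_some: "smooth_atlas B A \<Longrightarrow> (SOME c. c \<in> charts_at A p) \<in> charts_at A p"
  using charts_at_ex someI_ex by metis

section \<open>Vector spaces as manifolds, charts as smooth maps, products\<close>

lemma inv_into_UNIV_id [simp]: "inv_into UNIV id = id" "inv_into UNIV (\<lambda>x. x) = (\<lambda>x. x)"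
  by (simp_all add: fun_eq_iff inv_into_f_eq)

lemma std_atlas_is_chart: "c \<in> std_atlas \<Longrightarrow> is_chart c"
  by (auto simp: std_atlas_def is_chart_def homeomorphism_def continuous_on_id id_def)

lemma smooth_atlas_std: "coord_basis B \<Longrightarrow> smooth_atlas B std_atlas"
  unfolding smooth_atlas_def
  by (auto simp: std_atlas_is_chart) (auto simp: std_atlas_def compatible_def comp_def id_def smooth_on_id)

lemma smooth_map_on_std:
  "smooth_map_on std_atlas std_atlas W f \<longleftrightarrow> open W \<and> smooth_on W f"
  by (auto simp: smooth_map_on_def std_atlas_def comp_def smooth_on_continuous)

text \<open>Treating the vector space as a manifold makes charts and their inverses ordinary smooth
  maps, so the composition lemma replaces computations with overlaps.\<close>

lemma smooth_map_on_inv_chart: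
  assumes "c \<in> admissible A"
  shows "smooth_map_on std_atlas A (chart_image c) (inv_chart c)"
proof (rule smooth_map_onI)
  note c = admissible_is_chart[OF assms]
  show "open (chart_image c)" "continuous_on (chart_image c) (inv_chart c)"
    using is_chart_open_image[OF c] is_chart_cont_inv[OF c] by auto
  fix c' d assume "c' \<in> (std_atlas :: ('b, 'b) chart set)" "d \<in> A"
  then show "smooth_on (snd c' ` (fst c' \<inter> chart_image c \<inter> inv_chart c -` fst d))
      (\<lambda>x. snd d (inv_chart c (inv_chart c' x)))"
    using assms chart_image_Int[OF c, of "fst d"]
    by (auto simp: admissible_def compatible_def comp_def std_atlas_def)
qed

lemma smooth_map_on_chart_map:
  assumes "c \<in> admissible A"
  shows "smooth_map_on A std_atlas (fst c) (snd c)"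
proof (rule smooth_map_onI)
  note c = admissible_is_chart[OF assms]
  show "open (fst c)" "continuous_on (fst c) (snd c)"
    using is_chart_open[OF c] is_chart_cont[OF c] by auto
  fix d c' assume "c' \<in> (std_atlas :: ('b, 'b) chart set)" "d \<in> A"
  then show "smooth_on (snd d ` (fst d \<inter> fst c \<inter> snd c -` fst c')) (\<lambda>x. snd c' (snd c (inv_chart d x)))"
    using assms by (auto simp: admissible_def compatible_def comp_def std_atlas_def Int_commute)
qed

lemma inv_chart_prod:
  assumes "is_chart c" "is_chart d" "x \<in> chart_image c" "y \<in> chart_image d"
  shows "inv_into (fst c \<times> fst d) (map_prod (snd c) (snd d)) (x, y) = (inv_chart c x, inv_chart d y)"
proof (rule inv_into_f_eq)
  show "inj_on (map_prod (snd c) (snd d)) (fst c \<times> fst d)"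
    using is_chart_inv[OF assms(1)] is_chart_inv[OF assms(2)]
    by (intro map_prod_inj_on inj_on_inverseI[where g = "inv_chart c"] inj_on_inverseI[where g = "inv_chart d"])
qed (simp_all add: is_chart_inv_in[OF assms(1,3)] is_chart_inv_in[OF assms(2,4)]
    is_chart_image[OF assms(1,3)] is_chart_image[OF assms(2,4)])

lemma is_chart_prod:
  assumes "is_chart c" "is_chart d"
  shows "is_chart (fst c \<times> fst d, map_prod (snd c) (snd d))"
proof -
  have im: "map_prod (snd c) (snd d) ` (fst c \<times> fst d) = chart_image c \<times> chart_image d" by auto
  have "continuous_on (chart_image c \<times> chart_image d) (\<lambda>z. (inv_chart c (fst z), inv_chart d (snd z)))"
    by (intro continuous_intros continuous_on_compose2[OF is_chart_cont_inv[OF assms(1)]]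
        continuous_on_compose2[OF is_chart_cont_inv[OF assms(2)]]) auto
  then have "continuous_on (chart_image c \<times> chart_image d) (inv_into (fst c \<times> fst d) (map_prod (snd c) (snd d)))"
    by (rule continuous_on_eq) (auto simp: inv_chart_prod[OF assms])
  moreover have "continuous_on (fst c \<times> fst d) (\<lambda>z. (snd c (fst z), snd d (snd z)))"
    by (intro continuous_intros continuous_on_compose2[OF is_chart_cont[OF assms(1)]]
        continuous_on_compose2[OF is_chart_cont[OF assms(2)]]) auto
  then have "continuous_on (fst c \<times> fst d) (map_prod (snd c) (snd d))"
    by (simp add: map_prod_def case_prod_unfold)
  ultimately have "homeomorphism (fst c \<times> fst d) (chart_image c \<times> chart_image d) (map_prod (snd c) (snd d))
      (inv_into (fst c \<times> fst d) (map_prod (snd c) (snd d)))"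
  proof (intro homeomorphismI)
    show "map_prod (snd c) (snd d) ` (fst c \<times> fst d) \<subseteq> chart_image c \<times> chart_image d" by auto
    show "inv_into (fst c \<times> fst d) (map_prod (snd c) (snd d)) ` (chart_image c \<times> chart_image d) \<subseteq> fst c \<times> fst d"
      by (auto simp: inv_chart_prod[OF assms] is_chart_inv[OF assms(1)] is_chart_inv[OF assms(2)])
    show "inv_into (fst c \<times> fst d) (map_prod (snd c) (snd d)) (map_prod (snd c) (snd d) z) = z" if "z \<in> fst c \<times> fst d" for z
      using that inv_chart_prod[OF assms, of "snd c (fst z)" "snd d (snd z)"]
      by (auto simp: is_chart_inv[OF assms(1)] is_chart_inv[OF assms(2)])
    show "map_prod (snd c) (snd d) (inv_into (fst c \<times> fst d) (map_prod (snd c) (snd d)) z) = z"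
      if "z \<in> chart_image c \<times> chart_image d" for z
      by (rule f_inv_into_f) (use that im in auto)
  qed
  then show ?thesis
    unfolding is_chart_def fst_conv snd_conv im
    by (simp add: open_Times is_chart_open is_chart_open_image assms)
qed

lemma smooth_atlas_prod:
  fixes A :: "('p::topological_space,'e::real_inner) chart set" and B :: "('q::topological_space,'f::real_inner) chart set"
  assumes A: "smooth_atlas BA A" and B: "smooth_atlas BB B"
  shows "smooth_atlas ((\<lambda>b. (b, 0)) ` BA \<union> (\<lambda>c. (0, c)) ` BB) (prod_atlas A B)"
proof -
  have half: "smooth_on (map_prod (snd c) (snd d) ` (fst c \<times> fst d \<inter> fst c' \<times> fst d'))
      (map_prod (snd c') (snd d') \<circ> inv_into (fst c \<times> fst d) (map_prod (snd c) (snd d)))"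
    if c: "c \<in> A" "c' \<in> A" and d: "d \<in> B" "d' \<in> B" for c c' d d'
  proof -
    note cc = smooth_atlas_is_chart[OF A c(1)] note cd = smooth_atlas_is_chart[OF B d(1)]
    define U where "U = snd c ` (fst c \<inter> fst c')"
    define V where "V = snd d ` (fst d \<inter> fst d')"
    have UV: "open U" "open V"
      unfolding U_def V_def using open_chart_image_Int is_chart_open smooth_atlas_is_chart A B c d by metis+
    have f: "smooth_on U (\<lambda>x. snd c' (inv_chart c x))" and g: "smooth_on V (\<lambda>x. snd d' (inv_chart d x))"
      using A B c d by (auto simp: smooth_atlas_def compatible_def U_def V_def comp_def)
    have "smooth_on (U \<times> V) (\<lambda>z. (snd c' (inv_chart c (fst z)), snd d' (inv_chart d (snd z))))"
      by (intro smooth_on_Pair open_Times UV smooth_on_compose[OF smooth_atlas_coord_basis[OF A] _ _ f]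
          smooth_on_compose[OF smooth_atlas_coord_basis[OF B] _ _ g] smooth_on_bounded_linear[OF _ bounded_linear_fst]
          smooth_on_bounded_linear[OF _ bounded_linear_snd] smooth_on_id) auto
    then have "smooth_on (U \<times> V) (map_prod (snd c') (snd d') \<circ> inv_into (fst c \<times> fst d) (map_prod (snd c) (snd d)))"
      by (rule smooth_on_cong_open[OF open_Times[OF UV], rotated])
        (auto simp: U_def V_def inv_chart_prod[OF cc cd])
    moreover have "map_prod (snd c) (snd d) ` (fst c \<times> fst d \<inter> fst c' \<times> fst d') = U \<times> V"
      unfolding U_def V_def Times_Int_Times by auto
    ultimately show ?thesis by simp
  qed
  have "p \<in> (\<Union>c\<in>prod_atlas A B. fst c)" for p
  proof -
    obtain c d where cd: "c \<in> A" "d \<in> B" "fst p \<in> fst c" "snd p \<in> fst d"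
      using smooth_atlas_chart_ex[OF A] smooth_atlas_chart_ex[OF B] by metis
    then have "(fst c \<times> fst d, map_prod (snd c) (snd d)) \<in> prod_atlas A B" unfolding prod_atlas_def by blast
    then show ?thesis by (rule UN_I) (use cd in \<open>simp add: mem_Times_iff\<close>)
  qed
  then have "(\<Union>c\<in>prod_atlas A B. fst c) = UNIV" by blast
  moreover have "is_chart c" if "c \<in> prod_atlas A B" for c
    using that smooth_atlas_is_chart[OF A] smooth_atlas_is_chart[OF B] is_chart_prod unfolding prod_atlas_def by blast
  moreover have "compatible c d" if "c \<in> prod_atlas A B" "d \<in> prod_atlas A B" for c d
  proof -
    obtain c1 c2 where c: "c = (fst c1 \<times> fst c2, map_prod (snd c1) (snd c2))" "c1 \<in> A" "c2 \<in> B"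
      using \<open>c \<in> prod_atlas A B\<close> unfolding prod_atlas_def by blast
    obtain d1 d2 where d: "d = (fst d1 \<times> fst d2, map_prod (snd d1) (snd d2))" "d1 \<in> A" "d2 \<in> B"
      using \<open>d \<in> prod_atlas A B\<close> unfolding prod_atlas_def by blast
    show ?thesis
      unfolding compatible_def c(1) d(1) fst_conv snd_conv
      using half[OF c(2) d(2) c(3) d(3)] half[OF d(2) c(2) d(3) c(3)] by (simp only: Int_commute)
  qed
  ultimately show ?thesis
    unfolding smooth_atlas_def using coord_basis_prod[OF smooth_atlas_coord_basis[OF A] smooth_atlas_coord_basis[OF B]]
    by blast
qed

lemma smooth_map_on_snd:
  assumes A: "smooth_atlas BA A" and B: "smooth_atlas BB B"
  shows "smooth_map_on (prod_atlas A B) B UNIV snd"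
proof (rule smooth_map_onI)
  fix e c' assume "e \<in> prod_atlas A B" and c': "c' \<in> B"
  then obtain c d where cd: "c \<in> A" "d \<in> B" and e: "e = (fst c \<times> fst d, map_prod (snd c) (snd d))"
    unfolding prod_atlas_def by blast
  note cc = smooth_atlas_is_chart[OF A cd(1)] note dd = smooth_atlas_is_chart[OF B cd(2)]
  define U where "U = snd d ` (fst d \<inter> fst c')"
  have U: "open U" unfolding U_def
    by (rule open_chart_image_Int[OF dd is_chart_open[OF smooth_atlas_is_chart[OF B c']]])
  have f: "smooth_on U (\<lambda>x. snd c' (inv_chart d x))"
    using B cd c' by (auto simp: smooth_atlas_def compatible_def U_def comp_def)
  have o: "open (chart_image c \<times> U)" by (intro open_Times U is_chart_open_image cc)
  have "smooth_on (chart_image c \<times> U) (\<lambda>z. snd c' (inv_chart d (snd z)))"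
    by (intro o smooth_on_compose[OF smooth_atlas_coord_basis[OF B] _ _ f]
        smooth_on_bounded_linear[OF _ bounded_linear_snd] smooth_on_id) auto
  then have "smooth_on (chart_image c \<times> U) (\<lambda>x. snd c' (snd (inv_chart e x)))"
    by (rule smooth_on_cong_open[OF o, rotated]) (auto simp: e U_def inv_chart_prod[OF cc dd])
  moreover have "snd e ` (fst e \<inter> UNIV \<inter> snd -` fst c') = chart_image c \<times> U"
    unfolding e U_def by (auto simp: image_iff)
  ultimately show "smooth_on (snd e ` (fst e \<inter> UNIV \<inter> snd -` fst c')) (\<lambda>x. snd c' (snd (inv_chart e x)))"
    by simp
qed (simp_all add: continuous_on_fst continuous_on_snd continuous_on_id)

lemma smooth_map_on_Pair:
  assumes A: "\<And>c. c \<in> A \<Longrightarrow> is_chart c" and B: "\<And>c. c \<in> B \<Longrightarrow> is_chart c" and C: "\<And>c. c \<in> C \<Longrightarrow> is_chart c"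
    and f: "smooth_map_on A B W f" and g: "smooth_map_on A C W g"
  shows "smooth_map_on A (prod_atlas B C) W (\<lambda>p. (f p, g p))"
proof (rule smooth_map_onI)
  show W: "open W" using f by (rule smooth_map_on_open)
  show "continuous_on W (\<lambda>p. (f p, g p))"
    using f g by (intro continuous_on_Pair smooth_map_on_continuous)
  fix a e assume a: "a \<in> A" and "e \<in> prod_atlas B C"
  then obtain c d where cd: "c \<in> B" "d \<in> C" and e: "e = (fst c \<times> fst d, map_prod (snd c) (snd d))"
    unfolding prod_atlas_def by blast
  define U where "U = snd a ` (fst a \<inter> ((W \<inter> f -` fst c) \<inter> (W \<inter> g -` fst d)))"
  have U: "open U" unfolding U_def
    by (intro open_chart_image_Int A a open_Int smooth_map_on_vimage_open[OF f] smooth_map_on_vimage_open[OF g]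
        is_chart_open B C cd)
  have "smooth_on U (\<lambda>x. (snd c (f (inv_chart a x)), snd d (g (inv_chart a x))))"
    by (intro smooth_on_Pair U smooth_on_subset[OF smooth_map_on_chart[OF f a cd(1)]]
        smooth_on_subset[OF smooth_map_on_chart[OF g a cd(2)]]) (auto simp: U_def)
  moreover have "snd a ` (fst a \<inter> W \<inter> (\<lambda>p. (f p, g p)) -` fst e) = U"
    unfolding U_def e by (rule arg_cong[where f = "\<lambda>X. snd a ` X"]) auto
  ultimately show "smooth_on (snd a ` (fst a \<inter> W \<inter> (\<lambda>p. (f p, g p)) -` fst e)) (\<lambda>x. snd e (f (inv_chart a x), g (inv_chart a x)))"
    by (simp add: e)
qed

section \<open>Tangent vectors\<close>

lemma smooth_map_on_coords:
  assumes A: "smooth_atlas B A" and u: "smooth_map_on std_atlas A W u" and c: "c \<in> admissible A"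
  shows "open (W \<inter> u -` fst c)" and "smooth_on (W \<inter> u -` fst c) (\<lambda>s. snd c (u s))"
proof -
  show "open (W \<inter> u -` fst c)"
    by (rule smooth_map_on_vimage_open[OF u is_chart_open[OF admissible_is_chart[OF c]]])
  have "smooth_map_on std_atlas (admissible A) W u"
    using smooth_map_on_compose[OF std_atlas_is_chart A admissible_is_chart u smooth_map_on_id_admissible(2)] by simp
  from smooth_map_on_chart[OF this, of "(UNIV, id)"] c
  show "smooth_on (W \<inter> u -` fst c) (\<lambda>s. snd c (u s))"
    by (simp add: std_atlas_def)
qed

lemma coords_differentiable:
  assumes "smooth_atlas B A" "smooth_map_on std_atlas A W u" "x \<in> W" "c \<in> charts_at A (u x)"
  shows "(\<lambda>s. snd c (u s)) differentiable (at x)"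
  by (rule smooth_on_differentiable[OF smooth_map_on_coords(2)[OF assms(1,2) charts_atD(1)[OF assms(4)]]])
    (use assms charts_atD(2)[OF assms(4)] in auto)

lemma pushvec_apply: "c \<in> charts_at A (u x) \<Longrightarrow> pushvec A u x d c = pd d (\<lambda>s. snd c (u s)) x"
  by (simp add: pushvec_def comp_def)

lemma pushvec_outside: "c \<notin> charts_at A (u x) \<Longrightarrow> pushvec A u x d c = 0"
  by (simp add: pushvec_def)

lemma pushvec_cong_open:
  assumes "open S" "x \<in> S" "\<And>y. y \<in> S \<Longrightarrow> f y = g y"
  shows "pushvec A f x d = pushvec A g x d"
  unfolding pushvec_def assms(3)[OF assms(2)] comp_def
  by (rule ext) (simp add: pd_cong_open[OF assms(1,2), of "\<lambda>s. snd _ (f s)"] assms(3))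

lemma pushvec_sum:
  assumes "smooth_atlas B A" "smooth_map_on std_atlas A W u" "x \<in> W"
  shows "pushvec A u x (\<Sum>i\<in>I. r i *\<^sub>R d i) = lincomb I r (\<lambda>i. pushvec A u x (d i))"
proof
  fix c
  show "pushvec A u x (\<Sum>i\<in>I. r i *\<^sub>R d i) c = lincomb I r (\<lambda>i. pushvec A u x (d i)) c"
  proof (cases "c \<in> charts_at A (u x)")
    case True
    note lin = pd_linear[OF coords_differentiable[OF assms True]]
    show ?thesis by (simp add: lincomb_def pushvec_apply True linear_sum[OF lin] linear_scale[OF lin])
  qed (simp add: pushvec_outside lincomb_def)
qed

lemma pushvec_add:
  assumes "smooth_atlas B A" "smooth_map_on std_atlas A W u" "x \<in> W"
  shows "pushvec A u x (d + e) = vadd (pushvec A u x d) (pushvec A u x e)"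
proof
  fix c
  show "pushvec A u x (d + e) c = vadd (pushvec A u x d) (pushvec A u x e) c"
  proof (cases "c \<in> charts_at A (u x)")
    case True
    note lin = pd_linear[OF coords_differentiable[OF assms True]]
    show ?thesis by (simp add: vadd_def pushvec_apply True linear_add[OF lin])
  qed (simp add: pushvec_outside vadd_def)
qed

lemma pushvec_reparam:
  assumes A: "smooth_atlas B A" and u: "smooth_map_on std_atlas A W u" "a t \<in> W" and a: "a differentiable (at t)"
  shows "pushvec A (\<lambda>s. u (a s)) t d = pushvec A u (a t) (pd d a t)"
proof
  fix c
  show "pushvec A (\<lambda>s. u (a s)) t d c = pushvec A u (a t) (pd d a t) c"
  proof (cases "c \<in> charts_at A (u (a t))")
    case True
    then show ?thesis
      by (simp add: pushvec_apply pd_compose[OF a coords_differentiable[OF A u True]])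
  qed (simp add: pushvec_outside)
qed

text \<open>The Leibniz rule for a map of two arguments. It splits the velocity of a moving group
  element acting on a moving point, and the velocity of a curve in a trivialization.\<close>

lemma pushvec_Pair:
  fixes F :: "'v::real_inner \<times> 'w::real_inner \<Rightarrow> 'p::topological_space"
  assumes A: "smooth_atlas B A" and F: "smooth_map_on std_atlas A W F" "(x, y) \<in> W"
  shows "pushvec A F (x, y) (d, e) = vadd (pushvec A (\<lambda>x. F (x, y)) x d) (pushvec A (\<lambda>y. F (x, y)) y e)"
proof -
  have dx: "((\<lambda>x. (x, y)) has_derivative (\<lambda>d. (d, 0))) (at x)"
    and dy: "((\<lambda>y. (x, y)) has_derivative (\<lambda>e. (0, e))) (at y)"
    by (auto intro!: derivative_eq_intros)
  have "pushvec A (\<lambda>x. F (x, y)) x d = pushvec A F (x, y) (d, 0)"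
    using pushvec_reparam[OF A F(1), of "\<lambda>x. (x, y)" x d] F(2) pd_eqI[OF dx, of d] dx
    by (simp add: differentiableI)
  moreover have "pushvec A (\<lambda>y. F (x, y)) y e = pushvec A F (x, y) (0, e)"
    using pushvec_reparam[OF A F(1), of "\<lambda>y. (x, y)" y e] F(2) pd_eqI[OF dy, of e] dy
    by (simp add: differentiableI)
  ultimately show ?thesis using pushvec_add[OF A F, of "(d, 0)" "(0, e)"] by simp
qed

lemma inv_chart_at:
  assumes "c \<in> charts_at A p"
  shows "snd c p \<in> chart_image c" "inv_chart c (snd c p) = p" "p \<in> fst c" "c \<in> admissible A"
    "smooth_map_on std_atlas A (chart_image c) (inv_chart c)"
    "smooth_map_on A std_atlas (fst c) (snd c)"
proof -
  show c: "c \<in> admissible A" "p \<in> fst c" by (rule charts_atD[OF assms])+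
  then show "snd c p \<in> chart_image c" by blast
  show "inv_chart c (snd c p) = p" by (rule is_chart_inv[OF admissible_is_chart[OF c(1)] c(2)])
  show "smooth_map_on std_atlas A (chart_image c) (inv_chart c)" "smooth_map_on A std_atlas (fst c) (snd c)"
    by (rule smooth_map_on_inv_chart[OF c(1)], rule smooth_map_on_chart_map[OF c(1)])
qed

lemma pushvec_in_tangent_space:
  assumes A: "smooth_atlas B A" and u: "smooth_map_on std_atlas A W u" "x \<in> W"
  shows "pushvec A u x d \<in> tangent_space A (u x)"
  unfolding tangent_space_def
proof (intro CollectI conjI ballI allI impI)
  fix c c' assume c: "c \<in> charts_at A (u x)" and c': "c' \<in> charts_at A (u x)"
  note ic = inv_chart_at[OF c]
  have diff: "(\<lambda>y. snd c' (inv_chart c y)) differentiable (at (snd c (u x)))"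
    by (rule coords_differentiable[OF A ic(5,1)]) (simp add: ic(2) c')
  have "pd d (\<lambda>s. snd c' (u s)) x = pd d (\<lambda>s. snd c' (inv_chart c (snd c (u s)))) x"
    by (rule pd_cong_open[OF smooth_map_on_coords(1)[OF A u(1) ic(4)]])
      (auto simp: u ic(3) is_chart_inv[OF admissible_is_chart[OF ic(4)]])
  also have "\<dots> = pd (pd d (\<lambda>s. snd c (u s)) x) (\<lambda>y. snd c' (inv_chart c y)) (snd c (u x))"
    by (rule pd_compose[OF coords_differentiable[OF A u c] diff])
  finally show "pushvec A u x d c' = pd (pushvec A u x d c) (snd c' \<circ> inv_chart c) (snd c (u x))"
    by (simp add: pushvec_apply c c' comp_def)
next
  show "pushvec A u x d c = 0" if "c \<notin> charts_at A (u x)" for c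
    using that by (simp add: pushvec_outside)
qed

lemma tangent_space_transform:
  "v \<in> tangent_space A p \<Longrightarrow> c \<in> charts_at A p \<Longrightarrow> d \<in> charts_at A p \<Longrightarrow>
    v d = pd (v c) (snd d \<circ> inv_chart c) (snd c p)"
  unfolding tangent_space_def by blast

text \<open>The transformation law says that one component determines the whole family. Statements
  about tangent maps thereby reduce to the chain rule for \<open>pushvec\<close>.\<close>

lemma tangent_space_eq_pushvec:
  assumes v: "v \<in> tangent_space A p" and c: "c \<in> charts_at A p"
  shows "v = pushvec A (inv_chart c) (snd c p) (v c)"
proof
  fix d
  note ic = inv_chart_at[OF c]
  show "v d = pushvec A (inv_chart c) (snd c p) (v c) d"
  proof (cases "d \<in> charts_at A p")
    case True
    have "v d = pd (v c) (snd d \<circ> inv_chart c) (snd c p)"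
      by (rule tangent_space_transform[OF v c True])
    then show ?thesis by (simp add: pushvec_def ic(2) True)
  next
    case False
    moreover have "v d = 0" using v False unfolding tangent_space_def by blast
    ultimately show ?thesis by (simp add: pushvec_def ic(2))
  qed
qed

lemma tangent_space_eqI:
  assumes "v \<in> tangent_space A p" "w \<in> tangent_space A p" "c \<in> charts_at A p" "v c = w c"
  shows "v = w"
  using tangent_space_eq_pushvec[OF assms(1,3)] tangent_space_eq_pushvec[OF assms(2,3)] assms(4) by simp

section \<open>Tangent maps of smooth maps between manifolds\<close>

lemma smooth_map_on_inv_chart_compose:
  assumes A: "smooth_atlas BA A" and B: "smooth_atlas BB B" and f: "smooth_map_on A B V f" and c: "c \<in> admissible A"
  shows "smooth_map_on std_atlas B (chart_image c \<inter> inv_chart c -` V) (\<lambda>y. f (inv_chart c y))"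
  by (rule smooth_map_on_compose[OF std_atlas_is_chart A smooth_atlas_is_chart[OF B] smooth_map_on_subset[OF smooth_map_on_inv_chart[OF c]
      smooth_map_on_vimage_open[OF smooth_map_on_inv_chart[OF c] smooth_map_on_open[OF f]]] f]) auto

text \<open>The chain rule: the chart selected inside \<open>tmap\<close> and its inverse occur in
  succession along \<open>u\<close> and cancel, so the selection does not influence the
  result.\<close>

lemma tmap_pushvec:
  assumes A: "smooth_atlas BA A" and B: "smooth_atlas BB B"
    and u: "smooth_map_on std_atlas A W u" "x \<in> W" and f: "smooth_map_on A B V f" "u x \<in> V"
  shows "tmap A B f (u x) (pushvec A u x d) = pushvec B (\<lambda>s. f (u s)) x d"
proof -
  define c where "c = (SOME c. c \<in> charts_at A (u x))"
  have c: "c \<in> charts_at A (u x)" unfolding c_def by (rule charts_at_some[OF A])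
  note ic = inv_chart_at[OF c]
  have V: "open V" using f(1) by (rule smooth_map_on_open)
  note fi = smooth_map_on_inv_chart_compose[OF A B f(1) ic(4)]
  let ?S = "W \<inter> u -` (fst c \<inter> V)"
  have S: "open ?S"
    by (rule smooth_map_on_vimage_open[OF u(1) open_Int[OF is_chart_open[OF admissible_is_chart[OF ic(4)]] V]])
  have "tmap A B f (u x) (pushvec A u x d) =
      pushvec B (\<lambda>y. f (inv_chart c y)) (snd c (u x)) (pd d (\<lambda>s. snd c (u s)) x)"
    by (simp add: tmap_def c_def[symmetric] comp_def pushvec_apply c)
  also have "\<dots> = pushvec B (\<lambda>s. f (inv_chart c (snd c (u s)))) x d"
    by (rule pushvec_reparam[OF B fi, symmetric]) (use ic f(2) coords_differentiable[OF A u c] in auto)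
  also have "\<dots> = pushvec B (\<lambda>s. f (u s)) x d"
    by (rule pushvec_cong_open[OF S]) (use u f ic is_chart_inv[OF admissible_is_chart[OF ic(4)]] in auto)
  finally show ?thesis .
qed

lemma tmap_eq:
  assumes A: "smooth_atlas BA A" and B: "smooth_atlas BB B" and f: "smooth_map_on A B V f" "p \<in> V"
    and v: "v \<in> tangent_space A p" and c: "c \<in> charts_at A p"
  shows "tmap A B f p v = pushvec B (\<lambda>y. f (inv_chart c y)) (snd c p) (v c)"
  using tmap_pushvec[OF A B inv_chart_at(5,1)[OF c], of V f] f(1,2) tangent_space_eq_pushvec[OF v c] inv_chart_at(2)[OF c]
  by metis

lemma tmap_in_tangent_space:
  assumes A: "smooth_atlas BA A" and B: "smooth_atlas BB B" and f: "smooth_map_on A B V f" "p \<in> V"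
    and v: "v \<in> tangent_space A p"
  shows "tmap A B f p v \<in> tangent_space B (f p)"
proof -
  obtain c where c: "c \<in> charts_at A p" using charts_at_ex[OF A] by blast
  note ic = inv_chart_at[OF c]
  show ?thesis
    using pushvec_in_tangent_space[OF B smooth_map_on_inv_chart_compose[OF A B f(1) ic(4)], of "snd c p" "v c"]
      tmap_eq[OF A B f v c] ic f(2) by auto
qed

lemma tmap_compose:
  assumes A: "smooth_atlas BA A" and B: "smooth_atlas BB B" and C: "smooth_atlas BC C"
    and f: "smooth_map_on A B V f" "p \<in> V" and h: "smooth_map_on B C V' h" "f p \<in> V'"
    and v: "v \<in> tangent_space A p"
  shows "tmap B C h (f p) (tmap A B f p v) = tmap A C (\<lambda>p. h (f p)) p v"
proof -
  obtain c where c: "c \<in> charts_at A p" using charts_at_ex[OF A] by blast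
  note ic = inv_chart_at[OF c]
  have V: "open (V \<inter> f -` V')" by (rule smooth_map_on_vimage_open[OF f(1) smooth_map_on_open[OF h(1)]])
  have hf: "smooth_map_on A C (V \<inter> f -` V') (\<lambda>p. h (f p))"
    by (rule smooth_map_on_compose[OF smooth_atlas_is_chart[OF A] B smooth_atlas_is_chart[OF C] smooth_map_on_subset[OF f(1) V] h(1)])
      auto
  show ?thesis
    using tmap_pushvec[OF B C smooth_map_on_inv_chart_compose[OF A B f(1) ic(4)], of "snd c p" V' h "v c"]
      tmap_eq[OF A B f v c] tmap_eq[OF A C hf _ v c] ic f(2) h by auto
qed

lemma tmap_id:
  assumes A: "smooth_atlas BA A" and v: "v \<in> tangent_space A p"
  shows "tmap A A (\<lambda>q. q) p v = v"
proof -
  obtain c where c: "c \<in> charts_at A p" using charts_at_ex[OF A] by blast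
  show ?thesis
    using tmap_eq[OF A A smooth_map_on_id[OF A open_UNIV] UNIV_I v c] tangent_space_eq_pushvec[OF v c] by simp
qed

lemma tmap_lincomb:
  assumes A: "smooth_atlas BA A" and B: "smooth_atlas BB B" and f: "smooth_map_on A B V f" "p \<in> V"
  shows "tmap A B f p (lincomb I r v) = lincomb I r (\<lambda>i. tmap A B f p (v i))"
proof -
  \<comment> \<open>This must be the very chart that \<open>tmap\<close> selects: the
    \<open>v i\<close> are arbitrary families here and need not obey the transformation law.\<close>
  define c where "c = (SOME c. c \<in> charts_at A p)"
  have c: "c \<in> charts_at A p" unfolding c_def by (rule charts_at_some[OF A])
  note ic = inv_chart_at[OF c]
  show ?thesis
    using pushvec_sum[OF B smooth_map_on_inv_chart_compose[OF A B f(1) ic(4)], of "snd c p" r "\<lambda>i. v i c" I] ic f(2)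
    by (simp add: tmap_def c_def[symmetric] comp_def lincomb_def[of I r v])
qed

lemma lincomb_in_tangent_space:
  assumes A: "smooth_atlas BA A" and v: "\<And>i. i \<in> I \<Longrightarrow> v i \<in> tangent_space A p"
  shows "lincomb I r v \<in> tangent_space A p"
proof -
  obtain c where c: "c \<in> charts_at A p" using charts_at_ex[OF A] by blast
  note ic = inv_chart_at[OF c]
  have "lincomb I r v = lincomb I r (\<lambda>i. pushvec A (inv_chart c) (snd c p) (v i c))"
    using tangent_space_eq_pushvec[OF v c] by (simp add: lincomb_def fun_eq_iff cong: sum.cong)
  also have "\<dots> = pushvec A (inv_chart c) (snd c p) (\<Sum>i\<in>I. r i *\<^sub>R v i c)"
    by (rule pushvec_sum[OF A ic(5,1), symmetric])
  also have "\<dots> \<in> tangent_space A p"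
    using pushvec_in_tangent_space[OF A ic(5,1)] ic(2) by simp
  finally show ?thesis .
qed

text \<open>A sum is a linear combination indexed by the truth values, so linearity is proved once,
  for \<open>lincomb\<close>.\<close>

lemma vadd_eq_lincomb: "vadd v w = lincomb UNIV (\<lambda>_. 1) (\<lambda>b. if b then v else w)"
  by (simp add: vadd_def lincomb_def UNIV_bool fun_eq_iff add.commute)

lemma vadd_in_tangent_space:
  assumes A: "smooth_atlas BA A" and v: "v \<in> tangent_space A p" "w \<in> tangent_space A p"
  shows "vadd v w \<in> tangent_space A p"
  unfolding vadd_eq_lincomb by (rule lincomb_in_tangent_space[OF A]) (simp add: v)

lemma tmap_vadd:
  assumes A: "smooth_atlas BA A" and B: "smooth_atlas BB B" and f: "smooth_map_on A B V f" "p \<in> V"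
  shows "tmap A B f p (vadd v w) = vadd (tmap A B f p v) (tmap A B f p w)"
  unfolding vadd_eq_lincomb tmap_lincomb[OF assms] by (simp add: if_distrib)

lemma vsub_eq_lincomb:
  "vsub v w = lincomb UNIV (\<lambda>b. if b then 1 else - 1) (\<lambda>b. if b then v else w)"
  by (simp add: vsub_def lincomb_def UNIV_bool fun_eq_iff)

lemma vsub_in_tangent_space:
  assumes A: "smooth_atlas BA A" and v: "v \<in> tangent_space A p" "w \<in> tangent_space A p"
  shows "vsub v w \<in> tangent_space A p"
  unfolding vsub_eq_lincomb by (rule lincomb_in_tangent_space[OF A]) (simp add: v)

lemma tmap_vsub:
  assumes A: "smooth_atlas BA A" and B: "smooth_atlas BB B" and f: "smooth_map_on A B V f" "p \<in> V"
  shows "tmap A B f p (vsub v w) = vsub (tmap A B f p v) (tmap A B f p w)"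
  unfolding vsub_eq_lincomb tmap_lincomb[OF assms] by (simp add: if_distrib)

section \<open>Passage from the given atlas to arbitrary admissible charts\<close>

lemma pd_chart_inv:
  assumes "c \<in> charts_at A p"
  shows "pd d (\<lambda>x. snd c (inv_chart c x)) (snd c p) = d"
proof -
  note ic = inv_chart_at[OF assms]
  have "pd d (\<lambda>x. snd c (inv_chart c x)) (snd c p) = pd d (\<lambda>x. x) (snd c p)"
    by (rule pd_cong_open[OF is_chart_open_image[OF admissible_is_chart[OF ic(4)]] ic(1)])
      (rule is_chart_image[OF admissible_is_chart[OF ic(4)]])
  then show ?thesis by (simp add: pd_eqI[OF has_derivative_ident])
qed

lemma pushvec_inv_chart:
  assumes "c \<in> charts_at A p"
  shows "pushvec A (inv_chart c) (snd c p) d c = d"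
  using pushvec_apply[of c A "inv_chart c" "snd c p" d] assms inv_chart_at(2)[OF assms] pd_chart_inv[OF assms] by simp

text \<open>\<open>smooth_vector_field_on\<close> tests the charts of \<open>A\<close>. Near each
  point the components in \<open>c\<close> arise from those in a chart of \<open>A\<close> by the
  Jacobian of the change of charts, which is smooth in the point and in the vector.\<close>

lemma smooth_vector_field_admissible:
  assumes A: "smooth_atlas B A" and Y: "smooth_vector_field_on A W Y" and c: "c \<in> admissible A"
  shows "smooth_on (snd c ` (fst c \<inter> W)) (\<lambda>x. Y (inv_chart c x) c)"
proof (rule smooth_on_local)
  note cc = admissible_is_chart[OF c]
  have W: "open W" and YT: "\<And>p. p \<in> W \<Longrightarrow> Y p \<in> tangent_space A p" using Y by (auto simp: smooth_vector_field_on_def)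
  fix x assume "x \<in> snd c ` (fst c \<inter> W)"
  then obtain p where p: "p \<in> fst c" "p \<in> W" "x = snd c p" by auto
  obtain d where d: "d \<in> A" "p \<in> fst d" using smooth_atlas_chart_ex[OF A] by blast
  have da: "d \<in> admissible A" using d smooth_atlas_subset_admissible[OF A] by auto
  note cd = smooth_atlas_is_chart[OF A d(1)]
  define N where "N = fst d \<inter> W \<inter> fst c"
  have N: "open N" unfolding N_def by (intro open_Int W is_chart_open cd cc)
  define U where "U = snd c ` (fst c \<inter> N)"
  have U: "open U" unfolding U_def by (rule open_chart_image_Int[OF cc N])
  have UN: "inv_chart c y \<in> N" if "y \<in> U" for y using that is_chart_inv[OF cc] unfolding U_def by force
  have comp: "compatible c d" "compatible d c"
    using smooth_atlas_admissible[OF A] c da by (auto simp: smooth_atlas_def)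
  have t: "smooth_on U (\<lambda>x. snd d (inv_chart c x))"
    by (rule smooth_on_subset[where S = "snd c ` (fst c \<inter> fst d)"]) (use comp in \<open>auto simp: compatible_def comp_def U_def N_def\<close>)
  have t': "smooth_on (snd d ` N) (\<lambda>x. snd c (inv_chart d x))"
    by (rule smooth_on_subset[where S = "snd d ` (fst d \<inter> fst c)"]) (use comp in \<open>auto simp: compatible_def comp_def N_def\<close>)
  have Yd: "smooth_on (snd d ` N) (\<lambda>x. Y (inv_chart d x) d)"
    by (rule smooth_on_subset[where S = "snd d ` (fst d \<inter> W)"]) (use Y d in \<open>auto simp: smooth_vector_field_on_def N_def\<close>)
  have im: "(\<lambda>x. snd d (inv_chart c x)) ` U \<subseteq> snd d ` N" using UN by auto
  have "smooth_on U (\<lambda>x. pd (Y (inv_chart d (snd d (inv_chart c x))) d) (\<lambda>x. snd c (inv_chart d x)) (snd d (inv_chart c x)))"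
    by (rule smooth_on_pd_direction[OF smooth_atlas_coord_basis[OF A] U t t' im])
      (rule smooth_on_compose[OF smooth_atlas_coord_basis[OF A] U t Yd im])
  then have "smooth_on U (\<lambda>x. Y (inv_chart c x) c)"
  proof (rule smooth_on_cong_open[OF U, rotated])
    fix y assume y: "y \<in> U"
    let ?q = "inv_chart c y"
    have q: "?q \<in> fst d" "?q \<in> W" "?q \<in> fst c" using UN[OF y] by (auto simp: N_def)
    have "Y ?q c = pd (Y ?q d) (snd c \<circ> inv_chart d) (snd d ?q)"
      by (rule tangent_space_transform[OF YT[OF q(2)]]) (use q c da in \<open>simp_all add: charts_at_def\<close>)
    then show "pd (Y (inv_chart d (snd d ?q)) d) (\<lambda>x. snd c (inv_chart d x)) (snd d ?q) = Y ?q c"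
      by (simp add: is_chart_inv[OF cd q(1)] comp_def)
  qed
  moreover have "x \<in> U" unfolding U_def N_def using p d by auto
  ultimately show "\<exists>U. open U \<and> x \<in> U \<and> smooth_on U (\<lambda>x. Y (inv_chart c x) c)" using U by blast
qed

text \<open>The change of charts on the velocity bundle is (x, u) to (t x, Dt(x) u), with t the
  change of charts on the base, and Dt applied to each of the \<open>k\<close> velocities. It is
  smooth, so smoothness passes from the charts of \<open>A\<close> to \<open>c\<close>.\<close>

lemma smooth_on_local_rep:
  fixes L :: "('p::topological_space,'e::real_inner,'k::finite) kvel \<Rightarrow> real"
  assumes A: "smooth_atlas B A" and L: "smooth_on_T1k A L" and c: "c \<in> admissible A"
  shows "smooth_on (chart_image c \<times> UNIV) (local_rep A c L)"
proof (rule smooth_on_local)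
  note cc = admissible_is_chart[OF c]
  fix z :: "'e \<times> ('e^'k)" assume "z \<in> chart_image c \<times> UNIV"
  then obtain p where p: "p \<in> fst c" "fst z = snd c p" by auto
  obtain d where d: "d \<in> A" "p \<in> fst d" using smooth_atlas_chart_ex[OF A] by blast
  have da: "d \<in> admissible A" using d smooth_atlas_subset_admissible[OF A] by auto
  note cd = smooth_atlas_is_chart[OF A d(1)]
  define U where "U = snd c ` (fst c \<inter> fst d)"
  have U: "open U" unfolding U_def by (rule open_chart_image_Int[OF cc is_chart_open[OF cd]])
  have "compatible c d" using smooth_atlas_admissible[OF A] c da by (auto simp: smooth_atlas_def)
  then have t: "smooth_on U (\<lambda>x. snd d (inv_chart c x))"
    by (simp add: compatible_def comp_def U_def)
  let ?t = "\<lambda>x. snd d (inv_chart c x)"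
  have U2: "open (U \<times> (UNIV :: ('e^'k) set))" by (rule open_Times[OF U open_UNIV])
  have s1: "smooth_on (U \<times> UNIV) (\<lambda>z :: 'e \<times> ('e^'k). fst z)"
    by (rule smooth_on_bounded_linear[OF U2 bounded_linear_fst smooth_on_id])
  have s2: "smooth_on (U \<times> UNIV) (\<lambda>z :: 'e \<times> ('e^'k). snd z $ \<alpha>)" for \<alpha>
    by (rule smooth_on_bounded_linear[OF U2 bounded_linear_compose[OF bounded_linear_vec_nth bounded_linear_snd] smooth_on_id])
  have im: "fst ` (U \<times> (UNIV :: ('e^'k) set)) \<subseteq> U" by auto
  have F: "smooth_on (U \<times> UNIV) (\<lambda>z :: 'e \<times> ('e^'k). (?t (fst z), \<chi> \<alpha>. pd (snd z $ \<alpha>) ?t (fst z)))"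
    by (rule smooth_on_Pair[OF U2 smooth_on_compose[OF smooth_atlas_coord_basis[OF A] U2 s1 t im]
        smooth_on_vec[OF U2 smooth_on_pd_direction[OF smooth_atlas_coord_basis[OF A] U2 s1 t im s2]]])
  have "smooth_on (chart_image d \<times> UNIV) (local_rep A d L)"
    using L d by (simp add: smooth_on_T1k_def)
  from smooth_on_compose[OF coord_basis_prod[OF smooth_atlas_coord_basis[OF A] coord_basis_vec[OF smooth_atlas_coord_basis[OF A]]] U2 F this]
  have "smooth_on (U \<times> UNIV) (\<lambda>z :: 'e \<times> ('e^'k). local_rep A d L (?t (fst z), \<chi> \<alpha>. pd (snd z $ \<alpha>) ?t (fst z)))"
    using is_chart_inv[OF cc] by (force simp: U_def)
  then have "smooth_on (U \<times> UNIV) (local_rep A c L)"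
  proof (rule smooth_on_cong_open[OF U2, rotated])
    fix z :: "'e \<times> ('e^'k)" assume "z \<in> U \<times> UNIV"
    then obtain q where q: "q \<in> fst c" "q \<in> fst d" "fst z = snd c q" by (auto simp: U_def)
    have qc: "c \<in> charts_at A q" "d \<in> charts_at A q" using q c da by (auto simp: charts_at_def)
    note ic = inv_chart_at[OF qc(1)] and id = inv_chart_at[OF qc(2)]
    have "pushvec A (inv_chart c) (snd c q) v = pushvec A (inv_chart d) (snd d q) (pd v ?t (snd c q))" for v
    proof (rule tangent_space_eqI[where p = q and c = d])
      show "pushvec A (inv_chart c) (snd c q) v \<in> tangent_space A q"
        using pushvec_in_tangent_space[OF A ic(5,1)] ic(2) by simp
      show "pushvec A (inv_chart d) (snd d q) w \<in> tangent_space A q" for w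
        using pushvec_in_tangent_space[OF A id(5,1)] id(2) by simp
      show "pushvec A (inv_chart c) (snd c q) v d = pushvec A (inv_chart d) (snd d q) (pd v ?t (snd c q)) d"
        using qc ic(2) by (simp add: pushvec_apply pushvec_inv_chart)
    qed (rule qc)
    then have "T1k_point A d (?t (snd c q), \<chi> \<alpha>. pd (snd z $ \<alpha>) ?t (snd c q)) = T1k_point A c (snd c q, snd z)"
      using ic(2) id(2) by (simp add: T1k_point_def)
    then show "local_rep A d L (?t (fst z), \<chi> \<alpha>. pd (snd z $ \<alpha>) ?t (fst z)) = local_rep A c L z"
      unfolding q(3) local_rep_def comp_def by (metis prod.collapse q(3))
  qed
  moreover have "z \<in> U \<times> UNIV" using p d by (auto simp: U_def mem_Times_iff)
  ultimately show "\<exists>U. open U \<and> z \<in> U \<and> smooth_on U (local_rep A c L)" using U2 by blast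
qed

section \<open>Related vector fields\<close>

text \<open>Differentiating the relations along \<open>Y1\<close> and \<open>Y2\<close> produces the
  second derivative of \<open>\<rho>\<close> in both orders; these terms cancel by symmetry and only
  the first derivative of \<open>\<rho>\<close> on the bracket remains. The map
  \<open>\<rho>\<close> may go between spaces of different dimension.\<close>

lemma bracket_related:
  fixes \<rho> :: "'h::real_inner \<Rightarrow> 'e::real_inner"
  assumes B: "coord_basis (B :: 'h set)" "coord_basis (B' :: 'e set)" and S: "open S" "y \<in> S" and \<rho>: "smooth_on S \<rho>"
    and Y: "Y1 differentiable (at y)" "Y2 differentiable (at y)"
    and Z: "Z1 differentiable (at (\<rho> y))" "Z2 differentiable (at (\<rho> y))"
    and rel: "\<And>x. x \<in> S \<Longrightarrow> Z1 (\<rho> x) = pd (Y1 x) \<rho> x" "\<And>x. x \<in> S \<Longrightarrow> Z2 (\<rho> x) = pd (Y2 x) \<rho> x"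
  shows "pd (Z1 (\<rho> y)) Z2 (\<rho> y) - pd (Z2 (\<rho> y)) Z1 (\<rho> y) = pd (pd (Y1 y) Y2 y - pd (Y2 y) Y1 y) \<rho> y"
proof -
  have d\<rho>: "\<rho> differentiable (at x)" if "x \<in> S" for x using smooth_on_differentiable[OF \<rho> that] .
  have 1: "pd (pd d \<rho> y) Z (\<rho> y) = pd d (pd (Y y) \<rho>) y + pd (pd d Y y) \<rho> y"
    if "Z differentiable (at (\<rho> y))" "Y differentiable (at y)" "\<And>x. x \<in> S \<Longrightarrow> Z (\<rho> x) = pd (Y x) \<rho> x" for Y Z d
  proof -
    have "pd (pd d \<rho> y) Z (\<rho> y) = pd d (\<lambda>x. Z (\<rho> x)) y"
      by (rule pd_compose[OF d\<rho>[OF S(2)] that(1), symmetric])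
    also have "\<dots> = pd d (\<lambda>x. pd (Y x) \<rho> x) y"
      by (rule pd_cong_open[OF S that(3)])
    also have "\<dots> = pd (pd d (\<lambda>x. x) y) (pd (Y y) \<rho>) y + pd (pd d Y y) \<rho> y"
      by (rule pd_direction[OF B(1) S S(1)])
        (auto intro: d\<rho> that(2) smooth_on_differentiable[OF smooth_on_pd[OF \<rho>]] S)
    also have "pd d (\<lambda>x. x) y = d" by (rule pd_eqI[OF has_derivative_ident])
    finally show ?thesis .
  qed
  show ?thesis
    using 1[OF Z(2) Y(2) rel(2), of "Y1 y"] 1[OF Z(1) Y(1) rel(1), of "Y2 y"] rel[OF S(2)]
      pd_symmetric[OF B(2) S \<rho>, of "Y1 y" "Y2 y"] linear_diff[OF pd_linear[OF d\<rho>[OF S(2)]]]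
    by simp
qed

section \<open>The Euler-Lagrange equations in a frame\<close>

lemma has_derivative_chi:
  fixes f :: "'k::finite \<Rightarrow> 'a::real_normed_vector \<Rightarrow> 'b::real_normed_vector"
  assumes "\<And>\<alpha>. (f \<alpha> has_derivative f' \<alpha>) (at x)"
  shows "((\<lambda>x. \<chi> \<alpha>. f \<alpha> x) has_derivative (\<lambda>d. \<chi> \<alpha>. f' \<alpha> d)) (at x)"
  unfolding vec_sum_axis
  by (intro has_derivative_sum bounded_linear.has_derivative[OF bounded_linear_axis] assms)

lemma linear_velocity_expand:
  fixes h :: "'e::real_inner \<times> ('e^'k::finite) \<Rightarrow> real"
  assumes "linear h"
  shows "h (x, u) = h (x, 0) + (\<Sum>\<beta>\<in>UNIV. h (0, axis \<beta> (u $ \<beta>)))"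
proof -
  have "(x, u) = (x, 0) + (\<Sum>\<beta>\<in>UNIV. (0, axis \<beta> (u $ \<beta>)))"
    using vec_sum_axis[of "\<lambda>\<beta>. u $ \<beta>"] by (simp add: prod_eq_iff fst_sum snd_sum)
  then show ?thesis by (simp add: linear_add[OF assms] linear_sum[OF assms])
qed

lemma linear_fst_expand:
  fixes h :: "'e::real_inner \<times> 'v::real_vector \<Rightarrow> real"
  assumes "coord_basis B" "linear h"
  shows "h (x, 0) = (\<Sum>b\<in>B. (x \<bullet> b) * h (b, 0))"
proof -
  have "(x, 0) = (\<Sum>b\<in>B. (x \<bullet> b) *\<^sub>R (b, 0 :: 'v))"
    using coord_basis_expand[OF assms(1), of x] by (simp add: prod_eq_iff fst_sum snd_sum)
  then have "h (x, 0) = h (\<Sum>b\<in>B. (x \<bullet> b) *\<^sub>R (b, 0))" by (rule arg_cong)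
  then show ?thesis by (simp only: linear_sum[OF assms(2)] linear_scale[OF assms(2)] real_scaleR_def)
qed

lemma linear_axis_expand:
  fixes h :: "'v::real_vector \<times> ('e::real_inner^'k::finite) \<Rightarrow> real"
  assumes "coord_basis B" "linear h"
  shows "h (0, axis \<beta> x) = (\<Sum>b\<in>B. (x \<bullet> b) * h (0, axis \<beta> b))"
proof -
  have "axis \<beta> x = (\<Sum>b\<in>B. (x \<bullet> b) *\<^sub>R (axis \<beta> b :: 'e^'k))"
    by (rule linear_coord_expand[OF assms(1) bounded_linear.linear[OF bounded_linear_axis]])
  then have "(0, axis \<beta> x) = (\<Sum>b\<in>B. (x \<bullet> b) *\<^sub>R (0 :: 'v, axis \<beta> b :: 'e^'k))"
    by (simp add: prod_eq_iff fst_sum snd_sum)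
  then have "h (0, axis \<beta> x) = h (\<Sum>b\<in>B. (x \<bullet> b) *\<^sub>R (0, axis \<beta> b))" by (rule arg_cong)
  then show ?thesis by (simp only: linear_sum[OF assms(2)] linear_scale[OF assms(2)] real_scaleR_def)
qed

text \<open>The second derivatives are written out as in the conclusion of the theorem, so that
  vanishing of this difference is literally the claim in a chart.\<close>

definition euler_lagrange :: "'e::real_inner set \<Rightarrow> ('e \<times> ('e^'k::finite) \<Rightarrow> real) \<Rightarrow> (real^'k \<Rightarrow> 'e) \<Rightarrow> real^'k \<Rightarrow> 'e \<Rightarrow> real" where
  "euler_lagrange B L f t a = (let z = (f t, \<chi> \<alpha>. pd (axis \<alpha> 1) f t) in
     (\<Sum>\<alpha>\<in>UNIV. \<Sum>b\<in>B. pd (b, 0) (pd (0, axis \<alpha> a) L) z * (pd (axis \<alpha> 1) f t \<bullet> b))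
     + (\<Sum>\<alpha>\<in>UNIV. \<Sum>\<beta>\<in>UNIV. \<Sum>b\<in>B. pd (0, axis \<beta> b) (pd (0, axis \<alpha> a) L) z
          * (pd (axis \<alpha> 1) (pd (axis \<beta> 1) f) t \<bullet> b))
     - pd (a, 0) L z)"

text \<open>Differentiating the momentum along \<open>Z\<close> yields the second-order terms with
  \<open>Z\<close> frozen and, because \<open>Z\<close> moves along the curve, one term with the
  derivative of \<open>Z\<close> along the velocity. The latter is the fibre part of the complete
  lift, so subtracting the complete lift applied to \<open>L\<close> leaves the Euler-Lagrange
  expression.\<close>

lemma euler_lagrange_contraction:
  fixes L :: "'e::real_inner \<times> ('e^'k::finite) \<Rightarrow> real" and f :: "real^'k \<Rightarrow> 'e"
  assumes B: "coord_basis (B :: 'e set)" and W: "open W" "t \<in> W" and f: "smooth_on W f"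
    and \<Omega>: "open \<Omega>" "f ` W \<subseteq> \<Omega>" and L: "smooth_on (\<Omega> \<times> UNIV) L" and Z: "Z differentiable (at (f t))"
  defines "F \<equiv> \<lambda>s. (f s, \<chi> \<alpha>. pd (axis \<alpha> 1) f s)"
  shows "(\<Sum>a\<in>B. (Z (f t) \<bullet> a) * euler_lagrange B L f t a) =
    (\<Sum>\<alpha>\<in>UNIV. pd (axis \<alpha> 1) (\<lambda>s. pd (0, axis \<alpha> (Z (f s))) L (F s)) t)
    - pd (Z (f t), \<chi> \<alpha>. pd (pd (axis \<alpha> 1) f t) Z (f t)) L (F t)"
proof -
  have \<Omega>2: "open (\<Omega> \<times> (UNIV :: ('e^'k) set))" by (rule open_Times[OF \<Omega>(1) open_UNIV])
  have F\<Omega>: "F ` W \<subseteq> \<Omega> \<times> UNIV" using \<Omega>(2) by (auto simp: F_def)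
  have Ft: "F t \<in> \<Omega> \<times> UNIV" using F\<Omega> W by blast
  have df: "f differentiable (at t)" by (rule smooth_on_differentiable[OF f W(2)])
  have dL: "L differentiable (at y)" if "y \<in> \<Omega> \<times> UNIV" for y by (rule smooth_on_differentiable[OF L that])
  have dpL: "pd e L differentiable (at (F t))" for e by (rule smooth_on_differentiable[OF smooth_on_pd[OF L] Ft])
  have F': "(F has_derivative (\<lambda>d. (pd d f t, \<chi> \<beta>. pd d (pd (axis \<beta> 1) f) t))) (at t)"
    unfolding F_def
    by (intro has_derivative_Pair has_derivative_chi pd_has_derivative df
        smooth_on_differentiable[OF smooth_on_pd[OF f] W(2)])
  define F1 where "F1 \<alpha> = (pd (axis \<alpha> 1) f t, \<chi> \<beta>. pd (axis \<alpha> 1) (pd (axis \<beta> 1) f) t)" for \<alpha> :: 'k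
  \<comment> \<open>\<open>pd_linear\<close> gives linearity in the outer direction only; symmetry
    of second derivatives moves \<open>e\<close> to the outside.\<close>
  have linE: "linear (\<lambda>e. pd (F1 \<alpha>) (pd e L) (F t))" for \<alpha>
    unfolding pd_symmetric_real[OF \<Omega>2 Ft L, of "F1 \<alpha>"] by (rule pd_linear[OF dpL])
  have euler_lagrange: "euler_lagrange B L f t a = (\<Sum>\<alpha>\<in>UNIV. pd (F1 \<alpha>) (pd (0, axis \<alpha> a) L) (F t)) - pd (a, 0) L (F t)" for a
  proof -
    have "pd (F1 \<alpha>) (pd e L) (F t) = (\<Sum>b\<in>B. pd (b, 0) (pd e L) (F t) * (pd (axis \<alpha> 1) f t \<bullet> b))
        + (\<Sum>\<beta>\<in>UNIV. \<Sum>b\<in>B. pd (0, axis \<beta> b) (pd e L) (F t) * (pd (axis \<alpha> 1) (pd (axis \<beta> 1) f) t \<bullet> b))" for \<alpha> e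
    proof -
      have h1: "pd (F1 \<alpha>) (pd e L) (F t) = pd (pd (axis \<alpha> 1) f t, 0) (pd e L) (F t)
          + (\<Sum>\<beta>\<in>UNIV. pd (0, axis \<beta> (pd (axis \<alpha> 1) (pd (axis \<beta> 1) f) t)) (pd e L) (F t))"
        using linear_velocity_expand[OF pd_linear[OF dpL[of e]], of "pd (axis \<alpha> 1) f t"
            "\<chi> \<beta>. pd (axis \<alpha> 1) (pd (axis \<beta> 1) f) t"] by (simp add: F1_def)
      have h2: "pd (0, axis \<beta> x) (pd e L) (F t) = (\<Sum>b\<in>B. pd (0, axis \<beta> b) (pd e L) (F t) * (x \<bullet> b))" for \<beta> x
        using linear_axis_expand[OF B pd_linear[OF dpL[of e]], of \<beta> x] by (simp add: mult.commute)
      have h3: "pd (x, 0) (pd e L) (F t) = (\<Sum>b\<in>B. pd (b, 0) (pd e L) (F t) * (x \<bullet> b))" for x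
        using linear_fst_expand[OF B pd_linear[OF dpL[of e]], of x] by (simp add: mult.commute)
      show ?thesis
        unfolding h1 h3[of "pd (axis \<alpha> 1) f t"] by (intro arg_cong2[where f = "(+)"] refl sum.cong h2)
    qed
    then show ?thesis by (simp add: euler_lagrange_def Let_def F_def sum.distrib)
  qed
  have P: "pd (axis \<alpha> 1) (\<lambda>s. pd (0, axis \<alpha> (Z (f s))) L (F s)) t =
      pd (F1 \<alpha>) (pd (0, axis \<alpha> (Z (f t))) L) (F t) + pd (0, axis \<alpha> (pd (pd (axis \<alpha> 1) f t) Z (f t))) L (F t)" for \<alpha> :: 'k
  proof -
    let ?h = "\<lambda>s. (0 :: 'e, axis \<alpha> (Z (f s)) :: 'e^'k)"
    have h: "(?h has_derivative (\<lambda>d. (0, axis \<alpha> (pd (pd d f t) Z (f t))))) (at t)"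
      by (intro has_derivative_Pair has_derivative_const bounded_linear.has_derivative[OF bounded_linear_axis]
          has_derivative_compose[OF pd_has_derivative[OF df] pd_has_derivative[OF Z]])
    have "pd (axis \<alpha> 1) (\<lambda>s. pd (?h s) L (F s)) t = pd (pd (axis \<alpha> 1) F t) (pd (?h t) L) (F t) + pd (pd (axis \<alpha> 1) ?h t) L (F t)"
      by (rule pd_direction[OF coord_basis_prod[OF B coord_basis_vec[OF B]] W \<Omega>2 F\<Omega> differentiableI[OF F'] dL dpL differentiableI[OF h]])
    then show ?thesis by (simp add: pd_eqI[OF F'] pd_eqI[OF h] F1_def)
  qed
  have "(\<Sum>a\<in>B. (Z (f t) \<bullet> a) * euler_lagrange B L f t a) =
      (\<Sum>\<alpha>\<in>UNIV. \<Sum>a\<in>B. (Z (f t) \<bullet> a) * pd (F1 \<alpha>) (pd (0, axis \<alpha> a) L) (F t)) - (\<Sum>a\<in>B. (Z (f t) \<bullet> a) * pd (a, 0) L (F t))"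
    unfolding euler_lagrange right_diff_distrib sum_subtractf sum_distrib_left by (subst sum.swap) (rule refl)
  also have "\<dots> = (\<Sum>\<alpha>\<in>UNIV. pd (F1 \<alpha>) (pd (0, axis \<alpha> (Z (f t))) L) (F t)) - pd (Z (f t), 0) L (F t)"
    unfolding linear_axis_expand[OF B linE, of _ _ "Z (f t)"] linear_fst_expand[OF B pd_linear[OF dL[OF Ft]], of "Z (f t)"] ..
  finally show ?thesis
    unfolding P sum.distrib linear_velocity_expand[OF pd_linear[OF dL[OF Ft]], of "Z (f t)" "\<chi> \<alpha>. pd (pd (axis \<alpha> 1) f t) Z (f t)"]
    by simp
qed

text \<open>The picture in one chart of \<open>Q\<close>: \<open>\<xi>\<close> reads off the base
  coordinates, \<open>X i\<close> projects to the coordinate direction \<open>i\<close>, and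
  \<open>E a\<close> is vertical. Of \<open>lhat\<close> only first derivatives are formed at single
  points; derivatives of the momenta along the curve are computed through \<open>L\<close>.\<close>

locale lagrangian_frame =
  fixes BQ :: "'e::real_inner set" and BX :: "'b::real_inner set" and BG :: "'h::real_inner set"
    and L :: "'e \<times> ('e^'k::finite) \<Rightarrow> real" and lhat :: "'b \<times> ('b^'k) \<times> ('h^'k) \<Rightarrow> real"
    and \<Omega> :: "'e set" and X :: "'b \<Rightarrow> 'e \<Rightarrow> 'e" and E :: "'h \<Rightarrow> 'e \<Rightarrow> 'e" and \<xi> :: "'e \<Rightarrow> 'b"
  assumes BQ: "coord_basis BQ" and BX: "coord_basis BX" and BG: "coord_basis BG"
    and \<Omega>: "open \<Omega>" and L: "smooth_on (\<Omega> \<times> UNIV) L"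
    and X: "\<And>i z. i \<in> BX \<Longrightarrow> z \<in> \<Omega> \<Longrightarrow> X i differentiable (at z)"
    and E: "\<And>a z. a \<in> BG \<Longrightarrow> z \<in> \<Omega> \<Longrightarrow> E a differentiable (at z)"
    and \<xi>: "\<And>z. z \<in> \<Omega> \<Longrightarrow> \<xi> differentiable (at z)"
    and \<xi>_X: "\<And>i z. i \<in> BX \<Longrightarrow> z \<in> \<Omega> \<Longrightarrow> pd (X i z) \<xi> z = i"
    and \<xi>_E: "\<And>a z. a \<in> BG \<Longrightarrow> z \<in> \<Omega> \<Longrightarrow> pd (E a z) \<xi> z = 0"
    and lhat: "\<And>z v w. z \<in> \<Omega> \<Longrightarrow> lhat differentiable (at (\<xi> z, v, w))"
    and lhat_eq: "\<And>z v w. z \<in> \<Omega> \<Longrightarrow>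
      lhat (\<xi> z, v, w) = L (z, \<chi> \<alpha>. (\<Sum>i\<in>BX. ((v $ \<alpha>) \<bullet> i) *\<^sub>R X i z) + (\<Sum>a\<in>BG. ((w $ \<alpha>) \<bullet> a) *\<^sub>R E a z))"
begin

definition vel :: "'e \<Rightarrow> 'b^'k \<Rightarrow> 'h^'k \<Rightarrow> 'e^'k" where
  "vel z v w = (\<chi> \<alpha>. (\<Sum>i\<in>BX. ((v $ \<alpha>) \<bullet> i) *\<^sub>R X i z) + (\<Sum>a\<in>BG. ((w $ \<alpha>) \<bullet> a) *\<^sub>R E a z))"

lemma lhat_vel: "z \<in> \<Omega> \<Longrightarrow> lhat (\<xi> z, v, w) = L (z, vel z v w)"
  by (simp add: lhat_eq vel_def)

lemma dL: "z \<in> \<Omega> \<Longrightarrow> L differentiable (at (z, u))"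
  by (rule smooth_on_differentiable[OF L]) simp

lemma axis_coeff_sum:
  assumes "coord_basis (C :: 'c::real_inner set)" "i \<in> C"
  shows "(\<Sum>j\<in>C. ((axis \<alpha> i :: 'c^'k) $ \<beta> \<bullet> j) *\<^sub>R Y j) = (axis \<alpha> (Y i) :: 'e^'k) $ \<beta>"
proof (cases "\<alpha> = \<beta>")
  case True
  have "(\<Sum>j\<in>C. (i \<bullet> j) *\<^sub>R Y j) = (\<Sum>j\<in>C. if j = i then Y j else 0)"
    by (rule sum.cong) (auto simp: coord_basis_inner[OF assms(1,2)])
  then show ?thesis using True assms coord_basis_finite[OF assms(1)] by (simp add: axis_def)
qed (simp add: axis_def)

text \<open>Moving \<open>v\<close> alone moves the velocity by multiples of the fields
  \<open>X i\<close>, so this momentum is the vertical lift of \<open>X i\<close> applied to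
  \<open>L\<close>.\<close>

lemma pd_lhat_v:
  assumes "z \<in> \<Omega>" "i \<in> BX"
  shows "pd (0, axis \<alpha> i, 0) lhat (\<xi> z, v, w) = pd (0, axis \<alpha> (X i z)) L (z, vel z v w)"
proof -
  have 1: "((\<lambda>v. (\<xi> z, v, w)) has_derivative (\<lambda>d. (0, d, 0))) (at v)"
    by (auto intro!: derivative_eq_intros)
  have 2: "((\<lambda>v. (z, vel z v w)) has_derivative (\<lambda>d. (0, \<chi> \<beta>. \<Sum>i\<in>BX. ((d $ \<beta>) \<bullet> i) *\<^sub>R X i z))) (at v)"
    unfolding vel_def
    by (intro has_derivative_Pair has_derivative_const has_derivative_chi has_derivative_add[where g' = "\<lambda>_. 0", simplified]
        has_derivative_sum has_derivative_scaleR_left has_derivative_inner_left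
        bounded_linear.has_derivative[OF bounded_linear_vec_nth] has_derivative_ident)
  have "pd (axis \<alpha> i) (\<lambda>v. lhat (\<xi> z, v, w)) v = pd (0, axis \<alpha> i, 0) lhat (\<xi> z, v, w)"
    by (rule pd_eqI[OF has_derivative_compose[OF 1 pd_has_derivative[OF lhat[OF assms(1)]]]])
  moreover have "pd (axis \<alpha> i) (\<lambda>v. L (z, vel z v w)) v = pd (0, \<chi> \<beta>. \<Sum>j\<in>BX. ((axis \<alpha> i :: 'b^'k) $ \<beta> \<bullet> j) *\<^sub>R X j z) L (z, vel z v w)"
    by (rule pd_eqI[OF has_derivative_compose[OF 2 pd_has_derivative[OF dL[OF assms(1)]]]])
  ultimately show ?thesis
    by (simp only: lhat_vel[OF assms(1)] axis_coeff_sum[OF BX assms(2)] vec_lambda_eta)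
qed

lemma pd_lhat_w:
  assumes "z \<in> \<Omega>" "a \<in> BG"
  shows "pd (0, 0, axis \<alpha> a) lhat (\<xi> z, v, w) = pd (0, axis \<alpha> (E a z)) L (z, vel z v w)"
proof -
  have 1: "((\<lambda>w. (\<xi> z, v, w)) has_derivative (\<lambda>d. (0, 0, d))) (at w)"
    by (auto intro!: derivative_eq_intros)
  have 2: "((\<lambda>w. (z, vel z v w)) has_derivative (\<lambda>d. (0, \<chi> \<beta>. \<Sum>a\<in>BG. ((d $ \<beta>) \<bullet> a) *\<^sub>R E a z))) (at w)"
    unfolding vel_def
    by (intro has_derivative_Pair has_derivative_const has_derivative_chi has_derivative_add[where f' = "\<lambda>_. 0", simplified]
        has_derivative_sum has_derivative_scaleR_left has_derivative_inner_left
        bounded_linear.has_derivative[OF bounded_linear_vec_nth] has_derivative_ident)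
  have "pd (axis \<alpha> a) (\<lambda>w. lhat (\<xi> z, v, w)) w = pd (0, 0, axis \<alpha> a) lhat (\<xi> z, v, w)"
    by (rule pd_eqI[OF has_derivative_compose[OF 1 pd_has_derivative[OF lhat[OF assms(1)]]]])
  moreover have "pd (axis \<alpha> a) (\<lambda>w. L (z, vel z v w)) w = pd (0, \<chi> \<beta>. \<Sum>j\<in>BG. ((axis \<alpha> a :: 'h^'k) $ \<beta> \<bullet> j) *\<^sub>R E j z) L (z, vel z v w)"
    by (rule pd_eqI[OF has_derivative_compose[OF 2 pd_has_derivative[OF dL[OF assms(1)]]]])
  ultimately show ?thesis
    by (simp only: lhat_vel[OF assms(1)] axis_coeff_sum[OF BG assms(2)] vec_lambda_eta)
qed

text \<open>Moving the base point with the frame components held fixed moves the velocity by the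
  derivatives of the frame fields. For \<open>d = Z z\<close> this is the complete lift of
  \<open>Z\<close> up to brackets with the frame.\<close>

lemma pd_lhat_x:
  assumes "z \<in> \<Omega>"
  shows "pd (pd d \<xi> z, 0, 0) lhat (\<xi> z, v, w) =
    pd (d, \<chi> \<alpha>. (\<Sum>i\<in>BX. ((v $ \<alpha>) \<bullet> i) *\<^sub>R pd d (X i) z) + (\<Sum>a\<in>BG. ((w $ \<alpha>) \<bullet> a) *\<^sub>R pd d (E a) z)) L (z, vel z v w)"
proof -
  have 1: "((\<lambda>z. (\<xi> z, v, w)) has_derivative (\<lambda>d. (pd d \<xi> z, 0, 0))) (at z)"
    using has_derivative_Pair[OF pd_has_derivative[OF \<xi>[OF assms]] has_derivative_const[of "(v, w)"]]
    by (simp add: zero_prod_def)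
  have 2: "((\<lambda>z. (z, vel z v w)) has_derivative (\<lambda>d. (d, \<chi> \<alpha>. (\<Sum>i\<in>BX. ((v $ \<alpha>) \<bullet> i) *\<^sub>R pd d (X i) z) + (\<Sum>a\<in>BG. ((w $ \<alpha>) \<bullet> a) *\<^sub>R pd d (E a) z)))) (at z)"
    unfolding vel_def
    by (intro has_derivative_Pair has_derivative_ident has_derivative_chi has_derivative_add
        has_derivative_sum has_derivative_scaleR_right pd_has_derivative X E assms)
  have "pd d (\<lambda>z. lhat (\<xi> z, v, w)) z = pd d (\<lambda>z. L (z, vel z v w)) z"
    by (rule pd_cong_open[OF \<Omega> assms lhat_vel])
  then show ?thesis
    unfolding pd_eqI[OF has_derivative_compose[OF 1 pd_has_derivative[OF lhat[OF assms]]]]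
      pd_eqI[OF has_derivative_compose[OF 2 pd_has_derivative[OF dL[OF assms]]]] .
qed

text \<open>The complete lift of \<open>Z\<close> and the variation at fixed frame components in
  \<open>pd_lhat_x\<close> differ by the brackets of the frame fields with \<open>Z\<close>. By
  \<open>k\<close> and \<open>m\<close> these are vertical, so they meet \<open>L\<close> only
  through the derivatives of \<open>lhat\<close> in \<open>w\<close>.\<close>

lemma euler_lagrange_frame:
  fixes f :: "real^'k \<Rightarrow> 'e"
  assumes W: "open W" "t \<in> W" and f: "smooth_on W f" "f ` W \<subseteq> \<Omega>"
    and vel: "\<And>s. s \<in> W \<Longrightarrow> (\<chi> \<alpha>. pd (axis \<alpha> 1) f s) = vel (f s) (v s) (w s)"
    and Z: "Z differentiable (at (f t))"
    and k: "\<And>i. i \<in> BX \<Longrightarrow> pd (X i (f t)) Z (f t) - pd (Z (f t)) (X i) (f t) = (\<Sum>b\<in>BG. k i b *\<^sub>R E b (f t))"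
    and m: "\<And>a. a \<in> BG \<Longrightarrow> pd (E a (f t)) Z (f t) - pd (Z (f t)) (E a) (f t) = (\<Sum>b\<in>BG. m a b *\<^sub>R E b (f t))"
  shows "(\<Sum>a\<in>BQ. (Z (f t) \<bullet> a) * euler_lagrange BQ L f t a) =
    (\<Sum>\<alpha>\<in>UNIV. pd (axis \<alpha> 1) (\<lambda>s. pd (0, axis \<alpha> (Z (f s))) L (f s, vel (f s) (v s) (w s))) t)
    - pd (pd (Z (f t)) \<xi> (f t), 0, 0) lhat (\<xi> (f t), v t, w t)
    - (\<Sum>\<alpha>\<in>UNIV. \<Sum>b\<in>BG. ((\<Sum>i\<in>BX. (v t $ \<alpha> \<bullet> i) * k i b) + (\<Sum>a\<in>BG. (w t $ \<alpha> \<bullet> a) * m a b))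
        * pd (0, 0, axis \<alpha> b) lhat (\<xi> (f t), v t, w t))"
proof -
  let ?n = "\<lambda>\<alpha> b. (\<Sum>i\<in>BX. (v t $ \<alpha> \<bullet> i) * k i b) + (\<Sum>a\<in>BG. (w t $ \<alpha> \<bullet> a) * m a b)"
  define z where "z = f t"
  have z: "z \<in> \<Omega>" using f W z_def by blast
  define D where "D d = pd d L (z, vel z (v t) (w t))" for d
  have linD: "linear D" unfolding D_def by (rule pd_linear[OF dL[OF z]])
  \<comment> \<open>The bracket terms: the excess of the derivative of \<open>Z\<close> along the
    velocity over the derivative along \<open>Z\<close> of the frame with components frozen at
    \<open>v t\<close>, \<open>w t\<close>.\<close>
  define N where "N \<alpha> = (\<Sum>b\<in>BG. ?n \<alpha> b *\<^sub>R E b z)" for \<alpha>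
  have dZ: "pd (pd (axis \<alpha> 1) f t) Z z =
      ((\<Sum>i\<in>BX. (v t $ \<alpha> \<bullet> i) *\<^sub>R pd (Z z) (X i) z) + (\<Sum>a\<in>BG. (w t $ \<alpha> \<bullet> a) *\<^sub>R pd (Z z) (E a) z)) + N \<alpha>" for \<alpha>
  proof -
    have lin: "linear (\<lambda>d. pd d Z z)" unfolding z_def by (rule pd_linear[OF Z])
    have "pd (axis \<alpha> 1) f t = (\<Sum>i\<in>BX. (v t $ \<alpha> \<bullet> i) *\<^sub>R X i z) + (\<Sum>a\<in>BG. (w t $ \<alpha> \<bullet> a) *\<^sub>R E a z)"
      using vel[OF W(2)] by (simp add: vel_def vec_eq_iff z_def)
    then have "pd (pd (axis \<alpha> 1) f t) Z z = (\<Sum>i\<in>BX. (v t $ \<alpha> \<bullet> i) *\<^sub>R pd (X i z) Z z) + (\<Sum>a\<in>BG. (w t $ \<alpha> \<bullet> a) *\<^sub>R pd (E a z) Z z)"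
      by (simp add: linear_add[OF lin] linear_sum[OF lin] linear_scale[OF lin])
    also have "(\<Sum>i\<in>BX. (v t $ \<alpha> \<bullet> i) *\<^sub>R pd (X i z) Z z) =
        (\<Sum>i\<in>BX. (v t $ \<alpha> \<bullet> i) *\<^sub>R pd (Z z) (X i) z) + (\<Sum>i\<in>BX. \<Sum>b\<in>BG. ((v t $ \<alpha> \<bullet> i) * k i b) *\<^sub>R E b z)"
      unfolding sum.distrib[symmetric]
      by (rule sum.cong[OF refl]) (use k[folded z_def] in \<open>simp add: scaleR_sum_right[symmetric] scaleR_scaleR[symmetric]
          scaleR_add_right[symmetric] del: scaleR_scaleR, simp add: algebra_simps\<close>)
    also have "(\<Sum>a\<in>BG. (w t $ \<alpha> \<bullet> a) *\<^sub>R pd (E a z) Z z) =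
        (\<Sum>a\<in>BG. (w t $ \<alpha> \<bullet> a) *\<^sub>R pd (Z z) (E a) z) + (\<Sum>a\<in>BG. \<Sum>b\<in>BG. ((w t $ \<alpha> \<bullet> a) * m a b) *\<^sub>R E b z)"
      unfolding sum.distrib[symmetric]
      by (rule sum.cong[OF refl]) (use m[folded z_def] in \<open>simp add: scaleR_sum_right[symmetric] scaleR_scaleR[symmetric]
          scaleR_add_right[symmetric] del: scaleR_scaleR, simp add: algebra_simps\<close>)
    also have "(\<Sum>i\<in>BX. \<Sum>b\<in>BG. ((v t $ \<alpha> \<bullet> i) * k i b) *\<^sub>R E b z) = (\<Sum>b\<in>BG. (\<Sum>i\<in>BX. (v t $ \<alpha> \<bullet> i) * k i b) *\<^sub>R E b z)"
      unfolding scaleR_sum_left by (rule sum.swap)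
    also have "(\<Sum>a\<in>BG. \<Sum>b\<in>BG. ((w t $ \<alpha> \<bullet> a) * m a b) *\<^sub>R E b z) = (\<Sum>b\<in>BG. (\<Sum>a\<in>BG. (w t $ \<alpha> \<bullet> a) * m a b) *\<^sub>R E b z)"
      unfolding scaleR_sum_left by (rule sum.swap)
    finally show ?thesis by (simp add: N_def scaleR_add_left sum.distrib)
  qed
  have "(Z z, \<chi> \<alpha>. pd (pd (axis \<alpha> 1) f t) Z z) =
      (Z z, \<chi> \<alpha>. (\<Sum>i\<in>BX. (v t $ \<alpha> \<bullet> i) *\<^sub>R pd (Z z) (X i) z) + (\<Sum>a\<in>BG. (w t $ \<alpha> \<bullet> a) *\<^sub>R pd (Z z) (E a) z))
      + (0, \<chi> \<alpha>. N \<alpha>)"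
    by (simp add: dZ vec_eq_iff)
  then have "D (Z z, \<chi> \<alpha>. pd (pd (axis \<alpha> 1) f t) Z z) = pd (pd (Z z) \<xi> z, 0, 0) lhat (\<xi> z, v t, w t) + D (0, \<chi> \<alpha>. N \<alpha>)"
    by (simp only: linear_add[OF linD] pd_lhat_x[OF z, of "Z z" "v t" "w t", folded D_def])
  also have "D (0, \<chi> \<alpha>. N \<alpha>) = (\<Sum>\<alpha>\<in>UNIV. D (0, axis \<alpha> (N \<alpha>)))"
    using linear_velocity_expand[OF linD, of 0 "\<chi> \<alpha>. N \<alpha>"] linear_0[OF linD] by (simp add: zero_prod_def)
  finally have main: "D (Z z, \<chi> \<alpha>. pd (pd (axis \<alpha> 1) f t) Z z) = pd (pd (Z z) \<xi> z, 0, 0) lhat (\<xi> z, v t, w t)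
      + (\<Sum>\<alpha>\<in>UNIV. D (0, axis \<alpha> (N \<alpha>)))" .
  have DN: "D (0, axis \<alpha> (N \<alpha>)) = (\<Sum>b\<in>BG. ?n \<alpha> b
        * pd (0, 0, axis \<alpha> b) lhat (\<xi> z, v t, w t))" for \<alpha>
  proof -
    have lin: "linear (\<lambda>x. D (0, axis \<alpha> x))"
      using linear_compose[OF bounded_linear.linear[OF bounded_linear_compose[OF bounded_linear_Pair_right bounded_linear_axis]] linD]
      by (simp add: comp_def)
    show ?thesis
      unfolding N_def linear_sum[OF lin] linear_scale[OF lin] real_scaleR_def
      by (rule sum.cong[OF refl]) (simp add: pd_lhat_w[OF z] D_def)
  qed
  have "pd (axis \<alpha> 1) (\<lambda>s. pd (0, axis \<alpha> (Z (f s))) L (f s, \<chi> \<alpha>. pd (axis \<alpha> 1) f s)) t =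
      pd (axis \<alpha> 1) (\<lambda>s. pd (0, axis \<alpha> (Z (f s))) L (f s, vel (f s) (v s) (w s))) t" for \<alpha>
    by (rule pd_cong_open[OF W]) (simp add: vel)
  then show ?thesis
    using euler_lagrange_contraction[OF BQ W f(1) \<Omega> f(2) L Z] main[unfolded DN] vel[OF W(2)] by (simp add: D_def z_def)
qed

lemma Euler_Lagrange_if_Lagrange_Poincare:
  fixes f :: "real^'k \<Rightarrow> 'e"
  assumes W: "open W" "t \<in> W" and f: "smooth_on W f" "f ` W \<subseteq> \<Omega>"
    and vel: "\<And>s. s \<in> W \<Longrightarrow> (\<chi> \<alpha>. pd (axis \<alpha> 1) f s) = vel (f s) (v s) (w s)"
    and \<xi>f: "\<And>s. s \<in> W \<Longrightarrow> \<xi> (f s) = x s"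
    and K: "\<And>i j. i \<in> BX \<Longrightarrow> j \<in> BX \<Longrightarrow>
      pd (X i (f t)) (X j) (f t) - pd (X j (f t)) (X i) (f t) = (\<Sum>b\<in>BG. (- K b i j) *\<^sub>R E b (f t))"
    and \<Upsilon>: "\<And>i a. i \<in> BX \<Longrightarrow> a \<in> BG \<Longrightarrow>
      pd (X i (f t)) (E a) (f t) - pd (E a (f t)) (X i) (f t) = (\<Sum>b\<in>BG. \<Upsilon> b i a *\<^sub>R E b (f t))"
    and C: "\<And>a c. a \<in> BG \<Longrightarrow> c \<in> BG \<Longrightarrow>
      pd (E a (f t)) (E c) (f t) - pd (E c (f t)) (E a) (f t) = (\<Sum>b\<in>BG. C b a c *\<^sub>R E b (f t))"
    and LP2: "\<And>i. i \<in> BX \<Longrightarrow>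
      (\<Sum>\<alpha>\<in>UNIV. pd (axis \<alpha> 1) (\<lambda>s. pd (0, axis \<alpha> i, 0) lhat (x s, v s, w s)) t) - pd (i, 0, 0) lhat (x t, v t, w t) =
      (\<Sum>\<beta>\<in>UNIV. \<Sum>b\<in>BG. ((\<Sum>j\<in>BX. K b i j * ((v t $ \<beta>) \<bullet> j)) - (\<Sum>c\<in>BG. \<Upsilon> b i c * ((w t $ \<beta>) \<bullet> c)))
        * pd (0, 0, axis \<beta> b) lhat (x t, v t, w t))"
    and LP3: "\<And>a. a \<in> BG \<Longrightarrow>
      (\<Sum>\<alpha>\<in>UNIV. pd (axis \<alpha> 1) (\<lambda>s. pd (0, 0, axis \<alpha> a) lhat (x s, v s, w s)) t) =
      (\<Sum>\<beta>\<in>UNIV. \<Sum>b\<in>BG. ((\<Sum>j\<in>BX. \<Upsilon> b j a * ((v t $ \<beta>) \<bullet> j)) - (\<Sum>c\<in>BG. C b a c * ((w t $ \<beta>) \<bullet> c)))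
        * pd (0, 0, axis \<beta> b) lhat (x t, v t, w t))"
    and frame: "\<And>d. \<exists>r s. d = (\<Sum>i\<in>BX. r i *\<^sub>R X i (f t)) + (\<Sum>a\<in>BG. s a *\<^sub>R E a (f t))"
    and a: "a \<in> BQ"
  shows "euler_lagrange BQ L f t a = 0"
proof -
  have ft: "f t \<in> \<Omega>" using f W by blast
  define lam where "lam d = (\<Sum>a\<in>BQ. (d \<bullet> a) * euler_lagrange BQ L f t a)" for d
  have X0: "lam (X j (f t)) = 0" if j: "j \<in> BX" for j
  proof -
    \<comment> \<open>The bracket is rewritten as minus the one with \<open>j\<close> first, so that
      the curvature gets the index order of \<open>LP2\<close> and the minus sign in
      \<open>K\<close> disappears.\<close>
    have k: "pd (X i (f t)) (X j) (f t) - pd (X j (f t)) (X i) (f t) = (\<Sum>b\<in>BG. K b j i *\<^sub>R E b (f t))" if "i \<in> BX" for i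
      using arg_cong[OF K[OF j that], of uminus] by (simp add: sum_negf)
    have m: "pd (E c (f t)) (X j) (f t) - pd (X j (f t)) (E c) (f t) = (\<Sum>b\<in>BG. (- \<Upsilon> b j c) *\<^sub>R E b (f t))" if "c \<in> BG" for c
      using arg_cong[OF \<Upsilon>[OF j that], of uminus] by (simp add: sum_negf)
    have D: "pd (axis \<alpha> 1) (\<lambda>s. pd (0, axis \<alpha> (X j (f s))) L (f s, vel (f s) (v s) (w s))) t =
        pd (axis \<alpha> 1) (\<lambda>s. pd (0, axis \<alpha> j, 0) lhat (x s, v s, w s)) t" for \<alpha>
    proof (rule pd_cong_open[OF W])
      fix s assume s: "s \<in> W"
      have "f s \<in> \<Omega>" using s f by blast
      from pd_lhat_v[OF this j] \<xi>f[OF s]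
      show "pd (0, axis \<alpha> (X j (f s))) L (f s, vel (f s) (v s) (w s)) = pd (0, axis \<alpha> j, 0) lhat (x s, v s, w s)" by simp
    qed
    have "lam (X j (f t)) = (\<Sum>\<alpha>\<in>UNIV. pd (axis \<alpha> 1) (\<lambda>s. pd (0, axis \<alpha> j, 0) lhat (x s, v s, w s)) t)
      - pd (j, 0, 0) lhat (x t, v t, w t)
      - (\<Sum>\<alpha>\<in>UNIV. \<Sum>b\<in>BG. ((\<Sum>i\<in>BX. (v t $ \<alpha> \<bullet> i) * K b j i) + (\<Sum>a\<in>BG. (w t $ \<alpha> \<bullet> a) * (- \<Upsilon> b j a)))
        * pd (0, 0, axis \<alpha> b) lhat (x t, v t, w t))"
      using euler_lagrange_frame[OF W f vel X[OF j ft] k m] by (simp only: lam_def D \<xi>_X[OF j ft] \<xi>f[OF W(2)])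
    then show ?thesis unfolding LP2[OF j] by (simp add: mult.commute sum_negf)
  qed
  have E0: "lam (E c (f t)) = 0" if c: "c \<in> BG" for c
  proof -
    have k: "pd (X i (f t)) (E c) (f t) - pd (E c (f t)) (X i) (f t) = (\<Sum>b\<in>BG. \<Upsilon> b i c *\<^sub>R E b (f t))" if "i \<in> BX" for i
      by (rule \<Upsilon>[OF that c])
    \<comment> \<open>Again the order is reversed, to meet the index order and the sign of the
      structure constants in \<open>LP3\<close>.\<close>
    have m: "pd (E a (f t)) (E c) (f t) - pd (E c (f t)) (E a) (f t) = (\<Sum>b\<in>BG. (- C b c a) *\<^sub>R E b (f t))" if "a \<in> BG" for a
      using arg_cong[OF C[OF c that], of uminus] by (simp add: sum_negf)
    have D: "pd (axis \<alpha> 1) (\<lambda>s. pd (0, axis \<alpha> (E c (f s))) L (f s, vel (f s) (v s) (w s))) t =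
        pd (axis \<alpha> 1) (\<lambda>s. pd (0, 0, axis \<alpha> c) lhat (x s, v s, w s)) t" for \<alpha>
    proof (rule pd_cong_open[OF W])
      fix s assume s: "s \<in> W"
      have "f s \<in> \<Omega>" using s f by blast
      from pd_lhat_w[OF this c] \<xi>f[OF s]
      show "pd (0, axis \<alpha> (E c (f s))) L (f s, vel (f s) (v s) (w s)) = pd (0, 0, axis \<alpha> c) lhat (x s, v s, w s)" by simp
    qed
    \<comment> \<open>\<open>E c\<close> projects to zero on the base, so the base derivative is
      absent; accordingly \<open>LP3\<close> has no such term on its left-hand side.\<close>
    have "pd (0, 0, 0) lhat (x t, v t, w t) = 0"
      using linear_0[OF pd_linear[OF lhat[OF ft]], of "v t" "w t"] \<xi>f[OF W(2)] by (simp add: zero_prod_def)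
    then have "lam (E c (f t)) = (\<Sum>\<alpha>\<in>UNIV. pd (axis \<alpha> 1) (\<lambda>s. pd (0, 0, axis \<alpha> c) lhat (x s, v s, w s)) t)
      - (\<Sum>\<alpha>\<in>UNIV. \<Sum>b\<in>BG. ((\<Sum>i\<in>BX. (v t $ \<alpha> \<bullet> i) * \<Upsilon> b i c) + (\<Sum>a\<in>BG. (w t $ \<alpha> \<bullet> a) * (- C b c a)))
        * pd (0, 0, axis \<alpha> b) lhat (x t, v t, w t))"
      using euler_lagrange_frame[OF W f vel E[OF c ft] k m] by (simp only: lam_def D \<xi>_E[OF c ft] \<xi>f[OF W(2)] diff_0_right)
    then show ?thesis unfolding LP3[OF c] by (simp add: mult.commute sum_negf)
  qed
  obtain r s where "a = (\<Sum>i\<in>BX. r i *\<^sub>R X i (f t)) + (\<Sum>a\<in>BG. s a *\<^sub>R E a (f t))" using frame by blast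
  moreover have "linear lam"
    by (rule linearI) (simp_all add: lam_def inner_add_left distrib_right sum.distrib sum_distrib_left mult.assoc)
  ultimately have "lam a = 0"
    by (simp add: linear_add linear_sum linear_scale X0 E0)
  \<comment> \<open>By orthonormality, contraction with the basis vector \<open>a\<close> picks out
    the component \<open>a\<close>.\<close>
  moreover have "lam a = (\<Sum>b\<in>BQ. if b = a then euler_lagrange BQ L f t b else 0)"
    unfolding lam_def using coord_basis_inner[OF BQ a] by (intro sum.cong) auto
  ultimately show ?thesis using a coord_basis_finite[OF BQ] by simp
qed

end

section \<open>Trivialized principal bundles\<close>

lemma pushvec_const: "pushvec A (\<lambda>_. p) x d = (\<lambda>c. 0)"
  by (rule ext) (simp add: pushvec_def comp_def pd_const)

lemma smooth_map_on_const:
  assumes "\<And>c. c \<in> A \<Longrightarrow> is_chart c" "open W"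
  shows "smooth_map_on A B W (\<lambda>_. b)"
  by (rule smooth_map_onI) (use assms in \<open>auto simp: smooth_on_const\<close>)

lemma local_rep_eq:
  assumes V: "\<And>\<alpha>. V \<alpha> \<in> tangent_space A p" and c: "c \<in> charts_at A p"
  shows "local_rep A c F (snd c p, \<chi> \<alpha>. V \<alpha> c) = F (p, V)"
  using tangent_space_eq_pushvec[OF V c] by (simp add: local_rep_def T1k_point_def inv_chart_at(2)[OF c])

text \<open>A vector field given by the velocities of a family of curves is, in a chart, a partial
  derivative of a jointly smooth map, taken at a point that may itself depend on \<open>z\<close>.
  This covers left-invariant fields, \<open>Ehat\<close> and \<open>lifted_coord\<close>.\<close>

lemma smooth_partial_derivative:
  fixes F :: "'v::real_inner \<times> 'w::real_inner \<Rightarrow> 'p::topological_space"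
  assumes A: "smooth_atlas B A" and bases: "coord_basis (BV :: 'v set)" "coord_basis (BW :: 'w set)"
    and F: "smooth_map_on std_atlas A W F" and c: "c \<in> admissible A" and S: "open S" "smooth_on S \<sigma>"
    and SW: "\<And>z. z \<in> S \<Longrightarrow> (z, \<sigma> z) \<in> W \<and> F (z, \<sigma> z) \<in> fst c"
  shows "smooth_on S (\<lambda>z. pd \<xi> (\<lambda>y. snd c (F (z, y))) (\<sigma> z))"
proof -
  define O' where "O' = W \<inter> F -` fst c"
  have O': "open O'" and G: "smooth_on O' (\<lambda>p. snd c (F p))"
    unfolding O'_def by (rule smooth_map_on_coords[OF A F c])+
  have "smooth_on S (\<lambda>z. pd (0, \<xi>) (\<lambda>p. snd c (F p)) (z, \<sigma> z))"
    by (rule smooth_on_compose[OF coord_basis_prod[OF bases] S(1) smooth_on_Pair[OF S(1) smooth_on_id S(2)] smooth_on_pd[OF G]])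
      (use SW in \<open>auto simp: O'_def\<close>)
  then show ?thesis
  proof (rule smooth_on_cong_open[OF S(1), rotated])
    fix z assume z: "z \<in> S"
    have dy: "((\<lambda>y. (z, y)) has_derivative (\<lambda>e. (0, e))) (at (\<sigma> z))"
      by (auto intro!: derivative_eq_intros)
    have "(\<lambda>p. snd c (F p)) differentiable (at (z, \<sigma> z))"
      by (rule smooth_on_differentiable[OF G]) (use SW[OF z] in \<open>simp add: O'_def\<close>)
    from pd_compose[OF differentiableI[OF dy] this, of \<xi>] pd_eqI[OF dy, of \<xi>]
    show "pd (0, \<xi>) (\<lambda>p. snd c (F p)) (z, \<sigma> z) = pd \<xi> (\<lambda>y. snd c (F (z, y))) (\<sigma> z)" by simp
  qed
qed

lemma smooth_map_on_fst_std:
  assumes "smooth_map_on std_atlas A W f" "smooth_atlas B A" "coord_basis (BV :: 'v::real_inner set)" "open V"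
  shows "smooth_map_on std_atlas A (W \<times> (V :: 'w::real_inner set)) (\<lambda>z :: 'v \<times> 'w. f (fst z))"
proof (rule smooth_map_on_compose[OF std_atlas_is_chart smooth_atlas_std[OF assms(3)] smooth_atlas_is_chart[OF assms(2)] _ assms(1)])
  show "smooth_map_on std_atlas std_atlas (W \<times> V) (\<lambda>z :: 'v \<times> 'w. fst z)"
    unfolding smooth_map_on_std
    by (rule conjI, rule open_Times[OF smooth_map_on_open[OF assms(1)] assms(4)],
        rule smooth_on_bounded_linear[OF open_Times[OF smooth_map_on_open[OF assms(1)] assms(4)] bounded_linear_fst smooth_on_id])
qed auto

lemma smooth_map_on_snd_std:
  assumes "smooth_map_on std_atlas A W f" "smooth_atlas B A" "coord_basis (BV :: 'v::real_inner set)" "open V"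
  shows "smooth_map_on std_atlas A ((V :: 'w::real_inner set) \<times> W) (\<lambda>z :: 'w \<times> 'v. f (snd z))"
proof (rule smooth_map_on_compose[OF std_atlas_is_chart smooth_atlas_std[OF assms(3)] smooth_atlas_is_chart[OF assms(2)] _ assms(1)])
  show "smooth_map_on std_atlas std_atlas (V \<times> W) (\<lambda>z :: 'w \<times> 'v. snd z)"
    unfolding smooth_map_on_std
    by (rule conjI, rule open_Times[OF assms(4) smooth_map_on_open[OF assms(1)]],
        rule smooth_on_bounded_linear[OF open_Times[OF assms(4) smooth_map_on_open[OF assms(1)]] bounded_linear_snd smooth_on_id])
qed auto

text \<open>The bundle over one trivializing chart domain. The Lagrangian and the solution stay
  outside, so the frame is studied for a single vector of the Lie algebra or a single base direction
  at a time.\<close>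

locale trivialized_bundle =
  fixes BQ :: "'e::real_inner set"
    and AQ :: "('q::{t2_space,second_countable_topology},'e) chart set"
    and BG :: "'h::real_inner set"
    and AG :: "('g::{t2_space,second_countable_topology},'h) chart set"
    and mul :: "'g \<Rightarrow> 'g \<Rightarrow> 'g" and one :: 'g and inverse_of :: "'g \<Rightarrow> 'g"
    and act :: "'g \<Rightarrow> 'q \<Rightarrow> 'q"
    and BX :: "'b::real_inner set"
    and AX :: "('x::{t2_space,second_countable_topology},'b) chart set"
    and \<pi> :: "'q \<Rightarrow> 'x"
    and H :: "'q \<Rightarrow> ('q,'e) tvec set"
    and cX :: "('x,'b) chart"
    and \<psi> :: "'q \<Rightarrow> 'x \<times> 'g"
  assumes Q: "smooth_manifold BQ AQ"
    and G: "lie_group BG AG mul one inverse_of"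
    and action: "smooth_left_action AG mul one AQ act"
    and quotient: "quotient_manifold AQ act BX AX \<pi>"
    and connection: "principal_connection AQ act AX \<pi> H"
    and cX: "cX \<in> admissible AX"
    and \<psi>: "local_trivialization AQ AG mul act AX \<pi> (fst cX) \<psi>"
begin

abbreviation "PU \<equiv> \<pi> -` fst cX"
abbreviation "\<psi>i \<equiv> inv_into (\<pi> -` fst cX) \<psi>"
abbreviation "PU_image (c :: ('q,'e) chart) \<equiv> snd c ` (fst c \<inter> PU)"
abbreviation "TG \<equiv> tangent_space AG one"
abbreviation "left_inv \<equiv> left_inv_field AG mul one"

lemma aQ: "smooth_atlas BQ AQ" and aG: "smooth_atlas BG AG" and aX: "smooth_atlas BX AX"
  using Q G quotient by (auto simp: lie_group_def quotient_manifold_def smooth_manifold_imp_atlas)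

lemmas cQ = smooth_atlas_is_chart[OF aQ]
lemmas cGG = smooth_atlas_is_chart[OF aG]
lemmas cXX = smooth_atlas_is_chart[OF aX]
lemmas bQ = smooth_atlas_coord_basis[OF aQ]
lemmas bG = smooth_atlas_coord_basis[OF aG]
lemmas ccX = admissible_is_chart[OF cX]
lemmas bX = smooth_atlas_coord_basis[OF aX]

sublocale grp: group mul one inverse_of
  using G by (simp add: lie_group_def)

lemma act_one [simp]: "act one q = q" and act_mul: "act (mul g h) q = act g (act h q)"
  using action by (auto simp: smooth_left_action_def)

lemma \<pi>_act [simp]: "\<pi> (act g q) = \<pi> q"
  using quotient unfolding quotient_manifold_def by metis

lemma \<pi>_smooth: "smooth_map_on AQ AX UNIV \<pi>"
  using quotient by (simp add: quotient_manifold_def)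

lemma open_PU: "open PU"
  using smooth_map_on_vimage_open[OF \<pi>_smooth is_chart_open[OF ccX]] by simp

lemma
  shows \<psi>_smooth: "smooth_map_on AQ (prod_atlas AX AG) PU \<psi>"
    and \<psi>i_smooth0: "smooth_map_on (prod_atlas AX AG) AQ (fst cX \<times> UNIV) \<psi>i"
    and \<psi>_bij: "bij_betw \<psi> PU (fst cX \<times> UNIV)"
    and \<psi>_fst: "q \<in> PU \<Longrightarrow> fst (\<psi> q) = \<pi> q"
    and \<psi>_act: "q \<in> PU \<Longrightarrow> \<psi> (act g q) = (\<pi> q, mul g (snd (\<psi> q)))"
  using \<psi> by (auto simp: local_trivialization_def)

lemma \<psi>i_\<psi>: "q \<in> PU \<Longrightarrow> \<psi>i (\<psi> q) = q"
  using \<psi>_bij by (auto simp: bij_betw_def inv_into_f_f)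

lemma \<psi>i_pair: "q \<in> PU \<Longrightarrow> \<psi>i (\<pi> q, snd (\<psi> q)) = q"
  using \<psi>i_\<psi>[of q] \<psi>_fst[of q] by (metis prod.collapse)

lemma \<psi>_\<psi>i: "x \<in> fst cX \<Longrightarrow> \<psi> (\<psi>i (x, h)) = (x, h)"
  using \<psi>_bij by (intro f_inv_into_f) (auto simp: bij_betw_def)

lemma \<psi>i_PU: "x \<in> fst cX \<Longrightarrow> \<psi>i (x, h) \<in> PU"
  using \<psi>_bij by (intro inv_into_into) (auto simp: bij_betw_def)

lemma \<pi>_\<psi>i: "x \<in> fst cX \<Longrightarrow> \<pi> (\<psi>i (x, h)) = x"
  using \<psi>_fst[OF \<psi>i_PU] \<psi>_\<psi>i by fastforce

lemma act_\<psi>i: "x \<in> fst cX \<Longrightarrow> act g (\<psi>i (x, h)) = \<psi>i (x, mul g h)"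
  using \<psi>_act[OF \<psi>i_PU, of x g h] \<psi>_\<psi>i[of x h] \<pi>_\<psi>i[of x h] \<psi>i_\<psi>[of "act g (\<psi>i (x, h))"] by simp

lemma mul_smooth:
  assumes "\<And>c. c \<in> A \<Longrightarrow> is_chart c" "smooth_map_on A AG W f" "smooth_map_on A AG W g"
  shows "smooth_map_on A AG W (\<lambda>p. mul (f p) (g p))"
proof -
  have m: "smooth_map_on (prod_atlas AG AG) AG UNIV (\<lambda>(g, h). mul g h)" using G by (simp add: lie_group_def)
  from smooth_map_on_compose[OF assms(1) smooth_atlas_prod[OF aG aG] cGG smooth_map_on_Pair[OF assms(1) cGG cGG assms(2,3)] m]
  show ?thesis by simp
qed

lemma act_smooth:
  assumes "\<And>c. c \<in> A \<Longrightarrow> is_chart c" "smooth_map_on A AG W f" "smooth_map_on A AQ W g"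
  shows "smooth_map_on A AQ W (\<lambda>p. act (f p) (g p))"
proof -
  have m: "smooth_map_on (prod_atlas AG AQ) AQ UNIV (\<lambda>(g, q). act g q)" using action by (simp add: smooth_left_action_def)
  from smooth_map_on_compose[OF assms(1) smooth_atlas_prod[OF aG aQ] cQ smooth_map_on_Pair[OF assms(1) cGG cQ assms(2,3)] m]
  show ?thesis by simp
qed

lemma \<psi>i_smooth:
  assumes "\<And>c. c \<in> A \<Longrightarrow> is_chart c" "smooth_map_on A AX W f" "smooth_map_on A AG W g" "f ` W \<subseteq> fst cX"
  shows "smooth_map_on A AQ W (\<lambda>p. \<psi>i (f p, g p))"
  by (rule smooth_map_on_compose[OF assms(1) smooth_atlas_prod[OF aX aG] cQ smooth_map_on_Pair[OF assms(1) cXX cGG assms(2,3)] \<psi>i_smooth0])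
    (use assms(4) in auto)

lemma snd_\<psi>_smooth: "smooth_map_on AQ AG PU (\<lambda>q. snd (\<psi> q))"
  by (rule smooth_map_on_compose[OF cQ smooth_atlas_prod[OF aX aG] cGG \<psi>_smooth smooth_map_on_snd[OF aX aG]]) auto

lemma act_fixed_smooth: "smooth_map_on AQ AQ UNIV (act g)"
  by (rule act_smooth[OF cQ smooth_map_on_const[OF cQ open_UNIV] smooth_map_on_id[OF aQ open_UNIV]])

lemma mul_fixed_smooth: "smooth_map_on AG AG UNIV (mul g)"
  by (rule mul_smooth[OF cGG smooth_map_on_const[OF cGG open_UNIV] smooth_map_on_id[OF aG open_UNIV]])

lemma left_inv_field_tangent:
  "\<xi> \<in> TG \<Longrightarrow> left_inv \<xi> h \<in> tangent_space AG h"
  using tmap_in_tangent_space[OF aG aG mul_fixed_smooth, of one \<xi> h] by (simp add: left_inv_field_def)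

text \<open>In the trivialization the group also acts from the right, and the left-invariant fields are the
  fundamental fields of this action.\<close>

definition right_act :: "'q \<Rightarrow> 'g \<Rightarrow> 'q" where
  "right_act q h = \<psi>i (\<pi> q, mul (snd (\<psi> q)) h)"

definition Ehat :: "('g,'h) tvec \<Rightarrow> 'q \<Rightarrow> ('q,'e) tvec" where
  "Ehat \<xi> q = tmap AG AQ (\<lambda>h. \<psi>i (\<pi> q, h)) (snd (\<psi> q)) (left_inv \<xi> (snd (\<psi> q)))"

lemma right_act_smooth:
  assumes "\<And>c. c \<in> A \<Longrightarrow> is_chart c" "smooth_map_on A AQ W f" "smooth_map_on A AG W g" "f ` W \<subseteq> PU"
  shows "smooth_map_on A AQ W (\<lambda>p. right_act (f p) (g p))"
  unfolding right_act_def
proof (rule \<psi>i_smooth[OF assms(1)])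
  show "smooth_map_on A AX W (\<lambda>p. \<pi> (f p))"
    by (rule smooth_map_on_compose[OF assms(1) aQ cXX assms(2) \<pi>_smooth]) auto
  show "smooth_map_on A AG W (\<lambda>p. mul (snd (\<psi> (f p))) (g p))"
    by (rule mul_smooth[OF assms(1) smooth_map_on_compose[OF assms(1) aQ cGG assms(2) snd_\<psi>_smooth assms(4)] assms(3)])
qed (use assms(4) in auto)

lemma right_act_fixed_smooth: "q \<in> PU \<Longrightarrow> smooth_map_on AG AQ UNIV (right_act q)"
  by (rule right_act_smooth[OF cGG smooth_map_on_const[OF cGG open_UNIV] smooth_map_on_id[OF aG open_UNIV]]) auto

lemma right_act_one [simp]: "q \<in> PU \<Longrightarrow> right_act q one = q"
  by (simp add: right_act_def \<psi>i_pair)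

lemma right_act_right_act: "q \<in> PU \<Longrightarrow> right_act (right_act q h) h' = right_act q (mul h h')"
  by (simp add: right_act_def \<psi>_\<psi>i \<pi>_\<psi>i grp.assoc)

lemma \<pi>_right_act [simp]: "q \<in> PU \<Longrightarrow> \<pi> (right_act q h) = \<pi> q"
  by (simp add: right_act_def \<pi>_\<psi>i)

lemma act_right_act: "q \<in> PU \<Longrightarrow> act g (right_act q h) = right_act (act g q) h"
  by (simp add: right_act_def act_\<psi>i \<psi>_act grp.assoc)

text \<open>Left translation by the group component of \<open>q\<close>, followed by the inclusion
  of the fibre, is the orbit map of the right action; so the field comes from one fixed vector at
  the identity.\<close>

lemma Ehat_eq:
  assumes q: "q \<in> PU" and \<xi>: "\<xi> \<in> TG"
  shows "Ehat \<xi> q = tmap AG AQ (right_act q) one \<xi>"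
proof -
  have "smooth_map_on AG AQ UNIV (\<lambda>h. \<psi>i (\<pi> q, h))"
    by (rule \<psi>i_smooth[OF cGG smooth_map_on_const[OF cGG open_UNIV] smooth_map_on_id[OF aG open_UNIV]]) (use q in auto)
  from tmap_compose[OF aG aG aQ mul_fixed_smooth UNIV_I this UNIV_I \<xi>, of "snd (\<psi> q)"]
  show ?thesis by (simp add: Ehat_def left_inv_field_def right_act_def[abs_def])
qed

text \<open>The relation needed for brackets: since the right action is an action, its orbit map
  through \<open>q\<close> carries the left-invariant field to \<open>Ehat\<close> along the whole
  orbit.\<close>

lemma Ehat_right_act:
  assumes q: "q \<in> PU" and \<xi>: "\<xi> \<in> TG"
  shows "Ehat \<xi> (right_act q h) = tmap AG AQ (right_act q) h (left_inv \<xi> h)"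
  using tmap_compose[OF aG aG aQ mul_fixed_smooth UNIV_I right_act_fixed_smooth[OF q] UNIV_I \<xi>, of h]
    Ehat_eq[of "right_act q h" \<xi>] q \<xi> by (simp add: left_inv_field_def right_act_right_act[OF q, abs_def])

lemma Ehat_tangent:
  assumes "q \<in> PU" "\<xi> \<in> TG"
  shows "Ehat \<xi> q \<in> tangent_space AQ q"
  using tmap_in_tangent_space[OF aG aQ right_act_fixed_smooth[OF assms(1)] UNIV_I assms(2)] assms by (simp add: Ehat_eq)

text \<open>Invariance holds because the left and the right action commute, by associativity in the
  group.\<close>

lemma Ehat_act:
  assumes "q \<in> PU" "\<xi> \<in> TG"
  shows "tmap AQ AQ (act g) q (Ehat \<xi> q) = Ehat \<xi> (act g q)"
  using tmap_compose[OF aG aQ aQ right_act_fixed_smooth[OF assms(1)] UNIV_I act_fixed_smooth UNIV_I assms(2), of g]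
    Ehat_eq[of "act g q" \<xi>] assms by (simp add: Ehat_eq act_right_act)

text \<open>\<open>\<pi>\<close> is constant along the right orbits.\<close>

lemma tmap_\<pi>_Ehat:
  assumes "q \<in> PU" "\<xi> \<in> TG"
  shows "tmap AQ AX \<pi> q (Ehat \<xi> q) = (\<lambda>c. 0)"
  using tmap_compose[OF aG aQ aX right_act_fixed_smooth[OF assms(1)] UNIV_I \<pi>_smooth UNIV_I assms(2)] assms
  by (simp add: Ehat_eq) (simp add: tmap_def comp_def pushvec_const)

lemma Ehat_chart:
  assumes q: "q \<in> PU" and \<xi>: "\<xi> \<in> TG" and d: "d \<in> charts_at AG one"
  shows "Ehat \<xi> q = pushvec AQ (\<lambda>y. right_act q (inv_chart d y)) (snd d one) (\<xi> d)"
  unfolding Ehat_eq[OF q \<xi>] by (rule tmap_eq[OF aG aQ right_act_fixed_smooth[OF q] UNIV_I \<xi> d])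

section \<open>Smoothness and brackets of the invariant vertical fields\<close>

lemma chart_PU_open: "c \<in> admissible AQ \<Longrightarrow> open (PU_image c)"
  by (rule open_chart_image_Int[OF admissible_is_chart open_PU])

lemma chart_PU_in:
  assumes "c \<in> admissible AQ" "z \<in> PU_image c"
  shows "inv_chart c z \<in> fst c" "inv_chart c z \<in> PU" "snd c (inv_chart c z) = z" "c \<in> charts_at AQ (inv_chart c z)"
    "z \<in> chart_image c"
proof -
  obtain q where q: "q \<in> fst c" "q \<in> PU" "z = snd c q" using assms(2) by auto
  then have "inv_chart c z = q" using is_chart_inv[OF admissible_is_chart[OF assms(1)]] by simp
  then show "inv_chart c z \<in> fst c" "inv_chart c z \<in> PU" "snd c (inv_chart c z) = z" "c \<in> charts_at AQ (inv_chart c z)"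
    "z \<in> chart_image c"
    using q assms(1) by (auto simp: charts_at_def)
qed

lemma inv_chart_PU_smooth:
  "c \<in> admissible AQ \<Longrightarrow> smooth_map_on std_atlas AQ (PU_image c) (inv_chart c)"
  by (rule smooth_map_on_subset[OF smooth_map_on_inv_chart chart_PU_open]) auto

lemma base_coordinate_smooth:
  assumes c: "c \<in> admissible AQ"
  shows "smooth_on (PU_image c) (\<lambda>z. snd cX (\<pi> (inv_chart c z)))"
proof -
  have "smooth_map_on std_atlas AX (PU_image c) (\<lambda>z. \<pi> (inv_chart c z))"
    by (rule smooth_map_on_compose[OF std_atlas_is_chart aQ cXX inv_chart_PU_smooth[OF c] \<pi>_smooth]) auto
  from smooth_map_on_coords(2)[OF aX this cX] show ?thesis
    by (rule smooth_on_subset) (use chart_PU_in[OF c] in auto)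
qed

lemma Ehat_smooth:
  assumes c: "c \<in> admissible AQ" and \<xi>: "\<xi> \<in> TG"
  shows "smooth_on (PU_image c) (\<lambda>z. Ehat \<xi> (inv_chart c z) c)"
proof -
  let ?S = "PU_image c"
  obtain d where d: "d \<in> charts_at AG one" using charts_at_ex[OF aG] by blast
  note id = inv_chart_at[OF d]
  note zin = chart_PU_in[OF c]
  have F: "smooth_map_on std_atlas AQ (?S \<times> chart_image d) (\<lambda>z. right_act (inv_chart c (fst z)) (inv_chart d (snd z)))"
    by (rule right_act_smooth[OF std_atlas_is_chart smooth_map_on_fst_std[OF inv_chart_PU_smooth[OF c] aQ bQ]
          smooth_map_on_snd_std[OF id(5) aG bG chart_PU_open[OF c]]])
      (use zin is_chart_open_image[OF admissible_is_chart[OF id(4)]] in auto)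
  have "smooth_on ?S (\<lambda>z. pd (\<xi> d) (\<lambda>y. snd c (right_act (inv_chart c (fst (z, y))) (inv_chart d (snd (z, y))))) (snd d one))"
    by (rule smooth_partial_derivative[OF aQ bQ bG F c chart_PU_open[OF c] smooth_on_const])
      (use zin id in auto)
  then show ?thesis
  proof (rule smooth_on_cong_open[OF chart_PU_open[OF c], rotated])
    fix z assume z: "z \<in> ?S"
    show "pd (\<xi> d) (\<lambda>y. snd c (right_act (inv_chart c (fst (z, y))) (inv_chart d (snd (z, y))))) (snd d one) = Ehat \<xi> (inv_chart c z) c"
      unfolding Ehat_chart[OF zin(2)[OF z] \<xi> d]
      using zin[OF z] id(2) by (subst pushvec_apply) auto
  qed
qed

lemma left_inv_field_smooth:
  assumes d: "d \<in> charts_at AG one" and \<xi>: "\<xi> \<in> TG"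
  shows "smooth_on (chart_image d) (\<lambda>y. left_inv \<xi> (inv_chart d y) d)"
proof -
  note id = inv_chart_at[OF d]
  note cd = admissible_is_chart[OF id(4)]
  have S: "open (chart_image d)" by (rule is_chart_open_image[OF cd])
  have F: "smooth_map_on std_atlas AG (chart_image d \<times> chart_image d) (\<lambda>z. mul (inv_chart d (fst z)) (inv_chart d (snd z)))"
    by (rule mul_smooth[OF std_atlas_is_chart smooth_map_on_fst_std[OF id(5) aG bG S] smooth_map_on_snd_std[OF id(5) aG bG S]])
  have "smooth_on (chart_image d) (\<lambda>z. pd (\<xi> d) (\<lambda>y. snd d (mul (inv_chart d (fst (z, y))) (inv_chart d (snd (z, y))))) (snd d one))"
    by (rule smooth_partial_derivative[OF aG bG bG F id(4) S smooth_on_const])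
      (use id is_chart_inv_in[OF cd] in auto)
  then show ?thesis
  proof (rule smooth_on_cong_open[OF S, rotated])
    fix z assume z: "z \<in> chart_image d"
    show "pd (\<xi> d) (\<lambda>y. snd d (mul (inv_chart d (fst (z, y))) (inv_chart d (snd (z, y))))) (snd d one)
        = left_inv \<xi> (inv_chart d z) d"
      unfolding left_inv_field_def tmap_eq[OF aG aG mul_fixed_smooth UNIV_I \<xi> d]
      using is_chart_inv_in[OF cd z] id by (subst pushvec_apply) (auto simp: charts_at_def)
  qed
qed

text \<open>Related fields have related brackets; applied to the orbit map through \<open>q\<close>
  at the identity, this turns the structure constants of the Lie algebra into those of the invariant
  frame. The orbit map reaches only the fibre, so the argument is relatedness rather than a change
  of coordinates.\<close>

lemma Ehat_bracket:
  assumes c: "c \<in> charts_at AQ q" and q: "q \<in> PU" and \<xi>: "\<xi> \<in> TG" "\<eta> \<in> TG"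
    and E: "\<And>i. i \<in> I \<Longrightarrow> E i \<in> TG"
    and br: "lie_algebra_bracket AG mul one \<xi> \<eta> = lincomb I r E"
  shows "pd (Ehat \<xi> q c) (\<lambda>z. Ehat \<eta> (inv_chart c z) c) (snd c q) - pd (Ehat \<eta> q c) (\<lambda>z. Ehat \<xi> (inv_chart c z) c) (snd c q)
    = (\<Sum>i\<in>I. r i *\<^sub>R Ehat (E i) q c)"
proof -
  obtain d where d: "d \<in> charts_at AG one" using charts_at_ex[OF aG] by blast
  note id = inv_chart_at[OF d] and ic = inv_chart_at[OF c]
  note cd = admissible_is_chart[OF id(4)]
  define \<rho> where "\<rho> y = snd c (right_act q (inv_chart d y))" for y
  have Rd: "smooth_map_on std_atlas AQ (chart_image d) (\<lambda>y. right_act q (inv_chart d y))"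
    by (rule smooth_map_on_compose[OF std_atlas_is_chart aG cQ id(5) right_act_fixed_smooth[OF q]]) auto
  define S where "S = chart_image d \<inter> (\<lambda>y. right_act q (inv_chart d y)) -` fst c"
  have S: "open S" and \<rho>: "smooth_on S \<rho>"
    unfolding S_def \<rho>_def by (rule smooth_map_on_coords[OF aQ Rd ic(4)])+
  have y0: "snd d one \<in> S" using id ic q by (simp add: S_def)
  have \<rho>0: "\<rho> (snd d one) = snd c q" using id q by (simp add: \<rho>_def)
  have rel: "Ehat \<zeta> (inv_chart c (\<rho> y)) c = pd (left_inv \<zeta> (inv_chart d y) d) \<rho> y"
    if y: "y \<in> S" and \<zeta>: "\<zeta> \<in> TG" for y \<zeta>
  proof -
    let ?h = "inv_chart d y"
    have yd: "y \<in> chart_image d" and Rc: "right_act q ?h \<in> fst c" using y by (auto simp: S_def)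
    have dh: "d \<in> charts_at AG ?h" "snd d ?h = y"
      using is_chart_inv_in[OF cd yd] is_chart_image[OF cd yd] id by (auto simp: charts_at_def)
    have "Ehat \<zeta> (right_act q ?h) = pushvec AQ (\<lambda>y. right_act q (inv_chart d y)) (snd d ?h) (left_inv \<zeta> ?h d)"
      unfolding Ehat_right_act[OF q \<zeta>]
      by (rule tmap_eq[OF aG aQ right_act_fixed_smooth[OF q] UNIV_I left_inv_field_tangent[OF \<zeta>] dh(1)])
    then have "Ehat \<zeta> (right_act q ?h) c = pd (left_inv \<zeta> ?h d) \<rho> y"
      using Rc ic(4) unfolding dh(2) \<rho>_def by (subst (asm) pushvec_def) (simp add: charts_at_def comp_def)
    then show ?thesis
      using is_chart_inv[OF admissible_is_chart[OF ic(4)] Rc] by (simp add: \<rho>_def)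
  qed
  have qS: "snd c q \<in> PU_image c" using ic q by blast
  have dZ: "(\<lambda>z. Ehat \<zeta> (inv_chart c z) c) differentiable (at (\<rho> (snd d one)))" if "\<zeta> \<in> TG" for \<zeta>
    unfolding \<rho>0 by (rule smooth_on_differentiable[OF Ehat_smooth[OF ic(4) that] qS])
  have dY: "(\<lambda>y. left_inv \<zeta> (inv_chart d y) d) differentiable (at (snd d one))" if "\<zeta> \<in> TG" for \<zeta>
    by (rule smooth_on_differentiable[OF left_inv_field_smooth[OF d that] id(1)])
  let ?Y = "\<lambda>\<zeta> y. left_inv \<zeta> (inv_chart d y) d"
  have Y0: "?Y \<zeta> (snd d one) = \<zeta> d" if "\<zeta> \<in> TG" for \<zeta>
  proof -
    have "mul one = (\<lambda>g. g)" by (simp add: fun_eq_iff)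
    then show ?thesis using tmap_id[OF aG that] id by (simp add: left_inv_field_def)
  qed
  have "pd (?Y \<xi> (snd d one)) (?Y \<eta>) (snd d one) - pd (?Y \<eta> (snd d one)) (?Y \<xi>) (snd d one) = (\<Sum>i\<in>I. r i *\<^sub>R E i d)"
    using fun_cong[OF br, of d] d id by (simp add: lie_algebra_bracket_def lie_bracket_def lincomb_def)
  moreover have "pd (\<Sum>i\<in>I. r i *\<^sub>R E i d) \<rho> (snd d one) = (\<Sum>i\<in>I. r i *\<^sub>R Ehat (E i) q c)"
  proof -
    have lin: "linear (\<lambda>e. pd e \<rho> (snd d one))" by (rule pd_linear[OF smooth_on_differentiable[OF \<rho> y0]])
    have "pd (E i d) \<rho> (snd d one) = Ehat (E i) q c" if "i \<in> I" for i
      using rel[OF y0 E[OF that]] Y0[OF E[OF that]] \<rho>0 ic by simp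
    then show ?thesis by (simp add: linear_sum[OF lin] linear_scale[OF lin])
  qed
  ultimately show ?thesis
    using bracket_related[OF bG bQ S y0 \<rho> dY[OF \<xi>(1)] dY[OF \<xi>(2)] dZ[OF \<xi>(1)] dZ[OF \<xi>(2)] rel[OF _ \<xi>(1)] rel[OF _ \<xi>(2)]]
      \<rho>0 ic by simp
qed

section \<open>Coordinate fields of the trivialization and horizontal lifts\<close>

definition lifted_coord :: "'b \<Rightarrow> 'q \<Rightarrow> ('q,'e) tvec" where
  "lifted_coord i q = pushvec AQ (\<lambda>x. \<psi>i (inv_chart cX x, snd (\<psi> q))) (snd cX (\<pi> q)) i"

definition hor_lift :: "'b \<Rightarrow> 'q \<Rightarrow> ('q,'e) tvec" where
  "hor_lift i q = horizontal_lift AQ AX \<pi> H q (pushvec AX (inv_chart cX) (snd cX (\<pi> q)) i)"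

lemma cX_at: "q \<in> PU \<Longrightarrow> cX \<in> charts_at AX (\<pi> q)"
  using cX by (simp add: charts_at_def)

lemma section_smooth: "smooth_map_on std_atlas AQ (chart_image cX) (\<lambda>x. \<psi>i (inv_chart cX x, h))"
  by (rule \<psi>i_smooth[OF std_atlas_is_chart smooth_map_on_inv_chart[OF cX] smooth_map_on_const[OF std_atlas_is_chart]])
    (use is_chart_open_image[OF ccX] is_chart_inv_in[OF ccX] in auto)

lemma section_at: "q \<in> PU \<Longrightarrow> \<psi>i (inv_chart cX (snd cX (\<pi> q)), snd (\<psi> q)) = q"
  using inv_chart_at(2)[OF cX_at] by (simp add: \<psi>i_pair)

lemma lifted_coord_tangent: "q \<in> PU \<Longrightarrow> lifted_coord i q \<in> tangent_space AQ q"
  using pushvec_in_tangent_space[OF aQ section_smooth inv_chart_at(1)[OF cX_at], of q "snd (\<psi> q)" i]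
  by (simp add: lifted_coord_def section_at)

lemma lifted_coord_act:
  assumes q: "q \<in> PU"
  shows "tmap AQ AQ (act g) q (lifted_coord i q) = lifted_coord i (act g q)"
proof -
  have "lifted_coord i (act g q) = pushvec AQ (\<lambda>x. act g (\<psi>i (inv_chart cX x, snd (\<psi> q)))) (snd cX (\<pi> q)) i"
    unfolding lifted_coord_def \<pi>_act
    by (rule pushvec_cong_open[OF is_chart_open_image[OF ccX] inv_chart_at(1)[OF cX_at[OF q]]])
      (simp add: \<psi>_act[OF q] act_\<psi>i is_chart_inv_in[OF ccX])
  then show ?thesis
    using tmap_pushvec[OF aQ aQ section_smooth inv_chart_at(1)[OF cX_at[OF q]] act_fixed_smooth UNIV_I, of g "snd (\<psi> q)" i]
      section_at[OF q] by (simp add: lifted_coord_def)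
qed

lemma tmap_\<pi>_lifted_coord:
  assumes q: "q \<in> PU"
  shows "tmap AQ AX \<pi> q (lifted_coord i q) = pushvec AX (inv_chart cX) (snd cX (\<pi> q)) i"
proof -
  have "pushvec AX (\<lambda>x. \<pi> (\<psi>i (inv_chart cX x, snd (\<psi> q)))) (snd cX (\<pi> q)) i = pushvec AX (inv_chart cX) (snd cX (\<pi> q)) i"
    by (rule pushvec_cong_open[OF is_chart_open_image[OF ccX] inv_chart_at(1)[OF cX_at[OF q]]])
      (simp add: \<pi>_\<psi>i is_chart_inv_in[OF ccX])
  then show ?thesis
    using tmap_pushvec[OF aQ aX section_smooth inv_chart_at(1)[OF cX_at[OF q]] \<pi>_smooth UNIV_I, of "snd (\<psi> q)" i]
      section_at[OF q] by (simp add: lifted_coord_def)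
qed

lemma lifted_coord_smooth: "smooth_vector_field_on AQ PU (lifted_coord i)"
  unfolding smooth_vector_field_on_def
proof (intro conjI ballI open_PU)
  show "lifted_coord i q \<in> tangent_space AQ q" if "q \<in> PU" for q by (rule lifted_coord_tangent[OF that])
  fix c assume cA: "c \<in> AQ"
  then have c: "c \<in> admissible AQ" using smooth_atlas_subset_admissible[OF aQ] by blast
  let ?S = "PU_image c"
  note zin = chart_PU_in[OF c] and S = chart_PU_open[OF c]
  note oX = is_chart_open_image[OF ccX]
  have F: "smooth_map_on std_atlas AQ (?S \<times> chart_image cX) (\<lambda>z. \<psi>i (inv_chart cX (snd z), snd (\<psi> (inv_chart c (fst z)))))"
    by (rule \<psi>i_smooth[OF std_atlas_is_chart smooth_map_on_snd_std[OF smooth_map_on_inv_chart[OF cX] aX bX S]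
          smooth_map_on_fst_std[OF smooth_map_on_compose[OF std_atlas_is_chart aQ cGG inv_chart_PU_smooth[OF c] snd_\<psi>_smooth] aG bQ oX]])
      (use zin is_chart_inv_in[OF ccX] in auto)
  note \<sigma> = base_coordinate_smooth[OF c]
  have "smooth_on ?S (\<lambda>z. pd i (\<lambda>y. snd c (\<psi>i (inv_chart cX (snd (z, y)), snd (\<psi> (inv_chart c (fst (z, y))))))) (snd cX (\<pi> (inv_chart c z))))"
    by (rule smooth_partial_derivative[OF aQ bQ bX F c S \<sigma>]) (use zin section_at in auto)
  then show "smooth_on ?S (\<lambda>z. lifted_coord i (inv_chart c z) c)"
  proof (rule smooth_on_cong_open[OF S, rotated])
    fix z assume z: "z \<in> ?S"
    show "pd i (\<lambda>y. snd c (\<psi>i (inv_chart cX (snd (z, y)), snd (\<psi> (inv_chart c (fst (z, y))))))) (snd cX (\<pi> (inv_chart c z)))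
      = lifted_coord i (inv_chart c z) c"
      unfolding lifted_coord_def using zin(4)[OF z] section_at[OF zin(2)[OF z]] by (subst pushvec_apply) auto
  qed
qed

lemma vsub_lifted_coord_vertical_iff:
  assumes q: "q \<in> PU" and v: "v \<in> tangent_space AQ q"
  shows "vsub (lifted_coord i q) v \<in> vertical_space AQ AX \<pi> q \<longleftrightarrow>
    tmap AQ AX \<pi> q v = pushvec AX (inv_chart cX) (snd cX (\<pi> q)) i"
proof -
  have "tmap AQ AX \<pi> q (vsub (lifted_coord i q) v) = vsub (pushvec AX (inv_chart cX) (snd cX (\<pi> q)) i) (tmap AQ AX \<pi> q v)"
    by (simp add: tmap_vsub[OF aQ aX \<pi>_smooth UNIV_I] tmap_\<pi>_lifted_coord[OF q])
  moreover have "vsub x y = (\<lambda>c. 0) \<longleftrightarrow> y = x" for x y :: "('x,'b) tvec"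
    by (simp add: vsub_def fun_eq_iff) metis
  ultimately show ?thesis
    using vsub_in_tangent_space[OF aQ lifted_coord_tangent[OF q] v, of i] by (simp only: vertical_space_def mem_Collect_eq simp_thms)
qed

text \<open>Vectors with the same projection differ by a vertical one, so the horizontal lift is the
  horizontal part of \<open>lifted_coord i\<close>. Its existence, uniqueness and smoothness then
  come from what \<open>principal_connection\<close> says about horizontal parts.\<close>

lemma hor_lift_eq_horizontal_part:
  assumes q: "q \<in> PU"
  shows "hor_lift i q = (THE v. v \<in> H q \<and> vsub (lifted_coord i q) v \<in> vertical_space AQ AX \<pi> q)"
proof -
  have "v \<in> H q \<and> tmap AQ AX \<pi> q v = pushvec AX (inv_chart cX) (snd cX (\<pi> q)) i \<longleftrightarrow>
      v \<in> H q \<and> vsub (lifted_coord i q) v \<in> vertical_space AQ AX \<pi> q" for v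
  proof (cases "v \<in> H q")
    case True
    then have v: "v \<in> tangent_space AQ q" using connection unfolding principal_connection_def by blast
    show ?thesis by (simp only: vsub_lifted_coord_vertical_iff[OF q v])
  qed simp
  then show ?thesis by (simp add: hor_lift_def horizontal_lift_def)
qed

lemma hor_lift_props:
  assumes q: "q \<in> PU"
  shows "hor_lift i q \<in> tangent_space AQ q" "tmap AQ AX \<pi> q (hor_lift i q) = pushvec AX (inv_chart cX) (snd cX (\<pi> q)) i"
proof -
  have "\<exists>!v. v \<in> H q \<and> vsub (lifted_coord i q) v \<in> vertical_space AQ AX \<pi> q"
    using connection lifted_coord_tangent[OF q] unfolding principal_connection_def by blast
  from theI'[OF this] have v: "hor_lift i q \<in> H q" "vsub (lifted_coord i q) (hor_lift i q) \<in> vertical_space AQ AX \<pi> q"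
    by (simp_all add: hor_lift_eq_horizontal_part[OF q])
  show T: "hor_lift i q \<in> tangent_space AQ q" using v(1) connection unfolding principal_connection_def by blast
  show "tmap AQ AX \<pi> q (hor_lift i q) = pushvec AX (inv_chart cX) (snd cX (\<pi> q)) i"
    using v(2) by (simp only: vsub_lifted_coord_vertical_iff[OF q T])
qed

lemma hor_lift_smooth:
  assumes c: "c \<in> admissible AQ"
  shows "smooth_on (PU_image c) (\<lambda>z. hor_lift i (inv_chart c z) c)"
proof -
  have "smooth_vector_field_on AQ PU (\<lambda>q. THE v. v \<in> H q \<and> vsub (lifted_coord i q) v \<in> vertical_space AQ AX \<pi> q)"
    using connection lifted_coord_smooth unfolding principal_connection_def by blast
  from smooth_vector_field_admissible[OF aQ this c] show ?thesis
    by (rule smooth_on_cong_open[OF chart_PU_open[OF c], rotated]) (use chart_PU_in(2)[OF c] in \<open>simp add: hor_lift_eq_horizontal_part\<close>)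
qed

text \<open>Near \<open>q\<close> the inverse chart factors as \<open>J\<close> after
  \<open>M\<close>, where \<open>J\<close> parametrizes \<open>Q\<close> by base and group
  coordinates and \<open>M\<close> computes these coordinates. The chain rule then writes
  \<open>d\<close> through the partial derivatives of \<open>J\<close>, which are the two families
  of fields.\<close>

lemma frame_spans:
  assumes q: "q \<in> PU" and c: "c \<in> charts_at AQ q" and E: "tbasis I E (TG)"
  shows "\<exists>r s. d = (\<Sum>i\<in>BX. r i *\<^sub>R lifted_coord i q c) + (\<Sum>a\<in>I. s a *\<^sub>R Ehat (E a) q c)"
proof -
  obtain e where e: "e \<in> charts_at AG one" using charts_at_ex[OF aG] by blast
  note ie = inv_chart_at[OF e] and ic = inv_chart_at[OF c] and iX = inv_chart_at[OF cX_at[OF q]]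
  define h where "h = snd (\<psi> q)"
  \<comment> \<open>The group factor is parametrized near \<open>h\<close> by left translation of a
    chart at the identity, because the basis \<open>E\<close> lives there and \<open>Ehat\<close> is
    the derivative of the orbit map at \<open>one\<close>.\<close>
  define J where "J z = \<psi>i (inv_chart cX (fst z), mul h (inv_chart e (snd z)))" for z
  have oe: "open (chart_image e)" and oX: "open (chart_image cX)"
    using is_chart_open_image admissible_is_chart ie iX by blast+
  have J: "smooth_map_on std_atlas AQ (chart_image cX \<times> chart_image e) J"
    unfolding J_def
    by (rule \<psi>i_smooth[OF std_atlas_is_chart smooth_map_on_fst_std[OF iX(5) aX bX oe]
          mul_smooth[OF std_atlas_is_chart smooth_map_on_const[OF std_atlas_is_chart open_Times[OF oX oe]] smooth_map_on_snd_std[OF ie(5) aG bG oX]]])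
      (use is_chart_inv_in[OF ccX] in auto)
  define S where "S = PU_image c \<inter> (\<lambda>z. mul (inverse_of h) (snd (\<psi> (inv_chart c z)))) -` fst e"
  have k: "smooth_map_on std_atlas AG (PU_image c) (\<lambda>z. mul (inverse_of h) (snd (\<psi> (inv_chart c z))))"
    by (rule mul_smooth[OF std_atlas_is_chart smooth_map_on_const[OF std_atlas_is_chart chart_PU_open[OF ic(4)]]
          smooth_map_on_compose[OF std_atlas_is_chart aQ cGG inv_chart_PU_smooth[OF ic(4)] snd_\<psi>_smooth]])
      (use chart_PU_in[OF ic(4)] in auto)
  have S: "open S" and dk: "smooth_on S (\<lambda>z. snd e (mul (inverse_of h) (snd (\<psi> (inv_chart c z)))))"
    unfolding S_def by (rule smooth_map_on_coords[OF aG k ie(4)])+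
  have dx: "smooth_on S (\<lambda>z. snd cX (\<pi> (inv_chart c z)))"
    by (rule smooth_on_subset[OF base_coordinate_smooth[OF ic(4)]]) (auto simp: S_def)
  define M where "M z = (snd cX (\<pi> (inv_chart c z)), snd e (mul (inverse_of h) (snd (\<psi> (inv_chart c z)))))" for z
  have M: "smooth_on S M" unfolding M_def by (rule smooth_on_Pair[OF S dx dk])
  have qS: "snd c q \<in> S" using ic q ie by (auto simp: S_def h_def)
  have M0: "M (snd c q) = (snd cX (\<pi> q), snd e one)" using ic by (simp add: M_def h_def)
  have JM: "J (M z) = inv_chart c z" if "z \<in> S" for z
  proof -
    have zS: "z \<in> PU_image c" and ze: "mul (inverse_of h) (snd (\<psi> (inv_chart c z))) \<in> fst e"
      using that by (auto simp: S_def)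
    note zin = chart_PU_in[OF ic(4) zS]
    have "mul h (mul (inverse_of h) (snd (\<psi> (inv_chart c z)))) = snd (\<psi> (inv_chart c z))"
      by (simp add: grp.assoc[symmetric])
    then show ?thesis
      unfolding J_def M_def fst_conv snd_conv is_chart_inv[OF admissible_is_chart[OF ie(4)] ze]
      using section_at[OF zin(2)] by simp
  qed
  obtain d1 d2 where d12: "pd d M (snd c q) = (d1, d2)" by (cases "pd d M (snd c q)")
  have "pushvec AQ (inv_chart c) (snd c q) d = pushvec AQ (\<lambda>z. J (M z)) (snd c q) d"
    by (rule pushvec_cong_open[OF S qS]) (simp add: JM)
  also have "\<dots> = pushvec AQ J (snd cX (\<pi> q), snd e one) (d1, d2)"
    using pushvec_reparam[OF aQ J, of M "snd c q" d] smooth_on_differentiable[OF M qS] iX ie by (simp add: M0 d12)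
  also have "\<dots> = vadd (pushvec AQ (\<lambda>x. J (x, snd e one)) (snd cX (\<pi> q)) d1) (pushvec AQ (\<lambda>y. J (snd cX (\<pi> q), y)) (snd e one) d2)"
    by (rule pushvec_Pair[OF aQ J]) (use iX ie in auto)
  also have "(\<lambda>x. J (x, snd e one)) = (\<lambda>x. \<psi>i (inv_chart cX x, snd (\<psi> q)))"
    using ie by (simp add: J_def h_def)
  also have "pushvec AQ (\<lambda>x. \<psi>i (inv_chart cX x, snd (\<psi> q))) (snd cX (\<pi> q)) d1 = lincomb BX (\<lambda>i. d1 \<bullet> i) (\<lambda>i. lifted_coord i q)"
    unfolding lifted_coord_def using pushvec_sum[OF aQ section_smooth[of "snd (\<psi> q)"] iX(1), of "\<lambda>i. d1 \<bullet> i" "\<lambda>i. i" BX]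
    by (simp add: coord_basis_expand[OF bX, of d1, symmetric])
  also have "(\<lambda>y. J (snd cX (\<pi> q), y)) = (\<lambda>y. right_act q (inv_chart e y))"
    using iX by (simp add: J_def right_act_def h_def)
  finally have eq: "pushvec AQ (inv_chart c) (snd c q) d =
      vadd (lincomb BX (\<lambda>i. d1 \<bullet> i) (\<lambda>i. lifted_coord i q)) (pushvec AQ (\<lambda>y. right_act q (inv_chart e y)) (snd e one) d2)" .
  have "pushvec AG (inv_chart e) (snd e one) d2 \<in> TG"
    using pushvec_in_tangent_space[OF aG ie(5,1), of d2] ie by simp
  then obtain s where "pushvec AG (inv_chart e) (snd e one) d2 = lincomb I s E"
    using E unfolding tbasis_def by blast
  then have d2: "d2 = (\<Sum>a\<in>I. s a *\<^sub>R E a e)"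
    using pushvec_inv_chart[OF e, of d2] by (simp add: lincomb_def)
  have Re: "smooth_map_on std_atlas AQ (chart_image e) (\<lambda>y. right_act q (inv_chart e y))"
    by (rule smooth_map_on_compose[OF std_atlas_is_chart aG cQ ie(5) right_act_fixed_smooth[OF q]]) auto
  have "pushvec AQ (\<lambda>y. right_act q (inv_chart e y)) (snd e one) d2 = lincomb I s (\<lambda>a. Ehat (E a) q)"
    unfolding d2 pushvec_sum[OF aQ Re ie(1)]
    using E Ehat_chart[OF q _ e] by (simp add: lincomb_def tbasis_def fun_eq_iff)
  with eq have "pushvec AQ (inv_chart c) (snd c q) d c =
      vadd (lincomb BX (\<lambda>i. d1 \<bullet> i) (\<lambda>i. lifted_coord i q)) (lincomb I s (\<lambda>a. Ehat (E a) q)) c" by simp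
  then have "d = (\<Sum>i\<in>BX. (d1 \<bullet> i) *\<^sub>R lifted_coord i q c) + (\<Sum>a\<in>I. s a *\<^sub>R Ehat (E a) q c)"
    by (simp add: pushvec_inv_chart[OF c] vadd_def lincomb_def)
  then show ?thesis by blast
qed

end

section \<open>Reconstruction\<close>

lemma differentiable_Pair_at:
  "f differentiable (at x) \<Longrightarrow> g differentiable (at x) \<Longrightarrow> (\<lambda>x. (f x, g x)) differentiable (at x)"
  unfolding differentiable_def by (blast intro: has_derivative_Pair)

lemma differentiable_chi_at:
  fixes f :: "'k::finite \<Rightarrow> 'a::real_normed_vector \<Rightarrow> 'b::real_normed_vector"
  assumes "\<And>\<alpha>. f \<alpha> differentiable (at x)"
  shows "(\<lambda>x. \<chi> \<alpha>. f \<alpha> x) differentiable (at x)"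
  by (rule differentiableI, rule has_derivative_chi, rule pd_has_derivative, rule assms)

lemma differentiable_sum_at:
  assumes "\<And>i. i \<in> I \<Longrightarrow> f i differentiable (at x)"
  shows "(\<lambda>x. \<Sum>i\<in>I. f i x) differentiable (at x)"
  by (rule differentiableI, rule has_derivative_sum, rule pd_has_derivative, rule assms)

text \<open>Prepares the differentiability of \<open>lhat\<close>, which near a point is
  \<open>L\<close> along a local section \<open>\<sigma>\<close> with the velocity assembled from
  the frame.\<close>

lemma frame_differentiable:
  fixes L :: "'e::real_inner \<times> ('e^'k::finite) \<Rightarrow> real" and X :: "'b::real_inner \<Rightarrow> 'e \<Rightarrow> 'e" and E :: "'h::real_inner \<Rightarrow> 'e \<Rightarrow> 'e"
    and \<sigma> :: "'b \<Rightarrow> 'e"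
  assumes \<sigma>: "\<sigma> differentiable (at x)" and L: "\<And>u. L differentiable (at (\<sigma> x, u))"
    and X: "\<And>i. i \<in> I \<Longrightarrow> X i differentiable (at (\<sigma> x))" and E: "\<And>a. a \<in> J \<Longrightarrow> E a differentiable (at (\<sigma> x))"
  shows "(\<lambda>p :: 'b \<times> ('b^'k) \<times> ('h^'k). L (\<sigma> (fst p), \<chi> \<alpha>. (\<Sum>i\<in>I. (fst (snd p) $ \<alpha> \<bullet> i) *\<^sub>R X i (\<sigma> (fst p)))
      + (\<Sum>a\<in>J. (snd (snd p) $ \<alpha> \<bullet> a) *\<^sub>R E a (\<sigma> (fst p))))) differentiable (at (x, v, w))"
proof -
  have s: "(\<lambda>p :: 'b \<times> ('b^'k) \<times> ('h^'k). \<sigma> (fst p)) differentiable (at (x, v, w))"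
    by (rule differentiable_compose_at[OF bounded_linear_imp_differentiable[OF bounded_linear_fst]]) (simp add: \<sigma>)
  have cv: "(\<lambda>p :: 'b \<times> ('b^'k) \<times> ('h^'k). fst (snd p) $ \<alpha> \<bullet> i) differentiable (at (x, v, w))" for \<alpha> i
    by (rule bounded_linear_imp_differentiable, rule bounded_linear_compose[OF bounded_linear_inner_left],
      rule bounded_linear_compose[OF bounded_linear_vec_nth], rule bounded_linear_compose[OF bounded_linear_fst bounded_linear_snd])
  have cw: "(\<lambda>p :: 'b \<times> ('b^'k) \<times> ('h^'k). snd (snd p) $ \<alpha> \<bullet> i) differentiable (at (x, v, w))" for \<alpha> i
    by (rule bounded_linear_imp_differentiable, rule bounded_linear_compose[OF bounded_linear_inner_left],
      rule bounded_linear_compose[OF bounded_linear_vec_nth], rule bounded_linear_compose[OF bounded_linear_snd bounded_linear_snd])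
  have X': "(\<lambda>p :: 'b \<times> ('b^'k) \<times> ('h^'k). X i (\<sigma> (fst p))) differentiable (at (x, v, w))" if "i \<in> I" for i
    by (rule differentiable_compose_at[OF s]) (simp add: X[OF that])
  have E': "(\<lambda>p :: 'b \<times> ('b^'k) \<times> ('h^'k). E i (\<sigma> (fst p))) differentiable (at (x, v, w))" if "i \<in> J" for i
    by (rule differentiable_compose_at[OF s]) (simp add: E[OF that])
  show ?thesis
    by (rule differentiable_compose_at[OF differentiable_Pair_at[OF s differentiable_chi_at[OF differentiable_add[OF
      differentiable_sum_at[OF differentiable_scaleR[OF cv X']] differentiable_sum_at[OF differentiable_scaleR[OF cw E']]]]]])
      (simp_all add: L)
qed

text \<open>The Kronecker part of \<open>u\<close> cancels the vertical part of \<open>dX\<close>,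
  since solving the frame relations gives dX_i = X_i + (\<open>\<gamma>\<close> times
  \<open>A\<close>) Et; \<open>Km\<close> serves to turn velocities of the group coordinates into
  multiples of \<open>Et\<close>. What remains beside \<open>X\<close> is the \<open>Bt\<close>
  part.\<close>

lemma horizontal_velocity:
  fixes X :: "'i \<Rightarrow> 'e::real_vector"
  assumes "finite J"
    and dX: "\<And>i. i \<in> I \<Longrightarrow> X i = dX i - (\<Sum>c\<in>J. \<gamma> c i *\<^sub>R Eh c)"
    and Eh: "\<And>c. c \<in> J \<Longrightarrow> Eh c = (\<Sum>b\<in>J. A b c *\<^sub>R Et b)"
    and Et: "\<And>b. b \<in> J \<Longrightarrow> Et b = (\<Sum>a\<in>J. Km a b *\<^sub>R dG a)"
    and u: "\<And>a. a \<in> J \<Longrightarrow> u a = - (\<Sum>i\<in>I. \<Sum>\<delta>\<in>UNIV. v i \<delta> *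
      (\<Sum>b\<in>J. Km a b * ((\<Sum>c\<in>J. \<gamma> c i * A b c) * (if \<delta> = \<alpha> then 1 else 0) + Bt \<delta> b i)))"
  shows "(\<Sum>i\<in>I. v i \<alpha> *\<^sub>R dX i) + (\<Sum>a\<in>J. u a *\<^sub>R dG a) =
    (\<Sum>i\<in>I. v i \<alpha> *\<^sub>R X i) - (\<Sum>b\<in>J. (\<Sum>i\<in>I. \<Sum>\<delta>\<in>(UNIV :: 'k::finite set). v i \<delta> * Bt \<delta> b i) *\<^sub>R Et b)"
proof -
  \<comment> \<open>Up to sign, \<open>m b\<close> is the contribution of the connection and
    \<open>n b\<close> that of \<open>Bt\<close> to the coefficient of \<open>Et b\<close> in the
    group velocity.\<close>
  define m where "m b = (\<Sum>i\<in>I. v i \<alpha> * (\<Sum>c\<in>J. \<gamma> c i * A b c))" for b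
  define n where "n b = (\<Sum>i\<in>I. \<Sum>\<delta>\<in>UNIV. v i \<delta> * Bt \<delta> b i)" for b
  have ua: "u a = - (\<Sum>b\<in>J. (m b + n b) * Km a b)" if "a \<in> J" for a
  proof -
    let ?T = "\<lambda>i \<delta> b. v i \<delta> * (Km a b * ((\<Sum>c\<in>J. \<gamma> c i * A b c) * (if \<delta> = \<alpha> then 1 else 0) + Bt \<delta> b i))"
    have "(\<Sum>i\<in>I. \<Sum>\<delta>\<in>UNIV. v i \<delta> * (\<Sum>b\<in>J. Km a b * ((\<Sum>c\<in>J. \<gamma> c i * A b c) * (if \<delta> = \<alpha> then 1 else 0) + Bt \<delta> b i)))
      = (\<Sum>i\<in>I. \<Sum>\<delta>\<in>UNIV. \<Sum>b\<in>J. ?T i \<delta> b)"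
      by (simp only: sum_distrib_left)
    also have "\<dots> = (\<Sum>i\<in>I. \<Sum>b\<in>J. \<Sum>\<delta>\<in>UNIV. ?T i \<delta> b)"
      by (rule sum.cong[OF refl], rule sum.swap)
    also have "\<dots> = (\<Sum>b\<in>J. \<Sum>i\<in>I. \<Sum>\<delta>\<in>UNIV. ?T i \<delta> b)"
      by (rule sum.swap)
    also have "\<dots> = (\<Sum>b\<in>J. (m b + n b) * Km a b)"
    proof (rule sum.cong[OF refl])
      fix b
      have *: "(\<Sum>\<delta>\<in>UNIV. ?T i \<delta> b)
        = Km a b * (v i \<alpha> * (\<Sum>c\<in>J. \<gamma> c i * A b c)) + Km a b * (\<Sum>\<delta>\<in>UNIV. v i \<delta> * Bt \<delta> b i)" for i
      proof -
        let ?s = "\<Sum>c\<in>J. \<gamma> c i * A b c"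
        have "(\<Sum>\<delta>\<in>UNIV. v i \<delta> * (Km a b * (?s * (if \<delta> = \<alpha> then 1 else 0) + Bt \<delta> b i)))
          = (\<Sum>\<delta>\<in>UNIV. (if \<delta> = \<alpha> then Km a b * (v i \<delta> * ?s) else 0) + Km a b * (v i \<delta> * Bt \<delta> b i))"
          by (rule sum.cong[OF refl]) (simp add: algebra_simps)
        then show ?thesis by (simp add: sum.distrib sum_distrib_left)
      qed
      show "(\<Sum>i\<in>I. \<Sum>\<delta>\<in>UNIV. ?T i \<delta> b)
        = (m b + n b) * Km a b"
        unfolding * m_def n_def sum.distrib sum_distrib_left[symmetric] by (simp only: distrib_left mult.commute[of _ "Km a b"])
    qed
    finally show ?thesis using u[OF that] by simp
  qed
  have "(\<Sum>a\<in>J. u a *\<^sub>R dG a) = - (\<Sum>a\<in>J. \<Sum>b\<in>J. (m b + n b) *\<^sub>R Km a b *\<^sub>R dG a)"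
    by (simp add: ua scaleR_sum_left sum_negf cong: sum.cong)
  also have "(\<Sum>a\<in>J. \<Sum>b\<in>J. (m b + n b) *\<^sub>R Km a b *\<^sub>R dG a) = (\<Sum>b\<in>J. (m b + n b) *\<^sub>R Et b)"
    by (subst sum.swap) (simp add: Et scaleR_sum_right cong: sum.cong)
  finally have 1: "(\<Sum>a\<in>J. u a *\<^sub>R dG a) = - (\<Sum>b\<in>J. m b *\<^sub>R Et b) - (\<Sum>b\<in>J. n b *\<^sub>R Et b)"
    by (simp add: scaleR_add_left sum.distrib)
  have "(\<Sum>c\<in>J. \<gamma> c i *\<^sub>R Eh c) = (\<Sum>b\<in>J. (\<Sum>c\<in>J. \<gamma> c i * A b c) *\<^sub>R Et b)" for i
  proof -
    have "(\<Sum>c\<in>J. \<gamma> c i *\<^sub>R Eh c) = (\<Sum>c\<in>J. \<Sum>b\<in>J. (\<gamma> c i * A b c) *\<^sub>R Et b)"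
      by (simp add: Eh scaleR_sum_right cong: sum.cong)
    also have "\<dots> = (\<Sum>b\<in>J. \<Sum>c\<in>J. (\<gamma> c i * A b c) *\<^sub>R Et b)" by (rule sum.swap)
    finally show ?thesis by (simp add: scaleR_sum_left)
  qed
  then have "dX i = X i + (\<Sum>b\<in>J. (\<Sum>c\<in>J. \<gamma> c i * A b c) *\<^sub>R Et b)" if "i \<in> I" for i
    using dX[OF that] by simp
  then have "(\<Sum>i\<in>I. v i \<alpha> *\<^sub>R dX i) = (\<Sum>i\<in>I. v i \<alpha> *\<^sub>R X i) + (\<Sum>i\<in>I. \<Sum>b\<in>J. (v i \<alpha> * (\<Sum>c\<in>J. \<gamma> c i * A b c)) *\<^sub>R Et b)"
    by (simp add: scaleR_add_right scaleR_sum_right sum.distrib cong: sum.cong)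
  also have "(\<Sum>i\<in>I. \<Sum>b\<in>J. (v i \<alpha> * (\<Sum>c\<in>J. \<gamma> c i * A b c)) *\<^sub>R Et b) = (\<Sum>b\<in>J. m b *\<^sub>R Et b)"
    by (subst sum.swap) (simp only: m_def scaleR_sum_left)
  finally show ?thesis using 1 by (simp add: n_def)
qed

section \<open>Velocities of curves in the bundle\<close>

context trivialized_bundle
begin

text \<open>Factoring g(s) = g(t) k(s) with k(t) the identity moves the computation to
  \<open>one\<close>: the fixed factor acts through its tangent map, and the Leibniz rule splits the
  rest into a fundamental vector and the velocity of \<open>q\<close>. The derivative of k is the
  left-hand side of the reconstruction equation.\<close>

lemma pushvec_act_curve:
  fixes g :: "'v::real_inner \<Rightarrow> 'g"
  assumes BV: "coord_basis (BV :: 'v set)"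
    and g: "smooth_map_on std_atlas AG D g" and q: "smooth_map_on std_atlas AQ D q" and t: "t \<in> D"
  shows "pushvec AQ (\<lambda>s. act (g s) (q s)) t d = tmap AQ AQ (act (g t)) (q t)
    (vadd (tmap AG AQ (\<lambda>k. act k (q t)) one (tmap AG AG (mul (inverse_of (g t))) (g t) (pushvec AG g t d))) (pushvec AQ q t d))"
proof -
  note sc = std_atlas_is_chart
  have D: "open D" by (rule smooth_map_on_open[OF g])
  define k where "k s = mul (inverse_of (g t)) (g s)" for s
  have k: "smooth_map_on std_atlas AG D k"
    unfolding k_def by (rule mul_smooth[OF sc smooth_map_on_const[OF sc D] g])
  have kt: "k t = one" by (simp add: k_def)
  have F: "smooth_map_on std_atlas AQ (D \<times> D) (\<lambda>z. act (k (fst z)) (q (snd z)))"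
    by (rule act_smooth[OF sc smooth_map_on_fst_std[OF k aG BV D] smooth_map_on_snd_std[OF q aQ BV D]])
  have kq: "smooth_map_on std_atlas AQ D (\<lambda>s. act (k s) (q s))" by (rule act_smooth[OF sc k q])
  have "act (g s) (q s) = act (g t) (act (k s) (q s))" for s
    by (simp add: act_mul[symmetric] k_def grp.assoc[symmetric])
  then have "pushvec AQ (\<lambda>s. act (g s) (q s)) t d = pushvec AQ (\<lambda>s. act (g t) (act (k s) (q s))) t d" by simp
  also have "\<dots> = tmap AQ AQ (act (g t)) (q t) (pushvec AQ (\<lambda>s. act (k s) (q s)) t d)"
    using tmap_pushvec[OF aQ aQ kq t act_fixed_smooth UNIV_I, of "g t" d] by (simp add: kt)
  also have "pushvec AQ (\<lambda>s. act (k s) (q s)) t d = pushvec AQ (\<lambda>z. act (k (fst z)) (q (snd z))) (t, t) (d, d)"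
  proof -
    have "((\<lambda>s. (s, s)) has_derivative (\<lambda>d. (d, d))) (at t)" by (auto intro!: derivative_eq_intros)
    from pushvec_reparam[OF aQ F, of "\<lambda>s. (s, s)" t d] differentiableI[OF this] pd_eqI[OF this, of d] t
    show ?thesis by simp
  qed
  also have "\<dots> = vadd (pushvec AQ (\<lambda>s. act (k s) (q t)) t d) (pushvec AQ q t d)"
    using pushvec_Pair[OF aQ F, of t t d d] t by (simp add: kt)
  also have "pushvec AQ (\<lambda>s. act (k s) (q t)) t d = tmap AG AQ (\<lambda>k. act k (q t)) one (pushvec AG k t d)"
  proof -
    have "smooth_map_on AG AQ UNIV (\<lambda>k. act k (q t))"
      by (rule act_smooth[OF cGG smooth_map_on_id[OF aG open_UNIV] smooth_map_on_const[OF cGG open_UNIV]])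
    from tmap_pushvec[OF aG aQ k t this UNIV_I, of d] show ?thesis by (simp add: kt)
  qed
  also have "pushvec AG k t d = tmap AG AG (mul (inverse_of (g t))) (g t) (pushvec AG g t d)"
    unfolding k_def by (rule tmap_pushvec[OF aG aG g t mul_fixed_smooth UNIV_I, symmetric])
  finally show ?thesis .
qed

lemma local_curve_smooth:
  assumes x: "smooth_on D x" "x ` D \<subseteq> chart_image cX" and y: "smooth_on D y" "y ` D \<subseteq> chart_image c" and c: "c \<in> admissible AG"
    and D: "open D"
  shows "smooth_map_on std_atlas AQ D (\<lambda>s. \<psi>i (inv_chart cX (x s), inv_chart c (y s)))"
proof (rule \<psi>i_smooth[OF std_atlas_is_chart])
  show "smooth_map_on std_atlas AX D (\<lambda>s. inv_chart cX (x s))"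
    by (rule smooth_map_on_compose[OF std_atlas_is_chart smooth_atlas_std[OF bX] cXX _ smooth_map_on_inv_chart[OF cX] x(2)])
      (assumption, assumption, rule smooth_map_on_std[THEN iffD2, OF conjI[OF D x(1)]])
  show "smooth_map_on std_atlas AG D (\<lambda>s. inv_chart c (y s))"
    by (rule smooth_map_on_compose[OF std_atlas_is_chart smooth_atlas_std[OF bG] cGG _ smooth_map_on_inv_chart[OF c] y(2)])
      (assumption, assumption, rule smooth_map_on_std[THEN iffD2, OF conjI[OF D y(1)]])
  show "(\<lambda>s. inv_chart cX (x s)) ` D \<subseteq> fst cX"
    using x(2) is_chart_inv_in[OF ccX] by auto
qed

lemma pushvec_local_curve:
  assumes x: "x differentiable (at t)" "x t \<in> chart_image cX" and y: "y differentiable (at t)" "y t \<in> chart_image c"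
    and c: "c \<in> admissible AG"
  defines "q \<equiv> \<psi>i (inv_chart cX (x t), inv_chart c (y t))"
  shows "pushvec AQ (\<lambda>s. \<psi>i (inv_chart cX (x s), inv_chart c (y s))) t d =
    vadd (lincomb BX (\<lambda>i. pd d x t \<bullet> i) (\<lambda>i. lifted_coord i q))
      (lincomb BG (\<lambda>a. pd d y t \<bullet> a) (\<lambda>a. pushvec AQ (\<lambda>y. \<psi>i (\<pi> q, inv_chart c y)) (snd c (snd (\<psi> q))) a))"
proof -
  note ccX = ccX and cc = admissible_is_chart[OF c]
  have xin: "inv_chart cX (x t) \<in> fst cX" by (rule is_chart_inv_in[OF ccX x(2)])
  have \<psi>q: "snd (\<psi> q) = inv_chart c (y t)" and \<pi>q: "\<pi> q = inv_chart cX (x t)"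
    using \<psi>_\<psi>i[OF xin] \<pi>_\<psi>i[OF xin] by (simp_all add: q_def)
  have base: "snd cX (\<pi> q) = x t" "snd c (snd (\<psi> q)) = y t"
    by (simp_all add: \<psi>q \<pi>q is_chart_image[OF ccX x(2)] is_chart_image[OF cc y(2)])
  have F: "smooth_map_on std_atlas AQ (chart_image cX \<times> chart_image c) (\<lambda>z. \<psi>i (inv_chart cX (fst z), inv_chart c (snd z)))"
    by (rule \<psi>i_smooth[OF std_atlas_is_chart smooth_map_on_fst_std[OF smooth_map_on_inv_chart[OF cX] aX bX is_chart_open_image[OF cc]]
          smooth_map_on_snd_std[OF smooth_map_on_inv_chart[OF c] aG bG is_chart_open_image[OF ccX]]])
      (use is_chart_inv_in[OF ccX] in auto)
  have fib: "smooth_map_on std_atlas AQ (chart_image c) (\<lambda>y. \<psi>i (inv_chart cX (x t), inv_chart c y))"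
    by (rule \<psi>i_smooth[OF std_atlas_is_chart smooth_map_on_const[OF std_atlas_is_chart is_chart_open_image[OF cc]] smooth_map_on_inv_chart[OF c]])
      (use xin in auto)
  have der: "((\<lambda>s. (x s, y s)) has_derivative (\<lambda>d. (pd d x t, pd d y t))) (at t)"
    by (intro has_derivative_Pair pd_has_derivative x y)
  have "pushvec AQ (\<lambda>s. \<psi>i (inv_chart cX (x s), inv_chart c (y s))) t d =
      pushvec AQ (\<lambda>z. \<psi>i (inv_chart cX (fst z), inv_chart c (snd z))) (x t, y t) (pd d x t, pd d y t)"
    using pushvec_reparam[OF aQ F, of "\<lambda>s. (x s, y s)" t d] differentiableI[OF der] pd_eqI[OF der, of d] x y by simp
  also have "\<dots> = vadd (pushvec AQ (\<lambda>x. \<psi>i (inv_chart cX x, inv_chart c (y t))) (x t) (pd d x t))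
      (pushvec AQ (\<lambda>y. \<psi>i (inv_chart cX (x t), inv_chart c y)) (y t) (pd d y t))"
    using pushvec_Pair[OF aQ F, of "x t" "y t" "pd d x t" "pd d y t"] x y by simp
  also have "pushvec AQ (\<lambda>x. \<psi>i (inv_chart cX x, inv_chart c (y t))) (x t) (pd d x t) = lincomb BX (\<lambda>i. pd d x t \<bullet> i) (\<lambda>i. lifted_coord i q)"
    unfolding lifted_coord_def base \<psi>q
    using pushvec_sum[OF aQ section_smooth[of "inv_chart c (y t)"] x(2), of "\<lambda>i. pd d x t \<bullet> i" "\<lambda>i. i" BX]
    by (simp add: coord_basis_expand[OF bX, of "pd d x t", symmetric])
  also have "pushvec AQ (\<lambda>y. \<psi>i (inv_chart cX (x t), inv_chart c y)) (y t) (pd d y t) =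
      lincomb BG (\<lambda>a. pd d y t \<bullet> a) (\<lambda>a. pushvec AQ (\<lambda>y. \<psi>i (\<pi> q, inv_chart c y)) (snd c (snd (\<psi> q))) a)"
    unfolding base \<pi>q
    using pushvec_sum[OF aQ fib y(2), of "\<lambda>i. pd d y t \<bullet> i" "\<lambda>i. i" BG]
    by (simp add: coord_basis_expand[OF bG, of "pd d y t", symmetric])
  finally show ?thesis .
qed

lemma pd_base_coordinate:
  assumes c: "c \<in> charts_at AQ q" and q: "q \<in> PU" and v: "v \<in> tangent_space AQ q"
  shows "pd (v c) (\<lambda>z. snd cX (\<pi> (inv_chart c z))) (snd c q) = tmap AQ AX \<pi> q v cX"
  unfolding tmap_eq[OF aQ aX \<pi>_smooth UNIV_I v c]
  using cX_at[OF q] inv_chart_at[OF c] by (subst pushvec_apply) auto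

end

theorem proposition6p4:
  fixes BQ :: "'e::real_inner set"
    and AQ :: "('q::{t2_space,second_countable_topology},'e) chart set"
    and BG :: "'h::real_inner set"
    and AG :: "('g::{t2_space,second_countable_topology},'h) chart set"
    and mul :: "'g \<Rightarrow> 'g \<Rightarrow> 'g" and one :: 'g and inverse_of :: "'g \<Rightarrow> 'g"
    and act :: "'g \<Rightarrow> 'q \<Rightarrow> 'q"
    and BX :: "'b::real_inner set"
    and AX :: "('x::{t2_space,second_countable_topology},'b) chart set"
    and \<pi> :: "'q \<Rightarrow> 'x"
    and H :: "'q \<Rightarrow> ('q,'e) tvec set"
    and L :: "('q,'e,'k::finite) kvel \<Rightarrow> real"
    and l :: "('q,'e,'k) kvel set \<Rightarrow> real"
    and cX :: "('x,'b) chart" and cG :: "('g,'h) chart"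
    and \<psi> :: "'q \<Rightarrow> 'x \<times> 'g"
    and E :: "'h \<Rightarrow> ('g,'h) tvec" and C :: "'h \<Rightarrow> 'h \<Rightarrow> 'h \<Rightarrow> real"
    and Et Eh :: "'h \<Rightarrow> 'q \<Rightarrow> ('q,'e) tvec"
    and dX :: "'b \<Rightarrow> 'q \<Rightarrow> ('q,'e) tvec" and dG :: "'h \<Rightarrow> 'q \<Rightarrow> ('q,'e) tvec"
    and X :: "'b \<Rightarrow> 'q \<Rightarrow> ('q,'e) tvec"
    and Km A :: "'q \<Rightarrow> 'h \<Rightarrow> 'h \<Rightarrow> real"
    and \<gamma> :: "'b \<Rightarrow> 'h \<Rightarrow> 'b \<Rightarrow> real"
    and \<Upsilon> :: "'b \<Rightarrow> 'h \<Rightarrow> 'b \<Rightarrow> 'h \<Rightarrow> real"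
    and K :: "'b \<Rightarrow> 'h \<Rightarrow> 'b \<Rightarrow> 'b \<Rightarrow> real"
    and pt :: "'b \<Rightarrow> 'g \<Rightarrow> 'b^'k \<Rightarrow> 'h^'k \<Rightarrow> ('q,'e,'k) kvel"
    and vt :: "('q,'e,'k) kvel \<Rightarrow> 'h \<Rightarrow> 'k \<Rightarrow> real"
    and lhat :: "'b \<times> ('b^'k) \<times> ('h^'k) \<Rightarrow> real"
    and gia :: "('q,'e,'k) kvel \<Rightarrow> 'k \<Rightarrow> 'k \<Rightarrow> 'b \<Rightarrow> 'h \<Rightarrow> real"
    and gab :: "('q,'e,'k) kvel \<Rightarrow> 'k \<Rightarrow> 'k \<Rightarrow> 'h \<Rightarrow> 'h \<Rightarrow> real"
    and ginv :: "('q,'e,'k) kvel \<Rightarrow> 'h \<Rightarrow> 'h \<Rightarrow> 'k \<Rightarrow> 'k \<Rightarrow> real"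
    and Bt :: "('q,'e,'k) kvel \<Rightarrow> 'k \<Rightarrow> 'h \<Rightarrow> 'k \<Rightarrow> 'b \<Rightarrow> real"
    and D :: "(real^'k) set"
    and \<phi>x :: "real^'k \<Rightarrow> 'b" and \<phi>v :: "real^'k \<Rightarrow> 'b^'k" and \<phi>w :: "real^'k \<Rightarrow> 'h^'k"
    and \<phi>h :: "real^'k \<Rightarrow> 'h" and \<phi>H :: "real^'k \<Rightarrow> ('q,'e,'k) kvel"
    and g :: "real^'k \<Rightarrow> 'g" and \<phi> :: "real^'k \<Rightarrow> ('q,'e,'k) kvel" and \<phi>Q :: "real^'k \<Rightarrow> 'q"
  assumes
    \<comment> \<open>the principal bundle, the connection and the Lagrangian\<close>
        Q: "smooth_manifold BQ AQ"
    and G: "lie_group BG AG mul one inverse_of" "connected (UNIV :: 'g set)"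
    and action: "smooth_left_action AG mul one AQ act" "free_action one act" "proper_action act"
    and quotient: "quotient_manifold AQ act BX AX \<pi>"
    and connection: "principal_connection AQ act AX \<pi> H"
    and L_smooth: "smooth_on_T1k AQ L"
    and L_regular: "regular_lagrangian BQ AQ L"
    and L_invariant: "\<And>h p. p \<in> T1k AQ \<Longrightarrow> L (T1k_act AQ act h p) = L p"
    and l: "\<And>p. p \<in> T1k AQ \<Longrightarrow> l (T1k_orbit AQ act p) = L p"
    \<comment> \<open>coordinates on \<open>U = fst cX\<close> and on \<open>G\<close>, and the trivialization over \<open>U\<close>\<close>
    and cX: "cX \<in> admissible AX" and cG: "cG \<in> admissible AG"
    and \<psi>: "local_trivialization AQ AG mul act AX \<pi> (fst cX) \<psi>"
    \<comment> \<open>the basis \<open>E\<^sub>a\<close> of the Lie algebra; \<open>C c a b\<close> is the structure constant with upper index \<open>c\<close>\<close>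
    and E: "tbasis BG E (tangent_space AG one)"
    and C: "\<And>a b. a \<in> BG \<Longrightarrow> b \<in> BG \<Longrightarrow>
              lie_algebra_bracket AG mul one (E a) (E b) = lincomb BG (\<lambda>c. C c a b) E"
    \<comment> \<open>the coordinate fields \<open>dX i\<close>, \<open>dG a\<close> of the coordinates \<open>q\<^sup>i\<close>, \<open>q\<^sup>a\<close>, and the local frames\<close>
    and dX: "dX = (\<lambda>i q. pushvec AQ (\<lambda>x. inv_into (\<pi> -` fst cX) \<psi> (inv_chart cX x, snd (\<psi> q))) (snd cX (\<pi> q)) i)"
    and dG: "dG = (\<lambda>a q. pushvec AQ (\<lambda>y. inv_into (\<pi> -` fst cX) \<psi> (\<pi> q, inv_chart cG y)) (snd cG (snd (\<psi> q))) a)"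
    and Et: "Et = (\<lambda>a. fundamental_field AG one AQ act (E a))"
    and Eh: "Eh = (\<lambda>a q. tmap AG AQ (\<lambda>h. inv_into (\<pi> -` fst cX) \<psi> (\<pi> q, h)) (snd (\<psi> q))
                           (left_inv_field AG mul one (E a) (snd (\<psi> q))))"
    and X: "X = (\<lambda>i q. horizontal_lift AQ AX \<pi> H q (pushvec AX (inv_chart cX) (snd cX (\<pi> q)) i))"
    \<comment> \<open>upper indices precede lower ones: \<open>Km q b a\<close> is \<open>K\<^sup>b\<^sub>a\<close>, \<open>K x a i j\<close> is \<open>K\<^sup>a\<^sub>i\<^sub>j\<close>, and so on\<close>
    and Km: "\<And>a q. a \<in> BG \<Longrightarrow> \<pi> q \<in> fst cX \<Longrightarrow> snd (\<psi> q) \<in> fst cG \<Longrightarrow>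
               Et a q = lincomb BG (\<lambda>b. Km q b a) (\<lambda>b. dG b q)"
    and A: "\<And>a q. a \<in> BG \<Longrightarrow> \<pi> q \<in> fst cX \<Longrightarrow> Eh a q = lincomb BG (\<lambda>b. A q b a) (\<lambda>b. Et b q)"
    and \<gamma>: "\<And>i q. i \<in> BX \<Longrightarrow> \<pi> q \<in> fst cX \<Longrightarrow>
               X i q = vsub (dX i q) (lincomb BG (\<lambda>b. \<gamma> (snd cX (\<pi> q)) b i) (\<lambda>b. Eh b q))"
    and \<Upsilon>: "\<And>i a q. i \<in> BX \<Longrightarrow> a \<in> BG \<Longrightarrow> \<pi> q \<in> fst cX \<Longrightarrow>
               lie_bracket AQ (X i) (Eh a) q = lincomb BG (\<lambda>b. \<Upsilon> (snd cX (\<pi> q)) b i a) (\<lambda>b. Eh b q)"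
    and K: "\<And>i j q. i \<in> BX \<Longrightarrow> j \<in> BX \<Longrightarrow> \<pi> q \<in> fst cX \<Longrightarrow>
               lie_bracket AQ (X i) (X j) q = lincomb BG (\<lambda>a. - K (snd cX (\<pi> q)) a i j) (\<lambda>a. Eh a q)"
    \<comment> \<open>\<open>pt x h v w\<close> is the point of \<open>T1k AQ\<close> over \<open>(x, h)\<close> with \<open>v\<^sup>i\<^sub>\<alpha> = (v $ \<alpha>) \<bullet> i\<close>, \<open>w\<^sup>a\<^sub>\<alpha> = (w $ \<alpha>) \<bullet> a\<close>;
        \<open>vt p a \<alpha>\<close> is \<open>v\<^sup>a\<^sub>\<alpha>\<close> and \<open>lhat\<close> is \<open>l\<close> in the coordinates \<open>q\<^sup>i, v\<^sup>i\<^sub>\<alpha>, w\<^sup>a\<^sub>\<alpha>\<close>\<close>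
    and pt: "pt = (\<lambda>x h v w. let q = inv_into (\<pi> -` fst cX) \<psi> (inv_chart cX x, h) in
               (q, \<lambda>\<alpha>. vadd (lincomb BX (\<lambda>i. (v $ \<alpha>) \<bullet> i) (\<lambda>i. X i q))
                            (lincomb BG (\<lambda>a. (w $ \<alpha>) \<bullet> a) (\<lambda>a. Eh a q))))"
    and vt: "\<And>x h v w \<alpha>. x \<in> chart_image cX \<Longrightarrow>
               snd (pt x h v w) \<alpha> =
                 vadd (lincomb BX (\<lambda>i. (v $ \<alpha>) \<bullet> i) (\<lambda>i. X i (fst (pt x h v w))))
                      (lincomb BG (\<lambda>a. vt (pt x h v w) a \<alpha>) (\<lambda>a. Et a (fst (pt x h v w))))"
    and lhat: "\<And>x h v w. x \<in> chart_image cX \<Longrightarrow> lhat (x, v, w) = l (T1k_orbit AQ act (pt x h v w))"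
    \<comment> \<open>\<open>G\<close>-regularity and \<open>Bt p \<gamma> a \<alpha> i\<close>\<close>
    and gia: "gia = (\<lambda>p \<alpha> \<beta> i a. vlift BQ AQ (X i) \<alpha> (vlift BQ AQ (Et a) \<beta> L) p)"
    and gab: "gab = (\<lambda>p \<alpha> \<beta> a b. vlift BQ AQ (Et a) \<alpha> (vlift BQ AQ (Et b) \<beta> L) p)"
    and L_G_regular: "\<And>p. p \<in> T1k AQ \<Longrightarrow> nonsingular (UNIV \<times> BG) (\<lambda>(\<alpha>, a) (\<beta>, b). gab p \<alpha> \<beta> a b)"
    and ginv: "\<And>p b c \<beta> \<delta>. p \<in> T1k AQ \<Longrightarrow> b \<in> BG \<Longrightarrow> c \<in> BG \<Longrightarrow>
               (\<Sum>\<alpha>\<in>UNIV. \<Sum>a\<in>BG. gab p \<alpha> \<beta> a b * ginv p a c \<alpha> \<delta>) = (if \<beta> = \<delta> \<and> c = b then 1 else 0)"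
    and Bt: "Bt = (\<lambda>p \<delta> a \<alpha> i. \<Sum>\<beta>\<in>UNIV. \<Sum>b\<in>BG. ginv p b a \<beta> \<alpha> * gia p \<delta> \<beta> i b)"
    \<comment> \<open>(1) the Lagrange-Poincare field equations\<close>
    and D: "open D"
    and \<phi>_smooth: "smooth_on D \<phi>x" "smooth_on D \<phi>v" "smooth_on D \<phi>w" "\<And>t. t \<in> D \<Longrightarrow> \<phi>x t \<in> chart_image cX"
    and LP1: "\<And>t i \<alpha>. t \<in> D \<Longrightarrow> i \<in> BX \<Longrightarrow> pd (axis \<alpha> 1) (\<lambda>s. \<phi>x s \<bullet> i) t = (\<phi>v t $ \<alpha>) \<bullet> i"
    and LP2: "\<And>t i. t \<in> D \<Longrightarrow> i \<in> BX \<Longrightarrow>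
          (\<Sum>\<alpha>\<in>UNIV. pd (axis \<alpha> 1) (\<lambda>s. pd (0, axis \<alpha> i, 0) lhat (\<phi>x s, \<phi>v s, \<phi>w s)) t)
            - pd (i, 0, 0) lhat (\<phi>x t, \<phi>v t, \<phi>w t) =
          (\<Sum>\<beta>\<in>UNIV. \<Sum>b\<in>BG.
             ((\<Sum>j\<in>BX. K (\<phi>x t) b i j * ((\<phi>v t $ \<beta>) \<bullet> j)) - (\<Sum>c\<in>BG. \<Upsilon> (\<phi>x t) b i c * ((\<phi>w t $ \<beta>) \<bullet> c)))
             * pd (0, 0, axis \<beta> b) lhat (\<phi>x t, \<phi>v t, \<phi>w t))"
    and LP3: "\<And>t a. t \<in> D \<Longrightarrow> a \<in> BG \<Longrightarrow>
          (\<Sum>\<alpha>\<in>UNIV. pd (axis \<alpha> 1) (\<lambda>s. pd (0, 0, axis \<alpha> a) lhat (\<phi>x s, \<phi>v s, \<phi>w s)) t) =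
          (\<Sum>\<beta>\<in>UNIV. \<Sum>b\<in>BG.
             ((\<Sum>j\<in>BX. \<Upsilon> (\<phi>x t) b j a * ((\<phi>v t $ \<beta>) \<bullet> j)) - (\<Sum>c\<in>BG. C b a c * ((\<phi>w t $ \<beta>) \<bullet> c)))
             * pd (0, 0, axis \<beta> b) lhat (\<phi>x t, \<phi>v t, \<phi>w t))"
    \<comment> \<open>(2)\<close>
    and \<phi>h_smooth: "smooth_on D \<phi>h" "\<And>t. t \<in> D \<Longrightarrow> \<phi>h t \<in> chart_image cG"
    and \<phi>H: "\<phi>H = (\<lambda>t. pt (\<phi>x t) (inv_chart cG (\<phi>h t)) (\<phi>v t) (\<phi>w t))"
    and hor: "\<And>t a \<alpha>. t \<in> D \<Longrightarrow> a \<in> BG \<Longrightarrow>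
          pd (axis \<alpha> 1) (\<lambda>s. \<phi>h s \<bullet> a) t =
          - (\<Sum>i\<in>BX. \<Sum>\<delta>\<in>UNIV. ((\<phi>v t $ \<delta>) \<bullet> i) *
               (\<Sum>b\<in>BG. Km (fst (\<phi>H t)) a b *
                  ((\<Sum>c\<in>BG. \<gamma> (\<phi>x t) c i * A (fst (\<phi>H t)) b c) * (if \<delta> = \<alpha> then 1 else 0)
                   + Bt (\<phi>H t) \<delta> b \<alpha> i)))"
    \<comment> \<open>(3) the reconstruction equation\<close>
    and g_smooth: "smooth_map_on std_atlas AG D g"
    and reconstruction: "\<And>t \<alpha>. t \<in> D \<Longrightarrow>
          tmap AG AG (mul (inverse_of (g t))) (g t) (pushvec AG g t (axis \<alpha> 1)) =
          lincomb BG (\<lambda>a. vt (\<phi>H t) a \<alpha> + (\<Sum>i\<in>BX. \<Sum>\<delta>\<in>UNIV. ((\<phi>v t $ \<delta>) \<bullet> i) * Bt (\<phi>H t) \<delta> a \<alpha> i)) E"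
    \<comment> \<open>the reconstructed field\<close>
    and \<phi>: "\<phi> = (\<lambda>t. T1k_act AQ act (g t) (\<phi>H t))"
    and \<phi>Q: "\<phi>Q = fst \<circ> \<phi>"
  shows "smooth_map_on std_atlas AQ D \<phi>Q \<and>
    (\<forall>t\<in>D. \<phi> t = first_prolongation AQ \<phi>Q t) \<and>
    (\<forall>t\<in>D. \<forall>c\<in>charts_at AQ (\<phi>Q t). \<forall>a\<in>BQ.
       let f = snd c \<circ> \<phi>Q;
           z = (f t, \<chi> \<alpha>. pd (axis \<alpha> 1) f t);
           Lc = local_rep AQ c L
       in (\<Sum>\<alpha>\<in>UNIV. \<Sum>b\<in>BQ. pd (b, 0) (pd (0, axis \<alpha> a) Lc) z * (pd (axis \<alpha> 1) f t \<bullet> b))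
          + (\<Sum>\<alpha>\<in>UNIV. \<Sum>\<beta>\<in>UNIV. \<Sum>b\<in>BQ. pd (0, axis \<beta> b) (pd (0, axis \<alpha> a) Lc) z
               * (pd (axis \<alpha> 1) (pd (axis \<beta> 1) f) t \<bullet> b))
          = pd (a, 0) Lc z)"
proof -
  interpret trivialized_bundle BQ AQ BG AG mul one inverse_of act BX AX \<pi> H cX \<psi>
    by (rule trivialized_bundle.intro[OF Q G(1) action(1) quotient connection cX \<psi>])
  note ccG = admissible_is_chart[OF cG]
  have E_in: "E a \<in> TG" if "a \<in> BG" for a
    using E that by (simp add: tbasis_def)
  have Eh_eq: "Eh a q = Ehat (E a) q" for a q by (simp add: Eh Ehat_def)
  have X_eq: "X i q = hor_lift i q" for i q by (simp add: X hor_lift_def)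
  have dX_eq: "dX i q = lifted_coord i q" for i q by (simp add: dX lifted_coord_def)
  have XT: "X i q \<in> tangent_space AQ q" if "q \<in> PU" for i q
    unfolding X_eq by (rule hor_lift_props(1)[OF that])
  have EhT: "Eh a q \<in> tangent_space AQ q" if "q \<in> PU" "a \<in> BG" for a q
    unfolding Eh_eq by (rule Ehat_tangent[OF that(1) E_in[OF that(2)]])
  have Eh_act: "tmap AQ AQ (act h) q (Eh a q) = Eh a (act h q)" if "q \<in> PU" "a \<in> BG" for h a q
    unfolding Eh_eq by (rule Ehat_act[OF that(1) E_in[OF that(2)]])
  have lin_cong: "lincomb I r V = lincomb I r W" if "\<And>i. i \<in> I \<Longrightarrow> V i = W i"
    for I :: "'i set" and r and V W :: "'i \<Rightarrow> ('q,'e) tvec"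
    using that by (simp add: lincomb_def fun_eq_iff cong: sum.cong)
  \<comment> \<open>\<open>dX\<close> and \<open>Eh\<close> are invariant, and the coefficients
    \<open>\<gamma>\<close> depend only on the base point, which the action does not move.\<close>
  have X_act: "tmap AQ AQ (act h) q (X i q) = X i (act h q)" if q: "q \<in> PU" and i: "i \<in> BX" for h i q
  proof -
    have "tmap AQ AQ (act h) q (X i q) =
        vsub (dX i (act h q)) (lincomb BG (\<lambda>b. \<gamma> (snd cX (\<pi> q)) b i) (\<lambda>b. tmap AQ AQ (act h) q (Eh b q)))"
      using \<gamma>[OF i, of q] q lifted_coord_act[OF q, of h i]
      by (simp add: tmap_vsub[OF aQ aQ act_fixed_smooth UNIV_I] tmap_lincomb[OF aQ aQ act_fixed_smooth UNIV_I] dX_eq)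
    also have "\<dots> = X i (act h q)"
      using \<gamma>[OF i, of "act h q"] q lin_cong[of BG "\<lambda>b. tmap AQ AQ (act h) q (Eh b q)" "\<lambda>b. Eh b (act h q)"] Eh_act[OF q]
      by simp
    finally show ?thesis .
  qed
  \<comment> \<open>The velocity with frame components \<open>v\<close>, \<open>w\<close> at
    \<open>q\<close>. As the frame is invariant, the action carries it to the velocity with the same
    components at the translated point.\<close>
  define V where "V q v w \<alpha> = vadd (lincomb BX (\<lambda>i. (v $ \<alpha>) \<bullet> i) (\<lambda>i. X i q)) (lincomb BG (\<lambda>a. (w $ \<alpha>) \<bullet> a) (\<lambda>a. Eh a q))"
    for q and v :: "'b^'k" and w :: "'h^'k" and \<alpha>
  have VT: "V q v w \<alpha> \<in> tangent_space AQ q" if "q \<in> PU" for q v w \<alpha>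
    unfolding V_def by (rule vadd_in_tangent_space[OF aQ lincomb_in_tangent_space[OF aQ XT[OF that]]
          lincomb_in_tangent_space[OF aQ EhT[OF that]]])
  have V_act: "tmap AQ AQ (act h) q (V q v w \<alpha>) = V (act h q) v w \<alpha>" if q: "q \<in> PU" for h q v w \<alpha>
    unfolding V_def tmap_vadd[OF aQ aQ act_fixed_smooth UNIV_I] tmap_lincomb[OF aQ aQ act_fixed_smooth UNIV_I]
    by (rule arg_cong2[where f = vadd]; rule lin_cong) (rule X_act[OF q] Eh_act[OF q]; assumption)+
  have V_chart: "V q v w \<alpha> c = (\<Sum>i\<in>BX. ((v $ \<alpha>) \<bullet> i) *\<^sub>R X i q c) + (\<Sum>a\<in>BG. ((w $ \<alpha>) \<bullet> a) *\<^sub>R Eh a q c)" for q v w \<alpha> c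
    by (simp add: V_def vadd_def lincomb_def)
  \<comment> \<open>Every point over the chart domain is reached by \<open>pt\<close> at its own
    group component, so the base function \<open>lhat\<close> represents \<open>L\<close> at all
    points of the fibre.\<close>
  have lhat_L: "lhat (snd cX (\<pi> q), v, w) = L (q, V q v w)" if q: "q \<in> PU" for q v w
  proof -
    have x: "snd cX (\<pi> q) \<in> chart_image cX" using q by blast
    have "pt (snd cX (\<pi> q)) (snd (\<psi> q)) v w = (q, V q v w)"
      using section_at[OF q] by (simp add: pt V_def fun_eq_iff Let_def)
    then show ?thesis
      using lhat[OF x, of v w "snd (\<psi> q)"] l[of "(q, V q v w)"] VT[OF q] by (simp add: T1k_def)
  qed

  define q where "q t = \<psi>i (inv_chart cX (\<phi>x t), inv_chart cG (\<phi>h t))" for t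
  have \<phi>H_eq: "\<phi>H t = (q t, V (q t) (\<phi>v t) (\<phi>w t))" for t
    by (simp add: \<phi>H pt q_def V_def fun_eq_iff Let_def)
  have \<phi>_eq: "\<phi> t = (act (g t) (q t), \<lambda>\<alpha>. tmap AQ AQ (act (g t)) (q t) (V (q t) (\<phi>v t) (\<phi>w t) \<alpha>))" for t
    by (simp add: \<phi> \<phi>H_eq T1k_act_def)
  have \<phi>Q_eq: "\<phi>Q t = act (g t) (q t)" for t by (simp add: \<phi>Q \<phi>_eq)
  have xU: "inv_chart cX (\<phi>x t) \<in> fst cX" if "t \<in> D" for t
    by (rule is_chart_inv_in[OF ccX \<phi>_smooth(4)[OF that]])
  have qPU: "q t \<in> PU" if "t \<in> D" for t unfolding q_def by (rule \<psi>i_PU[OF xU[OF that]])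
  have \<pi>q: "\<pi> (q t) = inv_chart cX (\<phi>x t)" and \<psi>q: "snd (\<psi> (q t)) = inv_chart cG (\<phi>h t)" if "t \<in> D" for t
    using \<pi>_\<psi>i[OF xU[OF that]] \<psi>_\<psi>i[OF xU[OF that]] by (simp_all add: q_def)
  have x_eq: "snd cX (\<pi> (q t)) = \<phi>x t" if "t \<in> D" for t
    unfolding \<pi>q[OF that] by (rule is_chart_image[OF ccX \<phi>_smooth(4)[OF that]])
  have q_smooth: "smooth_map_on std_atlas AQ D q"
    unfolding q_def by (rule local_curve_smooth[OF \<phi>_smooth(1) _ \<phi>h_smooth(1) _ cG D]) (use \<phi>_smooth(4) \<phi>h_smooth(2) in blast)+
  have \<phi>Q_smooth: "smooth_map_on std_atlas AQ D \<phi>Q"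
    using act_smooth[OF std_atlas_is_chart g_smooth q_smooth] by (simp add: \<phi>Q_eq[abs_def])
  have \<phi>QPU: "\<phi>Q t \<in> PU" if "t \<in> D" for t using qPU[OF that] by (simp add: \<phi>Q_eq)

  have prolong: "pushvec AQ \<phi>Q t (axis \<alpha> 1) = V (\<phi>Q t) (\<phi>v t) (\<phi>w t) \<alpha>" if t: "t \<in> D" for t \<alpha>
  proof -
    let ?q = "q t"
    \<comment> \<open>The correction shared by both equations: it enters the velocity of
      \<open>q\<close> with a minus sign and the reconstruction equation with a plus sign.\<close>
    define \<theta> where "\<theta> a = (\<Sum>i\<in>BX. \<Sum>\<delta>\<in>UNIV. ((\<phi>v t $ \<delta>) \<bullet> i) * Bt (\<phi>H t) \<delta> a \<alpha> i)" for a
    have dx: "\<phi>x differentiable (at t)" and dh: "\<phi>h differentiable (at t)"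
      using smooth_on_differentiable \<phi>_smooth(1) \<phi>h_smooth(1) t by blast+
    have pdx: "pd (axis \<alpha> 1) \<phi>x t \<bullet> i = (\<phi>v t $ \<alpha>) \<bullet> i" if "i \<in> BX" for i
      using LP1[OF t that, of \<alpha>] pd_bounded_linear[OF bounded_linear_inner_left dx] by simp
    have pdh: "pd (axis \<alpha> 1) \<phi>h t \<bullet> a = pd (axis \<alpha> 1) (\<lambda>s. \<phi>h s \<bullet> a) t" for a
      using pd_bounded_linear[OF bounded_linear_inner_left dh] by simp
    have dG_eq: "dG a ?q = pushvec AQ (\<lambda>y. \<psi>i (\<pi> ?q, inv_chart cG y)) (snd cG (snd (\<psi> ?q))) a" for a
      by (simp add: dG)
    have hG: "snd (\<psi> ?q) \<in> fst cG" using \<psi>q[OF t] is_chart_inv_in[OF ccG \<phi>h_smooth(2)[OF t]] by simp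
    have vq: "pushvec AQ q t (axis \<alpha> 1) = vadd (lincomb BX (\<lambda>i. pd (axis \<alpha> 1) \<phi>x t \<bullet> i) (\<lambda>i. dX i ?q))
        (lincomb BG (\<lambda>a. pd (axis \<alpha> 1) \<phi>h t \<bullet> a) (\<lambda>a. dG a ?q))"
      unfolding dX_eq dG_eq unfolding q_def
      by (rule pushvec_local_curve[OF dx \<phi>_smooth(4)[OF t] dh \<phi>h_smooth(2)[OF t] cG])
    have vq': "pushvec AQ q t (axis \<alpha> 1) =
        vsub (lincomb BX (\<lambda>i. (\<phi>v t $ \<alpha>) \<bullet> i) (\<lambda>i. X i ?q)) (lincomb BG \<theta> (\<lambda>a. Et a ?q))"
    proof
      fix c
      have "(\<Sum>i\<in>BX. (\<phi>v t $ \<alpha> \<bullet> i) *\<^sub>R dX i ?q c) + (\<Sum>a\<in>BG. (pd (axis \<alpha> 1) (\<lambda>s. \<phi>h s \<bullet> a) t) *\<^sub>R dG a ?q c) =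
          (\<Sum>i\<in>BX. (\<phi>v t $ \<alpha> \<bullet> i) *\<^sub>R X i ?q c) - (\<Sum>b\<in>BG. \<theta> b *\<^sub>R Et b ?q c)"
        unfolding \<theta>_def
      proof (rule horizontal_velocity[where \<gamma> = "\<gamma> (\<phi>x t)" and A = "A ?q" and Km = "Km ?q" and Eh = "\<lambda>a. Eh a ?q c"])
        show "finite BG" by (rule coord_basis_finite[OF bG])
        show "X i ?q c = dX i ?q c - (\<Sum>b\<in>BG. \<gamma> (\<phi>x t) b i *\<^sub>R Eh b ?q c)" if "i \<in> BX" for i
          using \<gamma>[OF that, of ?q] qPU[OF t] x_eq[OF t] by (simp add: vsub_def lincomb_def)
        show "Eh b ?q c = (\<Sum>a\<in>BG. A ?q a b *\<^sub>R Et a ?q c)" if "b \<in> BG" for b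
          using A[OF that, of ?q] qPU[OF t] by (simp add: lincomb_def)
        show "Et b ?q c = (\<Sum>a\<in>BG. Km ?q a b *\<^sub>R dG a ?q c)" if "b \<in> BG" for b
          using Km[OF that, of ?q] qPU[OF t] hG by (simp add: lincomb_def)
        show "pd (axis \<alpha> 1) (\<lambda>s. \<phi>h s \<bullet> a) t = - (\<Sum>i\<in>BX. \<Sum>\<delta>\<in>UNIV. (\<phi>v t $ \<delta> \<bullet> i) *
            (\<Sum>b\<in>BG. Km ?q a b * ((\<Sum>c\<in>BG. \<gamma> (\<phi>x t) c i * A ?q b c) * (if \<delta> = \<alpha> then 1 else 0) + Bt (\<phi>H t) \<delta> b \<alpha> i)))"
          if "a \<in> BG" for a
          using hor[OF t that, of \<alpha>] by (simp add: \<phi>H_eq)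
      qed
      then show "pushvec AQ q t (axis \<alpha> 1) c =
          vsub (lincomb BX (\<lambda>i. (\<phi>v t $ \<alpha>) \<bullet> i) (\<lambda>i. X i ?q)) (lincomb BG \<theta> (\<lambda>a. Et a ?q)) c"
        unfolding vq by (simp add: vadd_def vsub_def lincomb_def pdx pdh cong: sum.cong)
    qed
    have act_q: "smooth_map_on AG AQ UNIV (\<lambda>k. act k ?q)"
      by (rule act_smooth[OF cGG smooth_map_on_id[OF aG open_UNIV] smooth_map_on_const[OF cGG open_UNIV]])
    have vg: "tmap AG AQ (\<lambda>k. act k ?q) one (tmap AG AG (mul (inverse_of (g t))) (g t) (pushvec AG g t (axis \<alpha> 1))) =
        lincomb BG (\<lambda>a. vt (\<phi>H t) a \<alpha> + \<theta> a) (\<lambda>a. Et a ?q)"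
      unfolding reconstruction[OF t] tmap_lincomb[OF aG aQ act_q UNIV_I] by (simp add: \<theta>_def Et fundamental_field_def)
    \<comment> \<open>The vertical part is expressed in fundamental fields, because differentiating
      the action of \<open>g\<close> produces multiples of these and not of
      \<open>Eh\<close>.\<close>
    have V_Et: "V ?q (\<phi>v t) (\<phi>w t) \<alpha> =
        vadd (lincomb BX (\<lambda>i. (\<phi>v t $ \<alpha>) \<bullet> i) (\<lambda>i. X i ?q)) (lincomb BG (\<lambda>a. vt (\<phi>H t) a \<alpha>) (\<lambda>a. Et a ?q))"
      using vt[OF \<phi>_smooth(4)[OF t], of "inv_chart cG (\<phi>h t)" "\<phi>v t" "\<phi>w t" \<alpha>] \<phi>H_eq[of t] unfolding \<phi>H by simp
    have "vadd (lincomb BG (\<lambda>a. vt (\<phi>H t) a \<alpha> + \<theta> a) (\<lambda>a. Et a ?q)) (pushvec AQ q t (axis \<alpha> 1)) = V ?q (\<phi>v t) (\<phi>w t) \<alpha>"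
      unfolding vq' V_Et by (simp add: vadd_def vsub_def lincomb_def fun_eq_iff scaleR_add_left sum.distrib)
    moreover have "pushvec AQ \<phi>Q t (axis \<alpha> 1) = pushvec AQ (\<lambda>s. act (g s) (q s)) t (axis \<alpha> 1)"
      by (simp add: \<phi>Q_eq[abs_def])
    ultimately show ?thesis
      using pushvec_act_curve[OF coord_basis_Basis g_smooth q_smooth t, of "axis \<alpha> 1"] vg V_act[OF qPU[OF t]]
      by (simp add: \<phi>Q_eq)
  qed
  have part2: "\<phi> t = first_prolongation AQ \<phi>Q t" if t: "t \<in> D" for t
    using prolong[OF t] V_act[OF qPU[OF t]] by (simp add: \<phi>_eq first_prolongation_def \<phi>Q_eq fun_eq_iff)

  have part3: "euler_lagrange BQ (local_rep AQ c L) (\<lambda>s. snd c (\<phi>Q s)) t a = 0"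
    if t: "t \<in> D" and c: "c \<in> charts_at AQ (\<phi>Q t)" and a: "a \<in> BQ" for t c a
  proof -
    note ic = inv_chart_at[OF c]
    note cc = admissible_is_chart[OF ic(4)]
    define \<Omega> where "\<Omega> = PU_image c"
    define f where "f s = snd c (\<phi>Q s)" for s
    define Lc where "Lc = (local_rep AQ c L :: 'e \<times> ('e^'k) \<Rightarrow> real)"
    define Xc where "Xc i z = X i (inv_chart c z) c" for i z
    define Ec where "Ec a z = Eh a (inv_chart c z) c" for a z
    define \<xi> where "\<xi> z = snd cX (\<pi> (inv_chart c z))" for z
    define W where "W = D \<inter> \<phi>Q -` fst c"
    have zin: "inv_chart c z \<in> fst c" "inv_chart c z \<in> PU" "snd c (inv_chart c z) = z" "c \<in> charts_at AQ (inv_chart c z)"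
      "z \<in> chart_image c" if "z \<in> \<Omega>" for z
      using chart_PU_in[OF ic(4)] that unfolding \<Omega>_def by auto
    have \<Omega>: "open \<Omega>" unfolding \<Omega>_def by (rule chart_PU_open[OF ic(4)])
    have Lc: "smooth_on (\<Omega> \<times> UNIV) Lc"
      unfolding Lc_def by (rule smooth_on_subset[OF smooth_on_local_rep[OF aQ L_smooth ic(4)]]) (use zin in auto)
    have dXc: "Xc i differentiable (at z)" if "z \<in> \<Omega>" for i z
      using smooth_on_differentiable[OF hor_lift_smooth[OF ic(4), of i]] that by (simp add: Xc_def[abs_def] X_eq \<Omega>_def)
    have dEc: "Ec b differentiable (at z)" if "z \<in> \<Omega>" "b \<in> BG" for b z
      using smooth_on_differentiable[OF Ehat_smooth[OF ic(4) E_in[OF that(2)]]] that by (simp add: Ec_def[abs_def] Eh_eq \<Omega>_def)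
    have d\<xi>: "\<xi> differentiable (at z)" if z: "z \<in> \<Omega>" for z
      unfolding \<xi>_def
      by (rule smooth_on_differentiable[OF base_coordinate_smooth[OF ic(4)]]) (use z \<Omega>_def in simp)
    have Lc_V: "lhat (\<xi> z, v, w) = Lc (z, \<chi> \<alpha>. (\<Sum>i\<in>BX. ((v $ \<alpha>) \<bullet> i) *\<^sub>R Xc i z) + (\<Sum>a\<in>BG. ((w $ \<alpha>) \<bullet> a) *\<^sub>R Ec a z))"
      if z: "z \<in> \<Omega>" for z v w
      using lhat_L[OF zin(2)[OF z], of v w] local_rep_eq[OF VT[OF zin(2)[OF z], of v w] zin(4)[OF z], of L] zin(3)[OF z]
      by (simp add: \<xi>_def Lc_def V_chart Xc_def Ec_def)
    \<comment> \<open>The section \<open>\<sigma>\<close> of \<open>\<xi>\<close> through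
      \<open>z\<close>, with frozen group component, exhibits \<open>lhat\<close> near the point as
      \<open>Lc\<close> evaluated on differentiable data.\<close>
    have dlhat: "lhat differentiable (at (\<xi> z, v, w))" if z: "z \<in> \<Omega>" for z v w
    proof -
      let ?q = "inv_chart c z"
      define \<sigma> where "\<sigma> x = snd c (\<psi>i (inv_chart cX x, snd (\<psi> ?q)))" for x
      define N where "N = chart_image cX \<inter> (\<lambda>x. \<psi>i (inv_chart cX x, snd (\<psi> ?q))) -` fst c"
      have N: "open N" and \<sigma>: "smooth_on N \<sigma>"
        unfolding N_def \<sigma>_def by (rule smooth_map_on_coords[OF aQ section_smooth ic(4)])+
      have \<sigma>\<xi>: "\<sigma> (\<xi> z) = z" using section_at[OF zin(2)[OF z]] zin(3)[OF z] by (simp add: \<sigma>_def \<xi>_def)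
      have \<xi>N: "\<xi> z \<in> N"
        using section_at[OF zin(2)[OF z]] zin[OF z] by (simp add: N_def \<xi>_def)
      have \<sigma>\<Omega>: "\<sigma> x \<in> \<Omega> \<and> \<xi> (\<sigma> x) = x" if "x \<in> N" for x
      proof -
        let ?p = "\<psi>i (inv_chart cX x, snd (\<psi> ?q))"
        have x: "x \<in> chart_image cX" and p: "?p \<in> fst c" using that by (auto simp: N_def)
        have U: "inv_chart cX x \<in> fst cX" by (rule is_chart_inv_in[OF ccX x])
        have "\<pi> ?p = inv_chart cX x" by (rule \<pi>_\<psi>i[OF U])
        then show ?thesis
          using p U is_chart_inv[OF cc p] is_chart_image[OF ccX x] by (auto simp: \<sigma>_def \<Omega>_def \<xi>_def)
      qed
      have oN: "open (N \<times> (UNIV :: (('b^'k) \<times> ('h^'k)) set))" by (rule open_Times[OF N open_UNIV])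
      show ?thesis
      proof (rule differentiable_cong_open[OF oN])
        show "(\<xi> z, v, w) \<in> N \<times> UNIV" using \<xi>N by simp
        show "(\<lambda>p :: 'b \<times> ('b^'k) \<times> ('h^'k). Lc (\<sigma> (fst p), \<chi> \<alpha>. (\<Sum>i\<in>BX. (fst (snd p) $ \<alpha> \<bullet> i) *\<^sub>R Xc i (\<sigma> (fst p)))
            + (\<Sum>a\<in>BG. (snd (snd p) $ \<alpha> \<bullet> a) *\<^sub>R Ec a (\<sigma> (fst p))))) differentiable (at (\<xi> z, v, w))"
          by (rule frame_differentiable) (use \<sigma>\<xi> z \<xi>N smooth_on_differentiable[OF \<sigma>] smooth_on_differentiable[OF Lc] dXc dEc in auto)
        show "Lc (\<sigma> (fst p), \<chi> \<alpha>. (\<Sum>i\<in>BX. (fst (snd p) $ \<alpha> \<bullet> i) *\<^sub>R Xc i (\<sigma> (fst p)))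
            + (\<Sum>a\<in>BG. (snd (snd p) $ \<alpha> \<bullet> a) *\<^sub>R Ec a (\<sigma> (fst p)))) = lhat p" if "p \<in> N \<times> UNIV" for p
          using Lc_V[of "\<sigma> (fst p)" "fst (snd p)" "snd (snd p)"] \<sigma>\<Omega>[of "fst p"] that by auto
      qed
    qed
    have \<xi>X: "pd (Xc i z) \<xi> z = i" if z: "z \<in> \<Omega>" for i z
    proof -
      let ?q = "inv_chart c z"
      have "pd (Xc i z) \<xi> z = tmap AQ AX \<pi> ?q (X i ?q) cX"
        using pd_base_coordinate[OF zin(4)[OF z] zin(2)[OF z] XT[OF zin(2)[OF z]], of i] zin(3)[OF z]
        by (simp add: Xc_def \<xi>_def[abs_def])
      also have "\<dots> = pushvec AX (inv_chart cX) (snd cX (\<pi> ?q)) i cX"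
        unfolding X_eq by (simp only: hor_lift_props(2)[OF zin(2)[OF z]])
      also have "\<dots> = i" by (rule pushvec_inv_chart[OF cX_at[OF zin(2)[OF z]]])
      finally show ?thesis .
    qed
    have \<xi>E: "pd (Ec b z) \<xi> z = 0" if z: "z \<in> \<Omega>" and b: "b \<in> BG" for b z
      using pd_base_coordinate[OF zin(4)[OF z] zin(2)[OF z] EhT[OF zin(2)[OF z] b]] zin(3)[OF z]
        tmap_\<pi>_Ehat[OF zin(2)[OF z] E_in[OF b]] by (simp add: Ec_def \<xi>_def[abs_def] Eh_eq)
    interpret fr: lagrangian_frame BQ BX BG Lc lhat \<Omega> Xc Ec \<xi>
      by (rule lagrangian_frame.intro[OF bQ bX bG \<Omega> Lc dXc dEc d\<xi> \<xi>X \<xi>E dlhat Lc_V])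
    let ?q = "\<phi>Q t"
    have W: "open W" "smooth_on W f" "t \<in> W"
      using smooth_map_on_coords[OF aQ \<phi>Q_smooth ic(4)] t ic(3) by (auto simp: W_def f_def[abs_def])
    \<comment> \<open>Translation by \<open>g s\<close> fixes the base coordinates, so the
      reconstructed curve still lies over \<open>\<phi>x\<close>, and the Lagrange-Poincare
      equations apply at its points.\<close>
    have fq: "inv_chart c (f s) = \<phi>Q s" "f s \<in> \<Omega>" "\<xi> (f s) = \<phi>x s" "c \<in> charts_at AQ (\<phi>Q s)" if "s \<in> W" for s
      using that is_chart_inv[OF cc, of "\<phi>Q s"] \<phi>QPU[of s] x_eq[of s] ic(4)
      by (auto simp: W_def f_def \<Omega>_def \<xi>_def \<phi>Q_eq charts_at_def)
    have vel: "(\<chi> \<alpha>. pd (axis \<alpha> 1) f s) = fr.vel (f s) (\<phi>v s) (\<phi>w s)" if s: "s \<in> W" for s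
    proof -
      have "pd (axis \<alpha> 1) f s = V (\<phi>Q s) (\<phi>v s) (\<phi>w s) \<alpha> c" for \<alpha>
        using prolong[of s \<alpha>] s pushvec_apply[of c AQ \<phi>Q s "axis \<alpha> 1"] fq(4)[OF s] by (simp add: W_def f_def[abs_def])
      then show ?thesis by (simp add: fr.vel_def V_chart Xc_def Ec_def fq(1)[OF s])
    qed
    have ft: "snd c ?q = f t" "inv_chart c (f t) = ?q" "?q \<in> PU" "snd cX (\<pi> ?q) = \<phi>x t"
      using fq[OF W(3)] \<phi>QPU[OF t] by (auto simp: f_def \<xi>_def)
    show ?thesis
      unfolding f_def[symmetric] Lc_def[symmetric]
    proof (rule fr.Euler_Lagrange_if_Lagrange_Poincare[OF W(1,3,2) _ vel fq(3) _ _ _ LP2[OF t] LP3[OF t] _ a])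
      show "f ` W \<subseteq> \<Omega>" using fq(2) by blast
      show "pd (Xc i (f t)) (Xc j) (f t) - pd (Xc j (f t)) (Xc i) (f t) = (\<Sum>b\<in>BG. (- K (\<phi>x t) b i j) *\<^sub>R Ec b (f t))"
        if "i \<in> BX" "j \<in> BX" for i j
        using fun_cong[OF K[OF that, of ?q], of c] ft c
        by (simp add: lie_bracket_def lincomb_def Xc_def[abs_def] Ec_def)
      show "pd (Xc i (f t)) (Ec b) (f t) - pd (Ec b (f t)) (Xc i) (f t) = (\<Sum>d\<in>BG. \<Upsilon> (\<phi>x t) d i b *\<^sub>R Ec d (f t))"
        if "i \<in> BX" "b \<in> BG" for i b
        using fun_cong[OF \<Upsilon>[OF that, of ?q], of c] ft c
        by (simp add: lie_bracket_def lincomb_def Xc_def[abs_def] Ec_def[abs_def])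
      show "pd (Ec b (f t)) (Ec d) (f t) - pd (Ec d (f t)) (Ec b) (f t) = (\<Sum>e\<in>BG. C e b d *\<^sub>R Ec e (f t))"
        if "b \<in> BG" "d \<in> BG" for b d
        using Ehat_bracket[OF c ft(3) E_in[OF that(1)] E_in[OF that(2)] E_in C[OF that]] ft
        by (simp add: Ec_def[abs_def] Eh_eq)
      show "\<exists>r s. d = (\<Sum>i\<in>BX. r i *\<^sub>R Xc i (f t)) + (\<Sum>a\<in>BG. s a *\<^sub>R Ec a (f t))" for d
      proof -
        obtain r s where d: "d = (\<Sum>i\<in>BX. r i *\<^sub>R lifted_coord i ?q c) + (\<Sum>a\<in>BG. s a *\<^sub>R Ehat (E a) ?q c)"
          using frame_spans[OF ft(3) c E] by blast
        \<comment> \<open>\<open>frame_spans\<close> speaks of coordinate fields. They differ from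
          \<open>X\<close> by vertical fields with coefficients \<open>\<gamma>\<close>, which are
          absorbed into the coefficients of \<open>Ec\<close>.\<close>
        have "lifted_coord i ?q c = Xc i (f t) + (\<Sum>b\<in>BG. \<gamma> (\<phi>x t) b i *\<^sub>R Ec b (f t))" if "i \<in> BX" for i
          using fun_cong[OF \<gamma>[OF that, of ?q], of c] ft by (simp add: vsub_def lincomb_def Xc_def Ec_def dX_eq)
        then have "(\<Sum>i\<in>BX. r i *\<^sub>R lifted_coord i ?q c) =
            (\<Sum>i\<in>BX. r i *\<^sub>R Xc i (f t)) + (\<Sum>i\<in>BX. \<Sum>b\<in>BG. (r i * \<gamma> (\<phi>x t) b i) *\<^sub>R Ec b (f t))"
          by (simp add: scaleR_add_right scaleR_sum_right sum.distrib cong: sum.cong)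
        also have "(\<Sum>i\<in>BX. \<Sum>b\<in>BG. (r i * \<gamma> (\<phi>x t) b i) *\<^sub>R Ec b (f t)) = (\<Sum>b\<in>BG. (\<Sum>i\<in>BX. r i * \<gamma> (\<phi>x t) b i) *\<^sub>R Ec b (f t))"
          by (subst sum.swap) (simp only: scaleR_sum_left)
        finally have "d = (\<Sum>i\<in>BX. r i *\<^sub>R Xc i (f t)) + (\<Sum>b\<in>BG. ((\<Sum>i\<in>BX. r i * \<gamma> (\<phi>x t) b i) + s b) *\<^sub>R Ec b (f t))"
          unfolding d by (simp add: scaleR_add_left sum.distrib Ec_def Eh_eq ft(2))
        then show ?thesis by (intro exI)
      qed
    qed
  qed
  show ?thesis
  proof (intro conjI ballI)
    show "smooth_map_on std_atlas AQ D \<phi>Q" by (rule \<phi>Q_smooth)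
    show "\<phi> t = first_prolongation AQ \<phi>Q t" if "t \<in> D" for t by (rule part2[OF that])
  next
    fix t c a assume "t \<in> D" "c \<in> charts_at AQ (\<phi>Q t)" "a \<in> BQ"
    from part3[OF this] show "let f = snd c \<circ> \<phi>Q;
           z = (f t, \<chi> \<alpha>. pd (axis \<alpha> 1) f t);
           Lc = local_rep AQ c L
       in (\<Sum>\<alpha>\<in>UNIV. \<Sum>b\<in>BQ. pd (b, 0) (pd (0, axis \<alpha> a) Lc) z * (pd (axis \<alpha> 1) f t \<bullet> b))
          + (\<Sum>\<alpha>\<in>UNIV. \<Sum>\<beta>\<in>UNIV. \<Sum>b\<in>BQ. pd (0, axis \<beta> b) (pd (0, axis \<alpha> a) Lc) z
               * (pd (axis \<alpha> 1) (pd (axis \<beta> 1) f) t \<bullet> b))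
          = pd (a, 0) Lc z"
      by (simp add: euler_lagrange_def Let_def comp_def)
  qed
qed

end
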